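(* Let $\alpha,k\in[0,\infty)$, $\varphi\in Q$ and $W\in A_{p(\varphi)}$. Then there is a constant $C>0$ depending only on $\alpha,k,\varphi,W$ (in particular independent of $n$ and $f$) such that for every $f\in W^\alpha_{\varphi,W}$ and every $n\in\mathbb N$, $$E_n(f)_{\varphi,W}\le\frac{C}{n^\alpha}\,\Omega_k\left(f^{(\alpha)},\tfrac1n\right)_{\varphi,W}.$$
   Context: $\mathbb R^+=(0,\infty)$, $\mathbb N=\{1,2,\dots\}$, $\mathsf T=[0,2\pi]$; functions on $\mathsf T$ are regarded as $2\pi$-periodic functions on $\mathbb R$. Young functions: $\varphi:\mathbb R\to[0,\infty)$ is a Young function if it is even, continuous, increasing on $(0,\infty)$, $\varphi(0)=0$ and $\lim_{x\to\infty}\varphi(x)=\infty$. A function $\varphi$ on $[0,\infty)$ is quasiconvex if there are a convex Young function $\Phi$ and $C\ge1$ with $\Phi(x)\le\varphi(x)\le\Phi(Cx)$ for all $x\ge0$. A Young function satisfies $\Delta_2$ if for some $C>0$, $\varphi(2x)\le C\varphi(x)$ for all $x$. $Q$ is the class of Young functions $\varphi$ satisfying $\Delta_2$ such that $\varphi^\theta$ is quasiconvex for some $\theta\in(0,1)$. The index $p(\varphi)$ is defined by $\frac1{p(\varphi)}=\inf\{p>0:\varphi^p\text{ is quasiconvex}\}$. Weights: a weight is a measurable, a.e. positive, $2\pi$-periodic function $\omega$. For $1<p<\infty$, $\omega\in A_p$ if $\sup_J\left(\frac1{|J|}\int_J\omega\right)\left(\frac1{|J|}\int_J\omega^{1/(1-p)}\right)^{p-1}<\infty$,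 the supremum over all subintervals $J$. Orlicz space: $L_W^\varphi$ is the space of measurable $f:\mathsf T\to\mathbb R$ with $\int_{\mathsf T}\varphi(C|f|)W\,dx<\infty$ for some $C>0$, with norm $\|f\|_{\varphi,W}=\sup\{\int_{\mathsf T}|fg|W\,dx:\int_{\mathsf T}\tilde\varphi(|g|)W\,dx\le1\}$, where $\tilde\varphi(y)=\sup_{x\ge0}\{xy-\varphi(x)\}$, $y\ge0$. For $\varphi\in Q$, $W\in A_{p(\varphi)}$ one has $L_W^\varphi\subset L^1$. Modulus of smoothness: $\mathcal A_hf(x)=\frac1h\int_{-h/2}^{h/2}f(x+t)\,dt$ for $h>0$; for $k\in\mathbb R^+$, $(I-\mathcal A_h)^kf=\sum_{j=0}^\infty(-1)^j\binom kj\mathcal A_h^jf$ (convergent in $\|\cdot\|_{\varphi,W}$), where $\binom kj=\frac{\Gamma(k+1)}{\Gamma(j+1)\Gamma(k-j+1)}$ ($1/\Gamma$ being $0$ at poles of $\Gamma$); $\Omega_k(f,\delta)_{\varphi,W}=\sup_{0<h\le\delta}\|(I-\mathcal A_h)^kf\|_{\varphi,W}$ for $k>0$ and $\Omega_0(f,\delta)_{\varphi,W}=\|f\|_{\varphi,W}$. Best approximation: $E_n(f)_{\varphi,W}=\inf\{\|f-T\|_{\varphi,W}:T\in\mathcal T_n\}$, $\mathcal T_n$ the real trigonometric polynomials of degree at most $n$. Weyl derivative: with $a_j(f)=\frac1\pi\int_{\mathsf T}f\cos jx\,dx$, $b_j(f)=\frac1\pi\int_{\mathsf T}f\sin jx\,dx$,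 $f\in L_W^\varphi$ has Weyl derivative $f^{(\alpha)}$ of degree $\alpha>0$ if $\sum_{j=1}^\infty j^\alpha\left(a_j(f)\cos j\left(x+\frac{\alpha\pi}{2j}\right)+b_j(f)\sin j\left(x+\frac{\alpha\pi}{2j}\right)\right)$ is the Fourier series of the function $f^{(\alpha)}$. $W^\alpha_{\varphi,W}$ is the class of $f\in L_W^\varphi$ with $f^{(\alpha)}\in L_W^\varphi$; for $\alpha=0$, $f^{(0)}=f$ and $W^0_{\varphi,W}=L_W^\varphi$. *)

theory Defs
  imports "HOL-Analysis.Analysis"
begin

abbreviation torus :: "real set" where
  "torus \<equiv> {0..2 * pi}"

definition periodic :: "(real \<Rightarrow> real) \<Rightarrow> bool" where
  "periodic f \<longleftrightarrow> (\<forall>x. f (x + 2 * pi) = f x)"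


subsection \<open>Young functions\<close>

text \<open>"Increasing" is read as nondecreasing, which gives the larger class.\<close>

definition young :: "(real \<Rightarrow> real) \<Rightarrow> bool" where
  "young \<phi> \<longleftrightarrow>
     (\<forall>x. 0 \<le> \<phi> x) \<and> (\<forall>x. \<phi> (- x) = \<phi> x) \<and> continuous_on UNIV \<phi> \<and>
     mono_on {0<..} \<phi> \<and> \<phi> 0 = 0 \<and> filterlim \<phi> at_top at_top"

definition quasiconvex :: "(real \<Rightarrow> real) \<Rightarrow> bool" where
  "quasiconvex \<phi> \<longleftrightarrow>
     (\<exists>\<Phi> C. young \<Phi> \<and> convex_on UNIV \<Phi> \<and> 1 \<le> C \<and>
        (\<forall>x\<ge>0. \<Phi> x \<le> \<phi> x \<and> \<phi> x \<le> \<Phi> (C * x)))"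

definition Delta2 :: "(real \<Rightarrow> real) \<Rightarrow> bool" where
  "Delta2 \<phi> \<longleftrightarrow> (\<exists>C>0. \<forall>x. \<phi> (2 * x) \<le> C * \<phi> x)"

definition class_Q :: "(real \<Rightarrow> real) set" where
  "class_Q = {\<phi>. young \<phi> \<and> Delta2 \<phi> \<and>
     (\<exists>\<theta>. 0 < \<theta> \<and> \<theta> < 1 \<and> quasiconvex (\<lambda>x. \<phi> x powr \<theta>))}"

text \<open>For members of \<open>class_Q\<close> the infimum lies strictly between 0 and 1.\<close>

definition young_index :: "(real \<Rightarrow> real) \<Rightarrow> real" where
  "young_index \<phi> = 1 / Inf {p. 0 < p \<and> quasiconvex (\<lambda>x. \<phi> x powr p)}"

text \<open>The expression under the supremum vanishes at \<open>x = 0\<close>, so the truncation of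
  negative values by \<^const>\<open>ennreal\<close> does not change the supremum.\<close>

definition complementary :: "(real \<Rightarrow> real) \<Rightarrow> real \<Rightarrow> ennreal" where
  "complementary \<phi> y = (SUP x\<in>{0..}. ennreal (x * y - \<phi> x))"


subsection \<open>Weights\<close>

definition weight :: "(real \<Rightarrow> real) \<Rightarrow> bool" where
  "weight w \<longleftrightarrow>
     w \<in> borel_measurable lebesgue \<and> periodic w \<and> (AE x in lebesgue. 0 < w x)"

text \<open>The intervals are all bounded intervals of the real line, on which weights live as
  periodic functions; in particular they may cross multiples of \<open>2 * pi\<close>.  Finiteness of
  the supremum includes finiteness of the two integrals, since both are positive.\<close>

definition muckenhoupt :: "real \<Rightarrow> (real \<Rightarrow> real) set" where
  "muckenhoupt p = {w. weight w \<and>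
     (\<forall>a b. a < b \<longrightarrow>
        set_integrable lebesgue {a..b} w \<and>
        set_integrable lebesgue {a..b} (\<lambda>x. w x powr (1 / (1 - p)))) \<and>
     (\<exists>B. \<forall>a b. a < b \<longrightarrow>
        (1 / (b - a) * (LINT x:{a..b}|lebesgue. w x)) *
        (1 / (b - a) * (LINT x:{a..b}|lebesgue. w x powr (1 / (1 - p)))) powr (p - 1) \<le> B)}"


subsection \<open>Weighted Orlicz spaces\<close>

definition orlicz_space :: "(real \<Rightarrow> real) \<Rightarrow> (real \<Rightarrow> real) \<Rightarrow> (real \<Rightarrow> real) set" where
  "orlicz_space \<phi> W = {f. f \<in> borel_measurable lebesgue \<and> periodic f \<and>
     (\<exists>C>0. (\<integral>\<^sup>+ x. ennreal (\<phi> (C * \<bar>f x\<bar>) * W x) \<partial>lebesgue_on torus) < \<infinity>)}"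

definition orlicz_norm ::
    "(real \<Rightarrow> real) \<Rightarrow> (real \<Rightarrow> real) \<Rightarrow> (real \<Rightarrow> real) \<Rightarrow> ennreal" where
  "orlicz_norm \<phi> W f =
     (SUP g\<in>{g. g \<in> borel_measurable (lebesgue_on torus) \<and>
               (\<integral>\<^sup>+ x. complementary \<phi> \<bar>g x\<bar> * ennreal (W x) \<partial>lebesgue_on torus) \<le> 1}.
        \<integral>\<^sup>+ x. ennreal (\<bar>f x * g x\<bar> * W x) \<partial>lebesgue_on torus)"


subsection \<open>Modulus of smoothness\<close>

definition steklov :: "real \<Rightarrow> (real \<Rightarrow> real) \<Rightarrow> real \<Rightarrow> real" where
  "steklov h f x = 1 / h * (LINT t:{- h / 2..h / 2}|lebesgue. f (x + t))"

text \<open>The sum of the binomial series for the \<open>k\<close>-th power of \<open>I - steklov h\<close>, as a limit in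
  the Orlicz norm; it is unique up to null sets, so its norm does not depend on the choice.
  By \<open>gbinomial_Gamma\<close>, \<open>k gchoose j\<close> is the quotient of Gamma values for \<open>k > 0\<close>.\<close>

definition frac_difference ::
    "(real \<Rightarrow> real) \<Rightarrow> (real \<Rightarrow> real) \<Rightarrow> real \<Rightarrow> real \<Rightarrow> (real \<Rightarrow> real) \<Rightarrow> real \<Rightarrow> real" where
  "frac_difference \<phi> W k h f =
     (SOME g. g \<in> orlicz_space \<phi> W \<and>
        (\<lambda>N. orlicz_norm \<phi> W
           (\<lambda>x. (\<Sum>j<N. (- 1) ^ j * (k gchoose j) * (steklov h ^^ j) f x) - g x))
          \<longlonglongrightarrow> 0)"

definition smoothness_modulus ::
    "(real \<Rightarrow> real) \<Rightarrow> (real \<Rightarrow> real) \<Rightarrow> real \<Rightarrow> (real \<Rightarrow> real) \<Rightarrow> real \<Rightarrow> ennreal" where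
  "smoothness_modulus \<phi> W k f \<delta> =
     (if k = 0 then orlicz_norm \<phi> W f
      else (SUP h\<in>{0<..\<delta>}. orlicz_norm \<phi> W (frac_difference \<phi> W k h f)))"


subsection \<open>Best approximation\<close>

definition trig_polys :: "nat \<Rightarrow> (real \<Rightarrow> real) set" where
  "trig_polys n =
     {T. \<exists>c a b. T = (\<lambda>x. c + (\<Sum>j=1..n. a j * cos (real j * x) + b j * sin (real j * x)))}"

definition best_approx ::
    "(real \<Rightarrow> real) \<Rightarrow> (real \<Rightarrow> real) \<Rightarrow> nat \<Rightarrow> (real \<Rightarrow> real) \<Rightarrow> ennreal" where
  "best_approx \<phi> W n f = (INF T\<in>trig_polys n. orlicz_norm \<phi> W (\<lambda>x. f x - T x))"


subsection \<open>Weyl derivatives\<close>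

definition fourier_cos :: "(real \<Rightarrow> real) \<Rightarrow> nat \<Rightarrow> real" where
  "fourier_cos f j = 1 / pi * (LINT x:torus|lebesgue. f x * cos (real j * x))"

definition fourier_sin :: "(real \<Rightarrow> real) \<Rightarrow> nat \<Rightarrow> real" where
  "fourier_sin f j = 1 / pi * (LINT x:torus|lebesgue. f x * sin (real j * x))"

text \<open>A series is the Fourier series of \<open>g\<close> when the terms of each frequency agree; the
  differentiated series has no constant term.  As a derivative is determined only up to null
  sets, it is a relation; any \<open>g\<close> related to \<open>f\<close> is a version of the derivative.\<close>

definition has_weyl_derivative ::
    "(real \<Rightarrow> real) \<Rightarrow> real \<Rightarrow> (real \<Rightarrow> real) \<Rightarrow> bool" where
  "has_weyl_derivative f \<alpha> g \<longleftrightarrow>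
     (if \<alpha> = 0 then g = f
      else g \<in> borel_measurable lebesgue \<and> periodic g \<and> set_integrable lebesgue torus g \<and>
        fourier_cos g 0 = 0 \<and>
        (\<forall>j\<ge>1. \<forall>x. fourier_cos g j * cos (real j * x) + fourier_sin g j * sin (real j * x) =
           real j powr \<alpha> *
             (fourier_cos f j * cos (real j * (x + \<alpha> * pi / (2 * real j))) +
              fourier_sin f j * sin (real j * (x + \<alpha> * pi / (2 * real j))))))"

definition weyl_class :: "(real \<Rightarrow> real) \<Rightarrow> (real \<Rightarrow> real) \<Rightarrow> real \<Rightarrow> (real \<Rightarrow> real) set" where
  "weyl_class \<phi> W \<alpha> =
     {f \<in> orlicz_space \<phi> W. \<exists>g\<in>orlicz_space \<phi> W. has_weyl_derivative f \<alpha> g}"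

end

theory Submission
  imports Defs
begin

text \<open>
  All operators are bounded by duality.  If \<open>W\<close> satisfies the \<open>A\<^sub>p\<close> condition for \<open>p = p(\<phi>)\<close>, the
  reverse Hoelder inequality gives \<open>A\<^sub>q\<close> for all \<open>q < p\<close> close to \<open>p\<close>, and for such \<open>q\<close> the function
  \<open>\<phi>\<close> grows at least like the \<open>q\<close>-th power up to dilation.  On one interval Jensen's inequality then
  yields a modular inequality for the adjoint of averaging, so averages over intervals are
  bounded on the space, uniformly in the length; hence so is convolution with any kernel
  bounded by \<open>min(N, 1 / (N t\<^sup>2))\<close>, which is a superposition of averages.

  Let \<open>h = 1 / n\<close> and \<open>F = (I - A\<^sub>h)\<^sup>k f\<^sup>(\<^sup>\<alpha>\<^sup>)\<close>.  On frequencies above \<open>n\<close> the inverse of \<open>(I - A\<^sub>h)\<^sup>k\<close> is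
  \<open>I + k A\<^sub>h\<close> plus a multiplier whose symbol and second derivative decay quadratically, and
  fractional integration is a dyadic sum of multipliers of size \<open>(2\<^sup>i n)\<close> to the power \<open>-\<alpha>\<close>.  Summation by
  parts puts all these kernels in the class above.  Applied to \<open>F\<close> they give a function that differs
  from \<open>f\<close> by one with spectrum in \<open>[0, n]\<close>, that is, by a trigonometric polynomial.
\<close>

subsection \<open>Reverse Hoelder inequality for Muckenhoupt weights\<close>

text \<open>The norm is itself a supremum over a dual modular ball, so an averaging operator is
  bounded as soon as its adjoint maps that ball into a multiple of itself; neither a maximal
  function nor interpolation enters. The obstacle is that the index p(\<phi>) stems from an infimum
  which need not be attained: growth of \<phi> may be available only for exponents q < p(\<phi>),
  and this is why the weight condition has to be improved below p(\<phi>). All kernels are estimated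
  through their absolute values, so each multiplier must have a kernel with an integrable decreasing
  majorant. This shapes the two symbols. The symbol of the inverse of (I - A_h)^k tends to 1 at
  infinity with an error of order 1/x only; subtracting its first two Taylor terms, which are the
  identity and k A_h, leaves a quadratically decaying rest. The phase of the fractional integral is
  put into cosines cos(j t + g), so no conjugate function appears: summation by parts is insensitive
  to the phase when the zeroth coefficient vanishes. The singularity of both symbols at 0 is
  harmless because frequencies up to n may be altered freely.\<close>

text \<open>The Calderon-Zygmund stopping intervals down to depth \<open>n\<close>; \<open>b\<close> marks the intervals on which the
  average exceeds the threshold.\<close>

primrec stopped :: "(real \<Rightarrow> real \<Rightarrow> bool) \<Rightarrow> nat \<Rightarrow> real \<Rightarrow> real \<Rightarrow> real set" where
  "stopped b 0 u v = {}"
| "stopped b (Suc n) u v =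
     (if b u ((u + v) / 2) then {u..<(u + v) / 2} else stopped b n u ((u + v) / 2)) \<union>
     (if b ((u + v) / 2) v then {(u + v) / 2..<v} else stopped b n ((u + v) / 2) v)"

text \<open>The dyadic cells of generation exactly \<open>n\<close> that lie in \<open>U\<close>. As
  \<open>n\<close> grows they exhaust the part of an open \<open>U\<close> inside the interval; in
  \<open>weak_reverse_holder\<close> this takes the place of the Lebesgue differentiation
  theorem.\<close>

primrec dyadic_inner :: "real set \<Rightarrow> nat \<Rightarrow> real \<Rightarrow> real \<Rightarrow> real set" where
  "dyadic_inner U 0 u v = (if {u..<v} \<subseteq> U then {u..<v} else {})"
| "dyadic_inner U (Suc n) u v =
     dyadic_inner U n u ((u + v) / 2) \<union> dyadic_inner U n ((u + v) / 2) v"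

lemma stopped_subset: "u < v \<Longrightarrow> stopped b n u v \<subseteq> {u..<v}"
proof (induction n arbitrary: u v)
  case (Suc n)
  have "stopped b n u ((u + v) / 2) \<subseteq> {u..<(u + v) / 2}" "stopped b n ((u + v) / 2) v \<subseteq> {(u + v) / 2..<v}"
    using Suc by auto
  then show ?case using Suc.prems unfolding stopped.simps by (force split: if_splits)
qed auto

lemma dyadic_inner_subset: "u < v \<Longrightarrow> dyadic_inner U n u v \<subseteq> {u..<v} \<inter> U"
proof (induction n arbitrary: u v)
  case (Suc n)
  have "dyadic_inner U n u ((u + v) / 2) \<subseteq> {u..<(u + v) / 2} \<inter> U" "dyadic_inner U n ((u + v) / 2) v \<subseteq> {(u + v) / 2..<v} \<inter> U"
    using Suc by auto
  then show ?case using Suc.prems unfolding dyadic_inner.simps by force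
qed auto

lemma stopped_borel [measurable]: "stopped b n u v \<in> sets borel"
  by (induction n arbitrary: u v) auto

lemma dyadic_inner_borel [measurable]: "dyadic_inner U n u v \<in> sets borel"
  by (induction n arbitrary: u v) auto

lemma stopped_mono_Suc: "u < v \<Longrightarrow> stopped b n u v \<subseteq> stopped b (Suc n) u v"
proof (induction n arbitrary: u v)
  case (Suc n)
  let ?m = "(u + v) / 2"
  have "stopped b n u ?m \<subseteq> stopped b (Suc n) u ?m" "stopped b n ?m v \<subseteq> stopped b (Suc n) ?m v"
    using Suc by auto
  then show ?case
    unfolding stopped.simps(2)[of b "Suc n" u v] stopped.simps(2)[of b n u v] by (auto simp del: stopped.simps)
qed auto

lemma dyadic_inner_ball:
  assumes "u < v" "x \<in> {u..<v}" "{x - e<..<x + e} \<subseteq> U" "(v - u) / 2 ^ n < e"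
  shows "x \<in> dyadic_inner U n u v"
  using assms
proof (induction n arbitrary: u v)
  case 0
  have "{u..<v} \<subseteq> {x - e<..<x + e}" using 0 by auto
  then show ?case using 0 by auto
next
  case (Suc n)
  let ?m = "(u + v) / 2"
  have e: "(?m - u) / 2 ^ n < e" "(v - ?m) / 2 ^ n < e" using Suc.prems by (auto simp: field_simps)
  show ?case
  proof (cases "x < ?m")
    case True
    then have "x \<in> dyadic_inner U n u ?m" using Suc e by (intro Suc.IH) auto
    then show ?thesis by simp
  next
    case False
    then have "x \<in> dyadic_inner U n ?m v" using Suc e by (intro Suc.IH) auto
    then show ?thesis by simp
  qed
qed

text \<open>A stopped cell has an unmarked parent of twice its length, so its mass is at most 2 l
  times its length; by \<open>H\<close> at least half of its length lies in \<open>T\<close>. The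
  two factors 2 give the constant 4.\<close>

lemma stopped_estimate:
  fixes S :: "real measure" and l :: real
  assumes S: "sets S = sets borel" and T: "T \<in> sets borel" and l0: "0 \<le> l"
    and b: "\<And>u v. b u v \<longleftrightarrow> ennreal (l * (v - u)) < emeasure S {u..<v}"
    and H: "\<And>u v. u < v \<Longrightarrow> b u v \<Longrightarrow> ennreal ((v - u) / 2) \<le> emeasure lborel ({u..<v} \<inter> T)"
    and "u < v" "\<not> b u v"
  shows "emeasure S (stopped b n u v) \<le> ennreal (4 * l) * emeasure lborel (stopped b n u v \<inter> T)"
  using \<open>u < v\<close> \<open>\<not> b u v\<close>
proof (induction n arbitrary: u v)
  case (Suc n)
  note [measurable] = T
  have [measurable]: "{a..<c} \<in> sets S" "stopped b n a c \<in> sets S" for n and a c :: real using S by auto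
  let ?m = "(u + v) / 2"
  define A where "A = (if b u ?m then {u..<?m} else stopped b n u ?m)"
  define B where "B = (if b ?m v then {?m..<v} else stopped b n ?m v)"
  have m: "u < ?m" "?m < v" using Suc.prems by auto
  have *: "stopped b (Suc n) u v = A \<union> B" by (simp add: A_def B_def)
  have sub: "A \<subseteq> {u..<?m}" "B \<subseteq> {?m..<v}" using stopped_subset m by (auto simp: A_def B_def)
  have [measurable]: "A \<in> sets borel" "B \<in> sets borel" "A \<in> sets S" "B \<in> sets S" by (auto simp: A_def B_def)
  have half: "emeasure S {x..<y} \<le> ennreal (4 * l) * emeasure lborel ({x..<y} \<inter> T)"
    if "x < y" "b x y" "{x..<y} \<subseteq> {u..<v}" "v - u = 2 * (y - x)" for x y
  proof -
    have "emeasure S {x..<y} \<le> emeasure S {u..<v}" using that by (intro emeasure_mono) auto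
    also have "\<dots> \<le> ennreal (l * (v - u))" using Suc.prems b by (simp add: not_less)
    also have "\<dots> = ennreal (4 * l) * ennreal ((y - x) / 2)" 
      using that l0 by (subst ennreal_mult[symmetric]) auto
    also have "\<dots> \<le> ennreal (4 * l) * emeasure lborel ({x..<y} \<inter> T)" 
      using H[of x y] that by (intro mult_left_mono) auto
    finally show ?thesis .
  qed
  have a: "emeasure S A \<le> ennreal (4 * l) * emeasure lborel (A \<inter> T)"
  proof (cases "b u ?m")
    case True
    show ?thesis unfolding A_def if_P[OF True] using m True by (intro half) (auto simp: field_simps)
  next
    case False
    show ?thesis unfolding A_def if_not_P[OF False] by (rule Suc.IH[OF m(1) False])
  qed
  have bb: "emeasure S B \<le> ennreal (4 * l) * emeasure lborel (B \<inter> T)"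
  proof (cases "b ?m v")
    case True
    show ?thesis unfolding B_def if_P[OF True] using m True by (intro half) (auto simp: field_simps)
  next
    case False
    show ?thesis unfolding B_def if_not_P[OF False] by (rule Suc.IH[OF m(2) False])
  qed
  have "emeasure S (A \<union> B) \<le> emeasure S A + emeasure S B" by (intro emeasure_subadditive) auto
  also have "\<dots> \<le> ennreal (4 * l) * (emeasure lborel (A \<inter> T) + emeasure lborel (B \<inter> T))"
    using add_mono[OF a bb] by (simp add: distrib_left)
  also have "emeasure lborel (A \<inter> T) + emeasure lborel (B \<inter> T) = emeasure lborel (A \<inter> T \<union> B \<inter> T)"
    using sub by (intro plus_emeasure) force+
  also have "A \<inter> T \<union> B \<inter> T = (A \<union> B) \<inter> T" by auto
  finally show ?case unfolding * .
qed simp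

text \<open>What remains of the cells of generation \<open>n\<close> inside \<open>U\<close> is a
  disjoint union of unmarked cells, on each of which the average of \<open>S\<close> is at most
  \<open>l\<close>.\<close>

lemma unstopped_estimate:
  fixes S :: "real measure" and l :: real
  assumes S: "sets S = sets borel" and l0: "0 \<le> l"
    and b: "\<And>u v. b u v \<longleftrightarrow> ennreal (l * (v - u)) < emeasure S {u..<v}"
    and "u < v" "\<not> b u v"
  shows "emeasure S (dyadic_inner U n u v - stopped b n u v)
    \<le> ennreal l * emeasure lborel (dyadic_inner U n u v - stopped b n u v)"
  using \<open>u < v\<close> \<open>\<not> b u v\<close>
proof (induction n arbitrary: u v)
  case 0
  then have "emeasure S {u..<v} \<le> ennreal (l * (v - u))" using b by (simp add: not_less)
  then show ?case using 0 l0 by (auto simp: ennreal_mult)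
next
  case (Suc n)
  let ?m = "(u + v) / 2"
  define A where "A = dyadic_inner U n u ?m - (if b u ?m then {u..<?m} else stopped b n u ?m)"
  define B where "B = dyadic_inner U n ?m v - (if b ?m v then {?m..<v} else stopped b n ?m v)"
  have m: "u < ?m" "?m < v" using Suc.prems by auto
  have dis: "{u..<?m} \<inter> {?m..<v} = {}" by auto
  note subs = stopped_subset[OF m(1), of b n] stopped_subset[OF m(2), of b n]
    dyadic_inner_subset[OF m(1), of U n] dyadic_inner_subset[OF m(2), of U n]
  have *: "dyadic_inner U (Suc n) u v - stopped b (Suc n) u v = A \<union> B"
  proof -
    have "(X \<union> Y) - (P \<union> Q) = (X - P) \<union> (Y - Q)" if "X \<subseteq> {u..<?m}" "P \<subseteq> {u..<?m}" "Y \<subseteq> {?m..<v}" "Q \<subseteq> {?m..<v}"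
      for X Y P Q using that dis by blast
    moreover have "dyadic_inner U n u ?m \<subseteq> {u..<?m}" "dyadic_inner U n ?m v \<subseteq> {?m..<v}" using subs by blast+
    moreover have "(if b u ?m then {u..<?m} else stopped b n u ?m) \<subseteq> {u..<?m}"
      "(if b ?m v then {?m..<v} else stopped b n ?m v) \<subseteq> {?m..<v}"
      using subs(1,2) by (simp_all only: split: if_split) blast+
    ultimately show ?thesis
      unfolding A_def B_def dyadic_inner.simps stopped.simps by blast
  qed
  have sub: "A \<subseteq> {u..<?m}" "B \<subseteq> {?m..<v}" using subs by (auto simp: A_def B_def)
  have [measurable]: "A \<in> sets borel" "B \<in> sets borel" "A \<in> sets S" "B \<in> sets S" 
    using S by (auto simp: A_def B_def)
  have a: "emeasure S A \<le> ennreal l * emeasure lborel A"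
  proof (cases "b u ?m")
    case True then have "A = {}" using subs by (auto simp: A_def)
    then show ?thesis by simp
  next
    case False then show ?thesis using Suc.IH[OF m(1)] by (simp add: A_def)
  qed
  have bb: "emeasure S B \<le> ennreal l * emeasure lborel B"
  proof (cases "b ?m v")
    case True then have "B = {}" using subs by (auto simp: B_def)
    then show ?thesis by simp
  next
    case False then show ?thesis using Suc.IH[OF m(2)] by (simp add: B_def)
  qed
  have "emeasure S (A \<union> B) \<le> emeasure S A + emeasure S B" by (intro emeasure_subadditive) auto
  also have "\<dots> \<le> ennreal l * (emeasure lborel A + emeasure lborel B)"
    using add_mono[OF a bb] by (simp add: distrib_left)
  also have "emeasure lborel A + emeasure lborel B = emeasure lborel (A \<union> B)"
  proof (rule plus_emeasure)
    show "A \<inter> B = {}" using sub dis by blast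
  qed auto
  finally show ?case unfolding * .
qed

lemma dyadic_inner_mono_Suc: "u < v \<Longrightarrow> dyadic_inner U n u v \<subseteq> dyadic_inner U (Suc n) u v"
proof (induction n arbitrary: u v)
  case 0
  have "{u..<(u + v) / 2} \<subseteq> {u..<v}" "{(u + v) / 2..<v} \<subseteq> {u..<v}" "{u..<v} = {u..<(u + v) / 2} \<union> {(u + v) / 2..<v}"
    using 0 by auto
  then show ?case by simp
next
  case (Suc n)
  let ?m = "(u + v) / 2"
  have "dyadic_inner U n u ?m \<subseteq> dyadic_inner U (Suc n) u ?m" "dyadic_inner U n ?m v \<subseteq> dyadic_inner U (Suc n) ?m v"
    using Suc by auto
  then show ?case
    unfolding dyadic_inner.simps(2)[of U "Suc n" u v] dyadic_inner.simps(2)[of U n u v] by blast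
qed

text \<open>Off the stopped set \<open>D\<close> the density is at most \<open>l\<close> almost
  everywhere, so the mass of {\<sigma> > l} is carried by \<open>D\<close>, where
  \<open>stopped_estimate\<close> applies. The bound off \<open>D\<close> comes from outer
  regularity: an open neighbourhood is exhausted by dyadic cells, each either contained in the
  stopped set or of average at most \<open>l\<close>.\<close>

lemma weak_reverse_holder:
  fixes \<sigma> :: "real \<Rightarrow> real" and l c :: real
  assumes \<sigma> [measurable]: "\<sigma> \<in> borel_measurable borel" and nonneg: "\<And>x. 0 \<le> \<sigma> x" 
    and l0: "0 \<le> l" and "u < v"
    and avg: "emeasure (density lborel \<sigma>) {u..<v} \<le> ennreal (l * (v - u))"
    and H: "\<And>u v. u < v \<Longrightarrow> ennreal (l * (v - u)) < emeasure (density lborel \<sigma>) {u..<v} \<Longrightarrow> 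
         ennreal ((v - u) / 2) \<le> emeasure lborel ({u..<v} \<inter> {x. c * l < \<sigma> x})"
  shows "emeasure (density lborel \<sigma>) ({u..<v} \<inter> {x. l < \<sigma> x}) 
     \<le> ennreal (4 * l) * emeasure lborel ({u..<v} \<inter> {x. c * l < \<sigma> x})"
proof -
  define S where "S = density lborel (\<lambda>x. ennreal (\<sigma> x))"
  have sS [simp, measurable_cong]: "sets S = sets borel" by (simp add: S_def)
  define b where "b = (\<lambda>u v. ennreal (l * (v - u)) < emeasure S {u..<v})"
  define D where "D = (\<Union>n. stopped b n u v)"
  have [measurable]: "D \<in> sets borel" by (auto simp: D_def)
  have [measurable]: "{x. c * l < \<sigma> x} \<in> sets borel" "{x. l < \<sigma> x} \<in> sets borel" 
    using borel_measurable_less[of "\<lambda>_. c * l" borel \<sigma>] borel_measurable_less[of "\<lambda>_. l" borel \<sigma>] by simp_all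
  have nb: "\<not> b u v" using avg by (simp add: b_def S_def not_less)
  have inc: "incseq (\<lambda>n. stopped b n u v)" using \<open>u < v\<close> stopped_mono_Suc by (intro incseq_SucI) auto
  have Dsub: "D \<subseteq> {u..<v}" using stopped_subset[OF \<open>u < v\<close>] by (auto simp: D_def)
  have SD: "emeasure S D \<le> ennreal (4 * l) * emeasure lborel (D \<inter> {x. c * l < \<sigma> x})"
  proof -
    have "emeasure S D = (SUP n. emeasure S (stopped b n u v))"
      unfolding D_def using inc by (intro SUP_emeasure_incseq[symmetric]) auto
    also have "\<dots> \<le> ennreal (4 * l) * emeasure lborel (D \<inter> {x. c * l < \<sigma> x})"
    proof (rule SUP_least)
      fix n
      have "emeasure S (stopped b n u v) \<le> ennreal (4 * l) * emeasure lborel (stopped b n u v \<inter> {x. c * l < \<sigma> x})"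
        using H by (intro stopped_estimate[where b = b] nb l0 \<open>u < v\<close>) (auto simp: b_def S_def)
      also have "\<dots> \<le> ennreal (4 * l) * emeasure lborel (D \<inter> {x. c * l < \<sigma> x})"
        by (intro mult_left_mono emeasure_mono) (auto simp: D_def)
      finally show "emeasure S (stopped b n u v) \<le> \<dots>" .
    qed
    finally show ?thesis .
  qed
  have out: "emeasure S E \<le> ennreal l * emeasure lborel E" if [measurable]: "E \<in> sets borel" and "E \<subseteq> {u..<v} - D" for E
  proof -
    \<comment> \<open>Every point of E has a ball inside \<open>U\<close>, hence lies in a dyadic
      cell inside \<open>U\<close> of some generation; off \<open>D\<close> these cells are
      controlled by \<open>unstopped_estimate\<close>.\<close>
    have *: "emeasure S E \<le> ennreal l * emeasure lborel U" if "open U" "E \<subseteq> U" for U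
    proof -
      let ?d = "\<lambda>n. dyadic_inner U n u v"
      have [measurable]: "U \<in> sets borel" using that by auto
      have "E \<subseteq> (\<Union>n. ?d n - D)"
      proof
        fix x assume "x \<in> E"
        then have x: "x \<in> U" "x \<in> {u..<v}" "x \<notin> D" using that \<open>E \<subseteq> {u..<v} - D\<close> by auto
        obtain e where e: "e > 0" "ball x e \<subseteq> U" using \<open>open U\<close> x openE by blast
        obtain n where "(v - u) / e < 2 ^ n" using real_arch_pow[of 2] by auto
        then have "(v - u) / 2 ^ n < e" using e by (simp add: field_simps)
        then have "x \<in> ?d n" using e x \<open>u < v\<close> by (intro dyadic_inner_ball) (auto simp: ball_eq_greaterThanLessThan)
        then show "x \<in> (\<Union>n. ?d n - D)" using x by auto
      qed
      then have "emeasure S E \<le> emeasure S (\<Union>n. ?d n - D)" by (intro emeasure_mono) auto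
      also have "\<dots> = (SUP n. emeasure S (?d n - D))"
      proof (intro SUP_emeasure_incseq[symmetric] incseq_SucI)
        show "?d n - D \<subseteq> ?d (Suc n) - D" for n using dyadic_inner_mono_Suc[OF \<open>u < v\<close>, of U n] by blast
      qed auto
      also have "\<dots> \<le> ennreal l * emeasure lborel U"
      proof (rule SUP_least)
        fix n
        have "emeasure S (?d n - D) \<le> emeasure S (?d n - stopped b n u v)"
          by (intro emeasure_mono) (auto simp: D_def)
        also have "\<dots> \<le> ennreal l * emeasure lborel (?d n - stopped b n u v)"
          by (intro unstopped_estimate nb l0 \<open>u < v\<close>) (auto simp: b_def)
        also have "\<dots> \<le> ennreal l * emeasure lborel U"
          using dyadic_inner_subset[OF \<open>u < v\<close>] by (intro mult_left_mono emeasure_mono) auto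
        finally show "emeasure S (?d n - D) \<le> \<dots>" .
      qed
      finally show ?thesis .
    qed
    \<comment> \<open>The denominator \<open>l + 1\<close> instead of \<open>l\<close> allows
      \<open>l = 0\<close>: the excess of the open set over E costs l * e / (l + 1) \<le> e.\<close>
    have "emeasure S E \<le> ennreal l * emeasure lborel E + ennreal e" if "e > 0" for e
    proof -
      have el: "0 < e / (l + 1)" using that l0 by auto
      obtain U where U: "open U" "E \<subseteq> U" "emeasure lborel (U - E) < ennreal (e / (l + 1))"
        by (rule outer_regular_lborel[OF \<open>E \<in> sets borel\<close> el])
      have [measurable]: "U \<in> sets borel" using U by auto
      have "emeasure S E \<le> ennreal l * emeasure lborel (E \<union> (U - E))" using *[OF U(1,2)] U(2) by (simp add: Un_absorb1)
      also have "\<dots> \<le> ennreal l * (emeasure lborel E + emeasure lborel (U - E))"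
        by (intro mult_left_mono emeasure_subadditive) auto
      also have "\<dots> \<le> ennreal l * (emeasure lborel E + ennreal (e / (l + 1)))"
        using U by (intro mult_left_mono add_mono) auto
      also have "\<dots> = ennreal l * emeasure lborel E + ennreal (l * (e / (l + 1)))" 
        using l0 that by (simp add: distrib_left ennreal_mult[symmetric])
      also have "\<dots> \<le> ennreal l * emeasure lborel E + ennreal e"
        using l0 that by (intro add_mono ennreal_leI) (auto simp: field_simps)
      finally show ?thesis .
    qed
    then show ?thesis by (rule ennreal_le_epsilon)
  qed
  define E where "E = {u..<v} \<inter> {x. l < \<sigma> x} - D"
  have [measurable]: "E \<in> sets borel" by (simp add: E_def)
  \<comment> \<open>The density is at least l + 1 / (k + 1) on this set, while its mass is at most l
    times its length; as the length is finite, it is zero.\<close>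
  have "emeasure lborel ({u..<v} \<inter> {x. l + 1 / Suc k \<le> \<sigma> x} - D) = 0" (is "emeasure lborel ?E = 0") for k
  proof -
    have [measurable]: "?E \<in> sets borel" by measurable
    have fin: "emeasure lborel ?E < \<infinity>" 
      by (rule le_less_trans[OF emeasure_mono[of _ "{u..<v}"]]) (auto simp: \<open>u < v\<close> less_imp_le)
    have "ennreal (l + 1 / Suc k) * emeasure lborel ?E = (\<integral>\<^sup>+x. ennreal (l + 1 / Suc k) * indicator ?E x \<partial>lborel)"
      using \<open>?E \<in> sets borel\<close> by (intro nn_integral_cmult_indicator[symmetric]) simp
    also have "\<dots> \<le> (\<integral>\<^sup>+x. ennreal (\<sigma> x) * indicator ?E x \<partial>lborel)"
      by (intro nn_integral_mono) (auto split: split_indicator intro!: ennreal_leI)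
    also have "\<dots> = emeasure S ?E" unfolding S_def using \<open>?E \<in> sets borel\<close> by (intro emeasure_density[symmetric]) auto
    also have "\<dots> \<le> ennreal l * emeasure lborel ?E" by (rule out) auto
    finally have *: "ennreal (l + 1 / Suc k) * emeasure lborel ?E \<le> ennreal l * emeasure lborel ?E" .
    obtain r where r: "emeasure lborel ?E = ennreal r" "0 \<le> r" using fin by (metis ennreal_cases infinity_ennreal_def less_irrefl)
    have "(l + 1 / Suc k) * r \<le> l * r"
      using * l0 r by (simp add: ennreal_mult'[symmetric] del: ennreal_plus)
    then have "r \<le> 0" by (simp add: field_simps)
    then show ?thesis using r by simp
  qed
  then have "emeasure lborel (\<Union>k. {u..<v} \<inter> {x. l + 1 / Suc k \<le> \<sigma> x} - D) = 0"
    by (intro emeasure_UN_eq_0) auto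
  moreover have "E \<subseteq> (\<Union>k. {u..<v} \<inter> {x. l + 1 / Suc k \<le> \<sigma> x} - D)"
  proof
    fix x assume "x \<in> E"
    then have "0 < \<sigma> x - l" by (auto simp: E_def)
    then obtain k where "1 / Suc k < \<sigma> x - l" using nat_approx_posE by blast
    then show "x \<in> (\<Union>k. {u..<v} \<inter> {x. l + 1 / Suc k \<le> \<sigma> x} - D)"
      using \<open>x \<in> E\<close> by (auto simp: E_def intro!: exI[of _ k])
  qed
  moreover have "(\<Union>k. {u..<v} \<inter> {x. l + 1 / Suc k \<le> \<sigma> x} - D) \<in> sets lborel" by measurable
  ultimately have "E \<in> null_sets lborel"
    using \<open>E \<in> sets borel\<close> by (metis (no_types, lifting) null_setsI null_sets_subset sets_lborel)
  then have "emeasure S E = 0"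
    unfolding S_def by (simp add: emeasure_density nn_integral_null_set)
  have "emeasure S ({u..<v} \<inter> {x. l < \<sigma> x}) \<le> emeasure S (D \<union> E)"
    by (intro emeasure_mono) (auto simp: E_def)
  also have "\<dots> \<le> emeasure S D + emeasure S E" by (intro emeasure_subadditive) auto
  also have "\<dots> \<le> ennreal (4 * l) * emeasure lborel (D \<inter> {x. c * l < \<sigma> x})" using SD \<open>emeasure S E = 0\<close> by simp
  also have "\<dots> \<le> ennreal (4 * l) * emeasure lborel ({u..<v} \<inter> {x. c * l < \<sigma> x})"
    using Dsub by (intro mult_left_mono emeasure_mono) auto
  finally show ?thesis unfolding S_def .
qed

text \<open>The layer cake formula for the d-th power, started at height \<open>a\<close> instead of
  0: the distribution estimate is known only for levels above the average, and the levels below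
  contribute at most a^d.\<close>

lemma powr_layer_cake:
  fixes a s M d :: real
  assumes "0 < a" "0 \<le> s" "0 < d" "0 < M"
  shows "ennreal (min s M powr d) \<le> ennreal (a powr d) + 
     (\<integral>\<^sup>+l. ennreal (d * l powr (d - 1)) * indicator {a..M} l * indicator {..<s} l \<partial>lborel)"
proof (cases "min s M \<le> a")
  case True
  have "min s M powr d \<le> a powr d" using True assms by (intro powr_mono2) auto
  then show ?thesis by (metis add_increasing2 ennreal_leI zero_le)
next
  case False
  define m where "m = min s M"
  have m: "a < m" "m \<le> s" "m \<le> M" using False by (auto simp: m_def)
  have "(\<integral>\<^sup>+l. ennreal (d * l powr (d - 1)) * indicator {a..m} l \<partial>lborel) = ennreal (m powr d - a powr d)"
    using m assms
    by (intro nn_integral_FTC_Icc) (auto intro!: derivative_eq_intros)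
  moreover have "(\<integral>\<^sup>+l. ennreal (d * l powr (d - 1)) * indicator {a..m} l \<partial>lborel) \<le> 
     (\<integral>\<^sup>+l. ennreal (d * l powr (d - 1)) * indicator {a..M} l * indicator {..<s} l \<partial>lborel)"
    using m by (intro nn_integral_mono_AE eventually_mono[OF AE_lborel_singleton[of m]]) (auto split: split_indicator)
  moreover have "ennreal (m powr d) = ennreal (a powr d) + ennreal (m powr d - a powr d)"
    using m assms by (subst ennreal_plus[symmetric]) (auto intro!: powr_mono2)
  ultimately show ?thesis unfolding m_def[symmetric] by (simp add: add_left_mono)
qed

text \<open>The truncation at \<open>M\<close> makes the left-hand side finite, so that it can be absorbed.\<close>

lemma reverse_holder_truncated:
  fixes \<sigma> :: "real \<Rightarrow> real" and c d M A :: real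
  assumes \<sigma> [measurable]: "\<sigma> \<in> borel_measurable borel" and nonneg: "\<And>x. 0 \<le> \<sigma> x" 
    and "u < v" and c: "0 < c" "c \<le> 1" and d: "0 < d" "d \<le> 1" "8 * d \<le> c\<^sup>2" and "0 < M" and "0 < A"
    and A: "(\<integral>\<^sup>+x. ennreal (\<sigma> x) * indicator {u..<v} x \<partial>lborel) = ennreal A"
    and weak: "\<And>l. A / (v - u) \<le> l \<Longrightarrow> emeasure (density lborel \<sigma>) ({u..<v} \<inter> {x. l < \<sigma> x}) 
     \<le> ennreal (4 * l) * emeasure lborel ({u..<v} \<inter> {x. c * l < \<sigma> x})"
  shows "(\<integral>\<^sup>+x. ennreal (min (\<sigma> x) M powr d * \<sigma> x) * indicator {u..<v} x \<partial>lborel)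
     \<le> ennreal (2 * (A / (v - u)) powr d * A)"
proof -
  define a where "a = A / (v - u)"
  have a: "0 < a" using \<open>u < v\<close> \<open>0 < A\<close> by (simp add: a_def)
  define X where "X = (\<integral>\<^sup>+x. ennreal (min (\<sigma> x) M powr d * \<sigma> x) * indicator {u..<v} x \<partial>lborel)"
  define k where "k = (\<lambda>l. ennreal (d * l powr (d - 1)) * indicator {a..M} l)"
  have [measurable]: "k \<in> borel_measurable borel" unfolding k_def by measurable
  let ?I = "indicator {u..<v} :: real \<Rightarrow> ennreal"
  have [measurable]: "(\<lambda>p. indicator {..<\<sigma> (fst p)} (snd p) :: ennreal) \<in> borel_measurable (lborel \<Otimes>\<^sub>M lborel)"
    unfolding indicator_def lessThan_iff by measurable
  have [measurable]: "(\<lambda>p. indicator {..<\<sigma> (snd p)} (fst p) :: ennreal) \<in> borel_measurable (lborel \<Otimes>\<^sub>M lborel)"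
    unfolding indicator_def lessThan_iff by measurable
  have [measurable]: "(\<lambda>p. indicator {c * fst p<..} (\<sigma> (snd p)) :: ennreal) \<in> borel_measurable (lborel \<Otimes>\<^sub>M lborel)"
    unfolding indicator_def greaterThan_iff by measurable
  have [measurable]: "(\<lambda>p. indicator {c * snd p<..} (\<sigma> (fst p)) :: ennreal) \<in> borel_measurable (lborel \<Otimes>\<^sub>M lborel)"
    unfolding indicator_def greaterThan_iff by measurable
  have "X \<le> (\<integral>\<^sup>+x. (ennreal (a powr d) + (\<integral>\<^sup>+l. k l * indicator {..<\<sigma> x} l \<partial>lborel)) * ennreal (\<sigma> x) * ?I x \<partial>lborel)"
    unfolding X_def k_def
    using powr_layer_cake[OF a nonneg d(1) \<open>0 < M\<close>] nonneg 
    by (intro nn_integral_mono mult_right_mono) (auto simp: ennreal_mult intro!: mult_right_mono)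
  also have "\<dots> = (\<integral>\<^sup>+x. ennreal (a powr d) * (ennreal (\<sigma> x) * ?I x) + (\<integral>\<^sup>+l. k l * indicator {..<\<sigma> x} l * ennreal (\<sigma> x) * ?I x \<partial>lborel) \<partial>lborel)"
  proof (intro nn_integral_cong)
    fix x
    have "(\<integral>\<^sup>+l. k l * indicator {..<\<sigma> x} l * ennreal (\<sigma> x) * ?I x \<partial>lborel)
      = (\<integral>\<^sup>+l. k l * indicator {..<\<sigma> x} l \<partial>lborel) * ennreal (\<sigma> x) * ?I x"
      by (simp add: nn_integral_multc)
    then show "(ennreal (a powr d) + (\<integral>\<^sup>+l. k l * indicator {..<\<sigma> x} l \<partial>lborel)) * ennreal (\<sigma> x) * ?I x =
      ennreal (a powr d) * (ennreal (\<sigma> x) * ?I x) + (\<integral>\<^sup>+l. k l * indicator {..<\<sigma> x} l * ennreal (\<sigma> x) * ?I x \<partial>lborel)"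
      by (simp add: distrib_right mult.assoc)
  qed
  also have "\<dots> = ennreal (a powr d) * ennreal A + (\<integral>\<^sup>+x. (\<integral>\<^sup>+l. k l * indicator {..<\<sigma> x} l * ennreal (\<sigma> x) * ?I x \<partial>lborel) \<partial>lborel)"
    by (subst nn_integral_add) (auto simp: nn_integral_cmult A)
  finally have X1: "X \<le> ennreal (a powr d) * ennreal A + (\<integral>\<^sup>+x. (\<integral>\<^sup>+l. k l * indicator {..<\<sigma> x} l * ennreal (\<sigma> x) * ?I x \<partial>lborel) \<partial>lborel)" .
  have "(\<integral>\<^sup>+x. (\<integral>\<^sup>+l. k l * indicator {..<\<sigma> x} l * ennreal (\<sigma> x) * ?I x \<partial>lborel) \<partial>lborel)
     = (\<integral>\<^sup>+l. (\<integral>\<^sup>+x. k l * indicator {..<\<sigma> x} l * ennreal (\<sigma> x) * ?I x \<partial>lborel) \<partial>lborel)"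
    by (intro lborel_pair.Fubini') measurable
  also have "\<dots> \<le> (\<integral>\<^sup>+l. (\<integral>\<^sup>+x. k l * ennreal (4 * l) * indicator {c * l<..} (\<sigma> x) * ?I x \<partial>lborel) \<partial>lborel)"
  proof (rule nn_integral_mono)
    fix l
    have [measurable]: "{x. c * l < \<sigma> x} \<in> sets borel" "{x. l < \<sigma> x} \<in> sets borel" 
      using borel_measurable_less[of "\<lambda>_. c * l" borel \<sigma>] borel_measurable_less[of "\<lambda>_. l" borel \<sigma>] by simp_all
    show "(\<integral>\<^sup>+x. k l * indicator {..<\<sigma> x} l * ennreal (\<sigma> x) * ?I x \<partial>lborel)
      \<le> (\<integral>\<^sup>+x. k l * ennreal (4 * l) * indicator {c * l<..} (\<sigma> x) * ?I x \<partial>lborel)"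
    proof (cases "a \<le> l")
      case True
      have "(\<integral>\<^sup>+x. k l * indicator {..<\<sigma> x} l * ennreal (\<sigma> x) * ?I x \<partial>lborel)
        = (\<integral>\<^sup>+x. k l * (ennreal (\<sigma> x) * indicator ({u..<v} \<inter> {x. l < \<sigma> x}) x) \<partial>lborel)"
        by (intro nn_integral_cong) (auto split: split_indicator)
      also have "\<dots> = k l * emeasure (density lborel \<sigma>) ({u..<v} \<inter> {x. l < \<sigma> x})"
        by (subst nn_integral_cmult) (auto simp: emeasure_density)
      also have "\<dots> \<le> k l * (ennreal (4 * l) * emeasure lborel ({u..<v} \<inter> {x. c * l < \<sigma> x}))"
        using weak[of l] True by (intro mult_left_mono) (auto simp: a_def)
      also have "\<dots> = (\<integral>\<^sup>+x. k l * ennreal (4 * l) * indicator ({u..<v} \<inter> {x. c * l < \<sigma> x}) x \<partial>lborel)"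
        by (simp add: nn_integral_cmult mult.assoc)
      also have "\<dots> = (\<integral>\<^sup>+x. k l * ennreal (4 * l) * indicator {c * l<..} (\<sigma> x) * ?I x \<partial>lborel)"
        by (intro nn_integral_cong) (auto split: split_indicator)
      finally show ?thesis .
    qed (simp add: k_def)
  qed
  also have "\<dots> = (\<integral>\<^sup>+x. (\<integral>\<^sup>+l. k l * ennreal (4 * l) * indicator {c * l<..} (\<sigma> x) * ?I x \<partial>lborel) \<partial>lborel)"
    by (intro lborel_pair.Fubini'[symmetric]) measurable
  also have "\<dots> \<le> (\<integral>\<^sup>+x. ennreal (1/2) * (ennreal (min (\<sigma> x) M powr d * \<sigma> x) * ?I x) \<partial>lborel)"
  proof (rule nn_integral_mono)
    fix x
    \<comment> \<open>Only levels l \<le> M with c l < \<sigma> x contribute, that is, levels up to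
      \<open>m\<close>. The factor l of the weak estimate turns l^(d-1) into l^d, so the factor d
      survives the integration and makes the term small.\<close>
    define m where "m = min (\<sigma> x / c) M"
    have m: "0 \<le> m" "m \<le> \<sigma> x / c" using nonneg[of x] c \<open>0 < M\<close> by (auto simp: m_def)
    have "M * c \<le> M" using c \<open>0 < M\<close> by (intro mult_left_le) auto
    then have "\<sigma> x \<le> M" if "\<sigma> x \<le> M * c" using that by (rule order_trans[rotated])
    then have m2: "m \<le> min (\<sigma> x) M / c" 
      using nonneg[of x] c \<open>0 < M\<close> by (auto simp: m_def min_def field_simps)
    have "k l * ennreal (4 * l) * indicator {c * l<..} (\<sigma> x) \<le> ennreal (4 * d * m powr d) * indicator {0..m} l" for l
    proof (cases "l \<in> {a..M} \<and> c * l < \<sigma> x")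
      case True
      then have l: "0 < l" "l \<le> m" using a c by (auto simp: m_def field_simps)
      have "d * l powr (d - 1) * (4 * l) = 4 * d * l powr d" 
        using l by (simp add: powr_diff)
      also have "\<dots> \<le> 4 * d * m powr d" using l d by (intro mult_left_mono powr_mono2) auto
      finally show ?thesis using True l d
        by (auto simp: k_def ennreal_mult[symmetric] intro!: ennreal_leI split: split_indicator)
    qed (auto simp: k_def split: split_indicator)
    then have "(\<integral>\<^sup>+l. k l * ennreal (4 * l) * indicator {c * l<..} (\<sigma> x) \<partial>lborel)
      \<le> (\<integral>\<^sup>+l. ennreal (4 * d * m powr d) * indicator {0..m} l \<partial>lborel)" by (intro nn_integral_mono)
    also have "\<dots> = ennreal (4 * d * m powr d * m)" 
      using m d by (simp add: nn_integral_cmult ennreal_mult)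
    also have "\<dots> \<le> ennreal ((1/2) * (min (\<sigma> x) M powr d * \<sigma> x))"
    proof (rule ennreal_leI)
      have "m powr d * m \<le> (min (\<sigma> x) M / c) powr d * (\<sigma> x / c)"
        using m m2 d by (intro mult_mono powr_mono2) auto
      also have "\<dots> = min (\<sigma> x) M powr d * \<sigma> x / (c powr d * c)"
        using c nonneg[of x] \<open>0 < M\<close> by (subst powr_divide) auto
      \<comment> \<open>Since c \<le> 1 and d \<le> 1, c^d \<ge> c. This is where
        \<open>8 * d \<le> c\<^sup>2\<close> comes from: 4 d / c^2 is then at most 1/2, and the term
        can be absorbed.\<close>
      also have "\<dots> \<le> min (\<sigma> x) M powr d * \<sigma> x / c\<^sup>2"
      proof (rule divide_left_mono)
        have "c powr 1 \<le> c powr d" using c d by (intro powr_mono') auto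
        then show "c\<^sup>2 \<le> c powr d * c" using c by (simp add: power2_eq_square)
      qed (use c nonneg[of x] in auto)
      finally have "4 * d * (m powr d * m) \<le> 4 * d * (min (\<sigma> x) M powr d * \<sigma> x / c\<^sup>2)" using d by (intro mult_left_mono) auto
      also have "\<dots> = (8 * d / c\<^sup>2) * ((1/2) * (min (\<sigma> x) M powr d * \<sigma> x))" by simp
      also have "\<dots> \<le> 1 * ((1/2) * (min (\<sigma> x) M powr d * \<sigma> x))"
        using d c nonneg[of x] by (intro mult_right_mono) (auto simp: field_simps)
      finally show "4 * d * m powr d * m \<le> (1/2) * (min (\<sigma> x) M powr d * \<sigma> x)" by (simp add: mult.assoc)
    qed
    finally have "(\<integral>\<^sup>+l. k l * ennreal (4 * l) * indicator {c * l<..} (\<sigma> x) \<partial>lborel) \<le> ennreal ((1/2) * (min (\<sigma> x) M powr d * \<sigma> x))" .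
    then have "(\<integral>\<^sup>+l. k l * ennreal (4 * l) * indicator {c * l<..} (\<sigma> x) \<partial>lborel) * ?I x \<le> ennreal ((1/2) * (min (\<sigma> x) M powr d * \<sigma> x)) * ?I x"
      by (rule mult_right_mono) simp
    moreover have "(\<integral>\<^sup>+l. k l * ennreal (4 * l) * indicator {c * l<..} (\<sigma> x) * ?I x \<partial>lborel)
      = (\<integral>\<^sup>+l. k l * ennreal (4 * l) * indicator {c * l<..} (\<sigma> x) \<partial>lborel) * ?I x"
    proof (rule nn_integral_multc)
      have "(\<lambda>l. indicator {c * l<..} (\<sigma> x) :: ennreal) \<in> borel_measurable borel"
        unfolding indicator_def greaterThan_iff by measurable
      then show "(\<lambda>l. k l * ennreal (4 * l) * indicator {c * l<..} (\<sigma> x)) \<in> borel_measurable lborel" by measurable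
    qed
    moreover have "ennreal ((1/2) * (min (\<sigma> x) M powr d * \<sigma> x)) = ennreal (1/2) * ennreal (min (\<sigma> x) M powr d * \<sigma> x)"
      using nonneg[of x] by (intro ennreal_mult) auto
    ultimately show "(\<integral>\<^sup>+l. k l * ennreal (4 * l) * indicator {c * l<..} (\<sigma> x) * ?I x \<partial>lborel) \<le> ennreal (1/2) * (ennreal (min (\<sigma> x) M powr d * \<sigma> x) * ?I x)"
      by (simp only: mult.assoc)
  qed
  also have "\<dots> = ennreal (1/2) * X" unfolding X_def by (intro nn_integral_cmult) measurable
  finally have main: "X \<le> ennreal (a powr d) * ennreal A + ennreal (1/2) * X"
    using X1 by (meson add_left_mono order_trans)
  have "X \<le> (\<integral>\<^sup>+x. ennreal (M powr d) * (ennreal (\<sigma> x) * ?I x) \<partial>lborel)"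
    unfolding X_def using nonneg d \<open>0 < M\<close>
    by (intro nn_integral_mono) (auto simp: ennreal_mult[symmetric] intro!: ennreal_leI mult_right_mono powr_mono2 split: split_indicator)
  also have "\<dots> = ennreal (M powr d * A)" using \<open>0 < A\<close> by (simp add: nn_integral_cmult A ennreal_mult)
  finally obtain r where r: "X = ennreal r" "0 \<le> r" by (metis ennreal_cases ennreal_neq_top neq_top_trans)
  have "r \<le> a powr d * A + 1/2 * r"
  proof -
    have "ennreal (a powr d) * ennreal A = ennreal (a powr d * A)" "ennreal (1/2) * ennreal r = ennreal (1/2 * r)"
      using r \<open>0 < A\<close> by (simp_all only: ennreal_mult'' less_imp_le)
    then have "ennreal r \<le> ennreal (a powr d * A + 1/2 * r)"
      using main r \<open>0 < A\<close> by (subst ennreal_plus) auto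
    then show ?thesis using r \<open>0 < A\<close> by (subst (asm) ennreal_le_iff) auto
  qed
  then have "r \<le> 2 * a powr d * A" by simp
  then show ?thesis unfolding X_def[symmetric] r a_def[symmetric] by (rule ennreal_leI)
qed

text \<open>The Muckenhoupt condition with its constant named, since later constants depend on it,
  and over \<open>lborel\<close>, since the weight will have been replaced by a Borel
  version.\<close>

definition ap_bound :: "(real \<Rightarrow> real) \<Rightarrow> real \<Rightarrow> real \<Rightarrow> bool" where
  "ap_bound W p B \<longleftrightarrow> (\<forall>a b. a < b \<longrightarrow>
        set_integrable lborel {a..b} W \<and>
        set_integrable lborel {a..b} (\<lambda>x. W x powr (1 / (1 - p))) \<and>
        (1 / (b - a) * (LINT x:{a..b}|lborel. W x)) *
        (1 / (b - a) * (LINT x:{a..b}|lborel. W x powr (1 / (1 - p)))) powr (p - 1) \<le> B)"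

lemma nn_integral_eq_set_integral_Icc:
  fixes f :: "real \<Rightarrow> real"
  assumes "set_integrable lborel {a..b} f" "\<And>x. 0 \<le> f x"
  shows "(\<integral>\<^sup>+x. ennreal (f x) * indicator {a..b} x \<partial>lborel) = ennreal (LINT x:{a..b}|lborel. f x)"
proof -
  have "(\<integral>\<^sup>+x. ennreal (f x) * indicator {a..b} x \<partial>lborel) = (\<integral>\<^sup>+x. ennreal (indicator {a..b} x * f x) \<partial>lborel)"
    by (intro nn_integral_cong) (auto split: split_indicator)
  also have "\<dots> = ennreal (\<integral>x. indicator {a..b} x * f x \<partial>lborel)"
    using assms by (intro nn_integral_eq_integral) (auto simp: set_integrable_def)
  finally show ?thesis by (simp add: set_lebesgue_integral_def)
qed

lemma nn_integral_Ico_eq_Icc: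
  fixes f :: "real \<Rightarrow> ennreal"
  shows "(\<integral>\<^sup>+x. f x * indicator {a..<b} x \<partial>lborel) = (\<integral>\<^sup>+x. f x * indicator {a..b} x \<partial>lborel)"
  by (intro nn_integral_cong_AE eventually_mono[OF AE_lborel_singleton[of b]]) (auto split: split_indicator)

lemma set_integral_pos_Icc:
  fixes f :: "real \<Rightarrow> real"
  assumes "set_integrable lborel {a..b} f" "\<And>x. 0 < f x" "a < b"
  shows "0 < (LINT x:{a..b}|lborel. f x)"
proof -
  have int: "integrable lborel (\<lambda>x. indicator {a..b} x * f x)" using assms by (simp add: set_integrable_def)
  have "(LINT x:{a..b}|lborel. f x) \<ge> 0"
    unfolding set_lebesgue_integral_def using assms(2) by (intro Bochner_Integration.integral_nonneg) (auto simp: less_imp_le)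
  moreover have "(LINT x:{a..b}|lborel. f x) \<noteq> 0"
  proof
    assume "(LINT x:{a..b}|lborel. f x) = 0"
    then have "AE x in lborel. indicator {a..b} x * f x = 0"
      using int assms(2) by (subst (asm) set_lebesgue_integral_def, subst (asm) integral_nonneg_eq_0_iff_AE) (auto simp: less_imp_le)
    then have "AE x in lborel. x \<notin> {a..b}" 
      by (rule eventually_mono) (use assms(2) in \<open>simp add: indicator_eq_0_iff less_imp_neq[THEN not_sym]\<close>)
    then have "emeasure lborel {a..b} = 0"
    proof -
      have "{x. a \<le> x \<and> x \<le> b} = {a..b}" by auto
      with \<open>AE x in lborel. x \<notin> {a..b}\<close> show ?thesis
        using AE_iff_measurable[of "{a..b}" lborel "\<lambda>x. x \<notin> {a..b}"] by auto
    qed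
    then show False using assms by simp
  qed
  ultimately show ?thesis by simp
qed

text \<open>The reverse Hoelder inequality is applied to the dual weight \<sigma> = W^(1/(1-p)),
  because raising \<sigma> to the power 1 + d amounts to passing from p to 1 + (p - 1) / (1 + d). A
  whole range of \<open>d\<close> is kept, since the exponent wanted later is prescribed by
  \<phi>.\<close>

lemma ap_bound_improve:
  fixes W :: "real \<Rightarrow> real"
  assumes W [measurable]: "W \<in> borel_measurable borel" and pos: "\<And>x. 0 < W x" and p: "1 < p"
    and ap: "ap_bound W p B"
  shows "\<exists>e>0. \<forall>d. 0 < d \<longrightarrow> d \<le> e \<longrightarrow> (\<exists>B'. ap_bound W (1 + (p - 1) / (1 + d)) B')"
proof -
  define \<sigma> where "\<sigma> = (\<lambda>x. W x powr (1 / (1 - p)))"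
  have [measurable]: "\<sigma> \<in> borel_measurable borel" unfolding \<sigma>_def by measurable
  have \<sigma>pos: "0 < \<sigma> x" for x using pos[of x] by (simp add: \<sigma>_def)
  have W\<sigma>: "W x = \<sigma> x powr (1 - p)" for x using pos[of x] p by (simp add: \<sigma>_def powr_powr)
  define s where "s = (\<lambda>u v. 1 / (v - u) * (LINT x:{u..v}|lborel. \<sigma> x))"
  define w where "w = (\<lambda>u v. 1 / (v - u) * (LINT x:{u..v}|lborel. W x))"
  have iW: "set_integrable lborel {u..v} W" and i\<sigma>: "set_integrable lborel {u..v} \<sigma>" 
    and bd: "w u v * s u v powr (p - 1) \<le> B" if "u < v" for u v
    using ap that by (auto simp: ap_bound_def \<sigma>_def s_def w_def)
  have spos: "0 < s u v" and wpos: "0 < w u v" if "u < v" for u v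
    using set_integral_pos_Icc[OF i\<sigma>[OF that] \<sigma>pos that] set_integral_pos_Icc[OF iW[OF that] pos that] that
    by (auto simp: s_def w_def)
  have "0 < w 0 1 * s 0 1 powr (p - 1)" using spos[of 0 1] wpos[of 0 1] by simp
  then have B: "0 < B" using bd[of 0 1] by linarith
  \<comment> \<open>Chosen such that c^(1-p) / 2 = B + 1 exceeds the Muckenhoupt constant. If
    \<sigma> \<le> c l held on half of an interval where the average of \<sigma> is above l, then W
    = \<sigma>^(1-p) would have too large an average there.\<close>
  define c where "c = (2 * (B + 1)) powr (- 1 / (p - 1))"
  have c0: "0 < c" using B by (simp add: c_def)
  have c1: "c \<le> 1" unfolding c_def using B p powr_mono[of "- 1 / (p - 1)" 0 "2 * (B + 1)"] by (auto simp: divide_nonpos_pos)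
  have cp: "c powr (1 - p) = 2 * (B + 1)" proof -
    have "- 1 / (p - 1) * (1 - p) = 1" using p by (simp add: field_simps)
    then show ?thesis unfolding c_def powr_powr using B by simp
  qed
  define S where "S = density lborel (\<lambda>x. ennreal (\<sigma> x))"
  have Seq: "emeasure S {u..<v} = ennreal (s u v * (v - u))" if "u < v" for u v
    using that nn_integral_eq_set_integral_Icc[OF i\<sigma>[OF that]] \<sigma>pos
    by (simp add: S_def emeasure_density nn_integral_Ico_eq_Icc less_imp_le s_def)
  have H: "ennreal ((v - u) / 2) \<le> emeasure lborel ({u..<v} \<inter> {x. c * l < \<sigma> x})"
    if uv: "u < v" and l: "0 \<le> l" and gt: "ennreal (l * (v - u)) < emeasure S {u..<v}" for u v l
  proof (rule ccontr)
    have [measurable]: "{x. c * l < \<sigma> x} \<in> sets borel" "{x. \<sigma> x \<le> c * l} \<in> sets borel"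
      using borel_measurable_less[of "\<lambda>_. c * l" borel \<sigma>] borel_measurable_le[of \<sigma> borel "\<lambda>_. c * l"] by simp_all
    assume "\<not> ?thesis"
    then have lt: "emeasure lborel ({u..<v} \<inter> {x. c * l < \<sigma> x}) < ennreal ((v - u) / 2)" by (simp add: not_le)
    have ls: "l < s u v" using gt uv l spos[OF uv] by (simp add: Seq ennreal_less_iff)
    let ?E = "{u..<v} \<inter> {x. \<sigma> x \<le> c * l}"
    have "ennreal (v - u) = emeasure lborel {u..<v}" using uv by simp
    also have "{u..<v} = ?E \<union> ({u..<v} \<inter> {x. c * l < \<sigma> x})" by auto
    also have "emeasure lborel \<dots> \<le> emeasure lborel ?E + emeasure lborel ({u..<v} \<inter> {x. c * l < \<sigma> x})"
      by (intro emeasure_subadditive) auto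
    also have "\<dots> \<le> emeasure lborel ?E + ennreal ((v - u) / 2)" using lt by (intro add_mono) auto
    finally have "ennreal (v - u) \<le> emeasure lborel ?E + ennreal ((v - u) / 2)" .
    then have "ennreal (v - u) - ennreal ((v - u) / 2) \<le> emeasure lborel ?E" 
      by (simp add: ennreal_minus_le_iff add.commute)
    then have E: "ennreal ((v - u) / 2) \<le> emeasure lborel ?E"
      using uv by (simp add: ennreal_minus field_simps)
    have "ennreal ((c * s u v) powr (1 - p) * ((v - u) / 2)) = ennreal ((c * s u v) powr (1 - p)) * ennreal ((v - u) / 2)"
      by (rule ennreal_mult) (use uv in auto)
    also have "\<dots> \<le> ennreal ((c * s u v) powr (1 - p)) * emeasure lborel ?E" by (intro mult_left_mono E) auto
    also have "\<dots> = (\<integral>\<^sup>+x. ennreal ((c * s u v) powr (1 - p)) * indicator ?E x \<partial>lborel)" by (simp add: nn_integral_cmult)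
    also have "\<dots> \<le> (\<integral>\<^sup>+x. ennreal (W x) * indicator {u..v} x \<partial>lborel)"
    proof (rule nn_integral_mono)
      fix x
      have "(c * s u v) powr (1 - p) \<le> W x" if "\<sigma> x \<le> c * l"
      proof -
        have "\<sigma> x \<le> c * s u v" using that ls c0 by (smt (verit) mult_left_mono)
        then show ?thesis unfolding W\<sigma> using p \<sigma>pos by (intro powr_mono2') auto
      qed
      then show "ennreal ((c * s u v) powr (1 - p)) * indicator ?E x \<le> ennreal (W x) * indicator {u..v} x"
        by (auto split: split_indicator intro!: ennreal_leI)
    qed
    also have "\<dots> = ennreal (w u v * (v - u))" 
      using nn_integral_eq_set_integral_Icc[OF iW[OF uv]] pos uv by (simp add: less_imp_le w_def)
    finally have "(c * s u v) powr (1 - p) * ((v - u) / 2) \<le> w u v * (v - u)" 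
      using wpos[OF uv] uv by (subst (asm) ennreal_le_iff) auto
    then have "(c * s u v) powr (1 - p) / 2 * (v - u) \<le> w u v * (v - u)" by simp
    then have "(c * s u v) powr (1 - p) / 2 \<le> w u v" by (rule mult_right_le_imp_le) (use uv in auto)
    then have "(c * s u v) powr (1 - p) / 2 * s u v powr (p - 1) \<le> w u v * s u v powr (p - 1)" by (intro mult_right_mono) auto
    also have "\<dots> \<le> B" using bd[OF uv] .
    finally have "c powr (1 - p) / 2 * (s u v powr (1 - p) * s u v powr (p - 1)) \<le> B"
      using c0 spos[OF uv] by (simp add: powr_mult)
    moreover have "s u v powr (1 - p) * s u v powr (p - 1) = 1" using spos[OF uv] by (simp flip: powr_add)
    ultimately show False unfolding cp by simp
  qed
  have rh: "(\<integral>\<^sup>+x. ennreal (\<sigma> x powr (1 + d)) * indicator {u..<v} x \<partial>lborel) \<le> ennreal (2 * s u v powr (1 + d) * (v - u))"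
    if uv: "u < v" and d: "0 < d" "d \<le> c\<^sup>2 / 8" for u v d
  proof -
    have "c\<^sup>2 \<le> 1" using c0 c1 by (simp add: power_le_one)
    then have d1: "d \<le> 1" "8 * d \<le> c\<^sup>2" using d by auto
    let ?A = "s u v * (v - u)"
    have A: "?A / (v - u) = s u v" using uv by simp
    have weak: "emeasure (density lborel \<sigma>) ({u..<v} \<inter> {x. l < \<sigma> x}) 
       \<le> ennreal (4 * l) * emeasure lborel ({u..<v} \<inter> {x. c * l < \<sigma> x})" if "?A / (v - u) \<le> l" for l
    proof (rule weak_reverse_holder)
      have l: "s u v \<le> l" using that A by simp
      then show l0: "0 \<le> l" using spos[OF uv] by simp
      show "emeasure (density lborel \<sigma>) {u..<v} \<le> ennreal (l * (v - u))"
        using Seq[OF uv] l uv by (auto simp: S_def intro!: ennreal_leI)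
      show "ennreal ((v' - u') / 2) \<le> emeasure lborel ({u'..<v'} \<inter> {x. c * l < \<sigma> x})"
        if "u' < v'" "ennreal (l * (v' - u')) < emeasure (density lborel \<sigma>) {u'..<v'}" for u' v'
        using H[OF that(1) l0] that(2) by (simp add: S_def)
    qed (use \<sigma>pos uv in \<open>auto simp: less_imp_le\<close>)
    have tr: "(\<integral>\<^sup>+x. ennreal (min (\<sigma> x) M powr d * \<sigma> x) * indicator {u..<v} x \<partial>lborel) \<le> ennreal (2 * s u v powr d * ?A)" if "0 < M" for M
    proof -
      have "(\<integral>\<^sup>+x. ennreal (\<sigma> x) * indicator {u..<v} x \<partial>lborel) = ennreal ?A"
        using Seq[OF uv] by (simp add: S_def emeasure_density)
      then show ?thesis
        using reverse_holder_truncated[of \<sigma> u v c d M ?A] \<sigma>pos uv c0 c1 d d1 that spos[OF uv] weak A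
        by (auto simp: less_imp_le)
    qed
    have "(\<integral>\<^sup>+x. ennreal (\<sigma> x powr (1 + d)) * indicator {u..<v} x \<partial>lborel)
      \<le> (\<integral>\<^sup>+x. (SUP n. ennreal (min (\<sigma> x) (real (Suc n)) powr d * \<sigma> x) * indicator {u..<v} x) \<partial>lborel)"
    proof (rule nn_integral_mono)
      fix x
      obtain n where "\<sigma> x \<le> real n" using real_arch_simple by blast
      then have "\<sigma> x \<le> real (Suc n)" by simp
      then have "ennreal (\<sigma> x powr (1 + d)) * indicator {u..<v} x = ennreal (min (\<sigma> x) (real (Suc n)) powr d * \<sigma> x) * indicator {u..<v} x"
        using \<sigma>pos[of x] by (simp add: powr_add mult.commute)
      then show "ennreal (\<sigma> x powr (1 + d)) * indicator {u..<v} x \<le> (SUP n. ennreal (min (\<sigma> x) (real (Suc n)) powr d * \<sigma> x) * indicator {u..<v} x)"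
        by (simp only:) (rule SUP_upper, simp)
    qed
    also have "\<dots> = (SUP n. (\<integral>\<^sup>+x. ennreal (min (\<sigma> x) (real (Suc n)) powr d * \<sigma> x) * indicator {u..<v} x \<partial>lborel))"
    proof (rule nn_integral_monotone_convergence_SUP)
      show "incseq (\<lambda>n x. ennreal (min (\<sigma> x) (real (Suc n)) powr d * \<sigma> x) * indicator {u..<v} x)"
        using \<sigma>pos d by (intro incseq_SucI le_funI) 
          (auto split: split_indicator intro!: ennreal_leI mult_right_mono powr_mono2 simp: less_imp_le)
    qed auto
    also have "\<dots> \<le> ennreal (2 * s u v powr d * ?A)" by (intro SUP_least tr) auto
    also have "2 * s u v powr d * ?A = 2 * s u v powr (1 + d) * (v - u)" using spos[OF uv] by (simp add: powr_add)
    finally show ?thesis .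
  qed
  show ?thesis
  proof (rule exI[of _ "c\<^sup>2 / 8"], intro conjI allI impI)
    show "0 < c\<^sup>2 / 8" using c0 by simp
    fix d assume d: "0 < d" "d \<le> c\<^sup>2 / 8"
    define q where "q = 1 + (p - 1) / (1 + d)"
    have q: "1 < q" using p d by (simp add: q_def)
    have e: "1 / (1 - q) = (1 / (1 - p)) * (1 + d)" using p d by (simp add: q_def field_simps)
    have Wq: "W x powr (1 / (1 - q)) = \<sigma> x powr (1 + d)" for x unfolding e \<sigma>_def powr_powr ..
    show "\<exists>B'. ap_bound W (1 + (p - 1) / (1 + d)) B'"
      unfolding q_def[symmetric] ap_bound_def Wq
    proof (intro exI allI impI conjI)
      fix u v :: real assume uv: "u < v"
      show "set_integrable lborel {u..v} W" by (rule iW[OF uv])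
      have nn: "(\<integral>\<^sup>+x. ennreal (indicator {u..v} x * \<sigma> x powr (1 + d)) \<partial>lborel) \<le> ennreal (2 * s u v powr (1 + d) * (v - u))"
        using rh[OF uv d] unfolding nn_integral_Ico_eq_Icc 
        by (simp add: ennreal_mult' ennreal_indicator mult.commute)
      show int: "set_integrable lborel {u..v} (\<lambda>x. \<sigma> x powr (1 + d))"
        unfolding set_integrable_def real_scaleR_def
        by (intro integrableI_nonneg) (use le_less_trans[OF nn] in \<open>auto simp: less_top\<close>)
      have "ennreal (LINT x:{u..v}|lborel. \<sigma> x powr (1 + d)) \<le> ennreal (2 * s u v powr (1 + d) * (v - u))"
        using nn_integral_eq_set_integral_Icc[OF int] nn by (simp add: ennreal_mult' ennreal_indicator mult.commute)
      then have "(LINT x:{u..v}|lborel. \<sigma> x powr (1 + d)) \<le> 2 * s u v powr (1 + d) * (v - u)"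
        using uv by (subst (asm) ennreal_le_iff) auto
      then have le: "1 / (v - u) * (LINT x:{u..v}|lborel. \<sigma> x powr (1 + d)) \<le> 2 * s u v powr (1 + d)"
        using uv by (simp add: field_simps)
      have nneg: "0 \<le> (LINT x:{u..v}|lborel. \<sigma> x powr (1 + d))"
        unfolding set_lebesgue_integral_def by (intro Bochner_Integration.integral_nonneg) auto
      have "w u v * (1 / (v - u) * (LINT x:{u..v}|lborel. \<sigma> x powr (1 + d))) powr (q - 1)
        \<le> w u v * (2 * s u v powr (1 + d)) powr (q - 1)"
        using le q wpos[OF uv] uv nneg by (intro mult_left_mono powr_mono2) auto
      \<comment> \<open>The exponents match: (1 + d) (q - 1) = p - 1.\<close>
      also have "\<dots> = 2 powr (q - 1) * (w u v * s u v powr (p - 1))"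
        using d by (simp add: powr_mult powr_powr q_def)
      also have "\<dots> \<le> 2 powr (q - 1) * B" using bd[OF uv] by (intro mult_left_mono) auto
      finally show "1 / (v - u) * (LINT x:{u..v}|lborel. W x) *
         (1 / (v - u) * (LINT x:{u..v}|lborel. \<sigma> x powr (1 + d))) powr (q - 1) \<le> 2 powr (q - 1) * B" 
        by (simp add: w_def)
    qed
  qed
qed

subsection \<open>Growth of Young functions\<close>

lemma convex_young_superlinear:
  assumes "young \<Phi>" "convex_on UNIV \<Phi>" "1 \<le> s" 
  shows "s * \<Phi> x \<le> \<Phi> (s * x)"
proof -
  have "\<Phi> ((1 - 1 / s) *\<^sub>R 0 + (1 / s) *\<^sub>R (s * x)) \<le> (1 - 1 / s) * \<Phi> 0 + (1 / s) * \<Phi> (s * x)"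
    using assms by (intro convex_onD) auto
  then show ?thesis using assms by (simp add: young_def field_simps)
qed

text \<open>Convexity with value 0 at 0 gives s \<Phi>(x) \<le> \<Phi>(s x); the comparison of
  \<Phi> with the p-th power of \<phi> transfers this at the cost of the dilation \<open>C\<close>,
  and the p-th root turns the factor s into s^(1/p).\<close>

lemma quasiconvex_powr_growth:
  assumes "0 < p" "quasiconvex (\<lambda>x. \<phi> x powr p)" "\<And>x. 0 \<le> \<phi> x"
  shows "\<exists>C\<ge>1. \<forall>s x. 1 \<le> s \<longrightarrow> 0 \<le> x \<longrightarrow> s powr (1 / p) * \<phi> (x / C) \<le> \<phi> (s * x)"
proof -
  obtain \<Phi> C where \<Phi>: "young \<Phi>" "convex_on UNIV \<Phi>" and C: "1 \<le> C"
    and b: "\<And>x. 0 \<le> x \<Longrightarrow> \<Phi> x \<le> \<phi> x powr p" "\<And>x. 0 \<le> x \<Longrightarrow> \<phi> x powr p \<le> \<Phi> (C * x)"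
    using assms(2) unfolding quasiconvex_def by blast
  show ?thesis
  proof (rule exI[of _ C], intro conjI allI impI)
    fix s x :: real assume s: "1 \<le> s" and x: "0 \<le> x"
    have "s * \<phi> (x / C) powr p \<le> s * \<Phi> x" using b(2)[of "x / C"] x C s by (intro mult_left_mono) auto
    also have "\<dots> \<le> \<Phi> (s * x)" by (rule convex_young_superlinear[OF \<Phi> s])
    also have "\<dots> \<le> \<phi> (s * x) powr p" using b(1) s x by auto
    finally have "(s * \<phi> (x / C) powr p) powr (1 / p) \<le> (\<phi> (s * x) powr p) powr (1 / p)"
      using assms s by (intro powr_mono2) auto
    then show "s powr (1 / p) * \<phi> (x / C) \<le> \<phi> (s * x)"
      using assms s by (simp add: powr_mult powr_powr)
  qed (rule C)
qed

text \<open>Without this bound \<^const>\<open>young_index\<close> could be the junk value \<open>1 / 0 = 0\<close>.\<close>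

lemma quasiconvex_exponent_bounded_below:
  assumes "young \<phi>" "Delta2 \<phi>"
  shows "\<exists>m>0. \<forall>p. 0 < p \<longrightarrow> quasiconvex (\<lambda>x. \<phi> x powr p) \<longrightarrow> m \<le> p"
proof -
  obtain D0 where D0: "D0 > 0" "\<And>x. \<phi> (2 * x) \<le> D0 * \<phi> x" using assms(2) unfolding Delta2_def by blast
  have nn: "0 \<le> \<phi> x" for x using assms(1) by (simp add: young_def)
  \<comment> \<open>At least 2, so that ln D > 0 and the bound ln 2 / ln D is positive.\<close>
  define D where "D = max D0 2"
  have D: "2 \<le> D" "\<phi> (2 * x) \<le> D * \<phi> x" for x
    using order_trans[OF D0(2), OF mult_right_mono[of D0 D "\<phi> x"]] nn by (auto simp: D_def)
  have iter: "\<phi> (2 ^ n * x) \<le> D ^ n * \<phi> x" for n x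
  proof (induction n)
    case (Suc n)
    have "\<phi> (2 ^ Suc n * x) \<le> D * \<phi> (2 ^ n * x)" using D(2)[of "2 ^ n * x"] by (simp add: mult.assoc)
    also have "\<dots> \<le> D * (D ^ n * \<phi> x)" using Suc D by (intro mult_left_mono) auto
    finally show ?case by simp
  qed simp
  show ?thesis
  proof (rule exI[of _ "ln 2 / ln D"], intro conjI allI impI)
    show "0 < ln 2 / ln D" using D by auto
    fix p :: real assume p: "0 < p" and q: "quasiconvex (\<lambda>x. \<phi> x powr p)"
    obtain \<Phi> C where \<Phi>: "young \<Phi>" "convex_on UNIV \<Phi>"
      and b: "\<And>x. 0 \<le> x \<Longrightarrow> \<Phi> x \<le> \<phi> x powr p"
      using q unfolding quasiconvex_def by blast
    have "filterlim \<Phi> at_top at_top" using \<Phi> by (simp add: young_def)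
    then have "eventually (\<lambda>x. 0 < \<Phi> x \<and> 0 < x) at_top"
      by (intro eventually_conj eventually_gt_at_top) (auto simp: filterlim_at_top_dense)
    then obtain x where x: "0 < \<Phi> x" "0 < x" using eventually_happens'[OF trivial_limit_at_top_linorder] by blast
    \<comment> \<open>With each doubling of the argument \<Phi> gains at least the factor 2 and the
      p-th power of \<phi> at most D^p. Were 2 / D^p above 1, its powers would be unbounded, against
      this estimate.\<close>
    have main: "(2 / D powr p) ^ n \<le> \<phi> x powr p / \<Phi> x" for n
    proof -
      have "2 ^ n * \<Phi> x \<le> \<Phi> (2 ^ n * x)" by (rule convex_young_superlinear[OF \<Phi>]) simp
      also have "\<dots> \<le> \<phi> (2 ^ n * x) powr p" using b x by auto
      also have "\<dots> \<le> (D ^ n * \<phi> x) powr p" using iter nn p by (intro powr_mono2) auto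
      also have "\<dots> = (D powr p) ^ n * \<phi> x powr p" 
        using D nn[of x] by (simp add: powr_mult powr_power[symmetric] powr_powr mult.commute flip: powr_realpow)
      finally show ?thesis using x D by (simp add: field_simps power_divide)
    qed
    have "2 / D powr p \<le> 1"
    proof (rule ccontr)
      assume "\<not> ?thesis"
      then obtain n where "\<phi> x powr p / \<Phi> x < (2 / D powr p) ^ n" using real_arch_pow by (metis not_le)
      then show False using main[of n] by simp
    qed
    then have "2 \<le> D powr p" using D by (simp add: field_simps)
    then have "ln 2 \<le> ln (D powr p)" using D by (subst ln_le_cancel_iff) auto
    then show "ln 2 / ln D \<le> p" using D by (simp add: ln_powr field_simps)
  qed
qed

text \<open>One exponent has to serve both \<phi> and the weight. If the infimum defining the index
  is attained, the index itself does. Otherwise growth is available with exponent 1 / p for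
  admissible p slightly above the infimum, and \<open>ap_bound_improve\<close> yields the weight
  condition for that exponent.\<close>

lemma class_Q_growth_exponent:
  assumes Q: "\<phi> \<in> class_Q" and W: "W \<in> borel_measurable borel" "\<And>x. 0 < W x"
    and ap: "ap_bound W (young_index \<phi>) B"
  shows "\<exists>q>1. (\<exists>B'. ap_bound W q B') \<and>
    (\<exists>C\<ge>1. \<forall>s x. 1 \<le> s \<longrightarrow> 0 \<le> x \<longrightarrow> s powr q * \<phi> (x / C) \<le> \<phi> (s * x))"
proof -
  define S where "S = {p. 0 < p \<and> quasiconvex (\<lambda>x. \<phi> x powr p)}"
  have y: "young \<phi>" "Delta2 \<phi>" using Q by (auto simp: class_Q_def)
  obtain \<theta> where \<theta>: "\<theta> \<in> S" "\<theta> < 1" using Q by (auto simp: class_Q_def S_def)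
  obtain m where m: "0 < m" "\<And>p. p \<in> S \<Longrightarrow> m \<le> p" 
    using quasiconvex_exponent_bounded_below[OF y] by (auto simp: S_def)
  define i where "i = Inf S"
  have bdd: "bdd_below S" by (rule bdd_belowI[of _ m]) (rule m(2))
  have i: "0 < i" "i < 1" 
    using cInf_greatest[of S m, OF _ m(2)] m(1) \<theta> cInf_lower[OF \<theta>(1) bdd] by (force simp: i_def)+
  define p0 where "p0 = 1 / i"
  have p0: "1 < p0" using i by (simp add: p0_def)
  have idx: "young_index \<phi> = p0" by (simp add: young_index_def p0_def i_def S_def)
  have gr: "\<exists>C\<ge>1. \<forall>s x. 1 \<le> s \<longrightarrow> 0 \<le> x \<longrightarrow> s powr (1 / p) * \<phi> (x / C) \<le> \<phi> (s * x)" if "p \<in> S" for p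
    using quasiconvex_powr_growth[of p \<phi>] that y by (auto simp: S_def young_def)
  show ?thesis
  proof (cases "i \<in> S")
    case True
    then show ?thesis using gr[OF True] ap p0 unfolding idx p0_def by blast
  next
    case False
    obtain e where e: "e > 0" "\<And>d. 0 < d \<Longrightarrow> d \<le> e \<Longrightarrow> \<exists>B'. ap_bound W (1 + (p0 - 1) / (1 + d)) B'"
      using ap_bound_improve[OF W p0 ap[unfolded idx]] by blast
    define qe where "qe = 1 + (p0 - 1) / (1 + e)"
    have "(p0 - 1) / (1 + e) < p0 - 1" using p0 e by (simp add: field_simps)
    then have qe: "1 < qe" "qe < p0" using p0 e by (auto simp: qe_def)
    then have "i < 1 / qe" using i by (simp add: p0_def field_simps)
    \<comment> \<open>An admissible exponent so close to the infimum that 1 / p lies between the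
      improved exponent \<open>qe\<close> and the index.\<close>
    then obtain p where p: "p \<in> S" "p < 1 / qe" using cInf_lessD[of S "1 / qe"] \<theta> by (auto simp: i_def)
    have "i < p" using False p cInf_lower[OF p(1) bdd] by (metis i_def order_le_less)
    define q where "q = 1 / p"
    have pp: "0 < p" using p by (simp add: S_def)
    have q: "qe < q" "q < p0" using p pp qe i \<open>i < p\<close> by (auto simp: q_def p0_def field_simps)
    \<comment> \<open>The solution of 1 + (p0 - 1) / (1 + d) = q; it is at most \<open>e\<close>
      because q > qe.\<close>
    define d where "d = (p0 - 1) / (q - 1) - 1"
    have q1: "1 < q" using q qe by simp
    have d: "0 < d" using q q1 by (simp add: d_def field_simps)
    have "(p0 - 1) / (1 + e) < q - 1" using q by (simp add: qe_def)
    then have "d \<le> e" using q1 e by (simp add: d_def field_simps)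
    moreover have "1 + (p0 - 1) / (1 + d) = q" using q1 p0 by (simp add: d_def)
    ultimately have "\<exists>B'. ap_bound W q B'" using e(2)[OF d] by simp
    then show ?thesis using gr[OF p(1)] q1 unfolding q_def by blast
  qed
qed

text \<open>The exponent \<open>q\<close> couples the two data: \<phi> grows at least like the q-th
  power up to dilation by \<open>C0\<close>, and \<open>W\<close> satisfies the weight condition
  with the same \<open>q\<close>. The weight is a Borel version, positive everywhere, so that one
  may divide by it.\<close>

locale orlicz_weight =
  fixes \<phi> W :: "real \<Rightarrow> real" and q B C0 :: real
  assumes W_borel [measurable]: "W \<in> borel_measurable borel"
    and W_pos: "\<And>x. 0 < W x"
    and W_periodic: "\<And>x. W (x + 2 * pi) = W x"
    and q: "1 < q"
    and ap: "ap_bound W q B"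
    and phi_borel [measurable]: "\<phi> \<in> borel_measurable borel"
    and phi_nonneg: "\<And>x. 0 \<le> \<phi> x"
    and phi_0: "\<phi> 0 = 0"
    and phi_mono: "\<And>x y. 0 \<le> x \<Longrightarrow> x \<le> y \<Longrightarrow> \<phi> x \<le> \<phi> y"
    and phi_pos: "\<exists>x>0. 0 < \<phi> x"
    and C0: "1 \<le> C0"
    and growth: "\<And>s x. 1 \<le> s \<Longrightarrow> 0 \<le> x \<Longrightarrow> s powr q * \<phi> (x / C0) \<le> \<phi> (s * x)"
begin

abbreviation "psi \<equiv> complementary \<phi>"
abbreviation "q' \<equiv> q / (q - 1)"

lemma psi_ge: "0 \<le> x \<Longrightarrow> ennreal (x * y - \<phi> x) \<le> psi y"
  unfolding complementary_def by (rule SUP_upper) simp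

lemma psi_le: "(\<And>x. 0 \<le> x \<Longrightarrow> ennreal (x * y - \<phi> x) \<le> z) \<Longrightarrow> psi y \<le> z"
  unfolding complementary_def by (rule SUP_least) simp

lemma psi_mono: "x \<le> y \<Longrightarrow> psi x \<le> psi y"
  by (intro psi_le order_trans[OF _ psi_ge]) (auto intro!: ennreal_leI mult_left_mono)

text \<open>A supremum of uncountably many functions; it is measurable because they are continuous
  in y, so that all sets {psi > c} are open.\<close>

lemma psi_borel [measurable]: "psi \<in> borel_measurable borel"
proof (rule borel_measurableI_greater)
  fix c :: ennreal
  have "{y \<in> space borel. c < psi y} = (\<Union>x\<in>{0..}. {y. c < ennreal (x * y - \<phi> x)})"
    by (auto simp: complementary_def less_SUP_iff)
  moreover have "open \<dots>"
    by (intro open_UN ballI open_Collect_less continuous_intros continuous_on_ennreal)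
  ultimately show "{y \<in> space borel. c < psi y} \<in> sets borel" by simp
qed

lemma young_ineq: "0 \<le> x \<Longrightarrow> 0 \<le> y \<Longrightarrow> ennreal (x * y) \<le> ennreal (\<phi> x) + psi y"
proof -
  assume "0 \<le> x" "0 \<le> y"
  have "ennreal (x * y) \<le> ennreal (\<phi> x + max 0 (x * y - \<phi> x))" by (intro ennreal_leI) auto
  also have "\<dots> = ennreal (\<phi> x) + ennreal (x * y - \<phi> x)" 
    using phi_nonneg by (subst ennreal_plus) (auto simp: max_def ennreal_neg)
  finally show ?thesis using psi_ge[OF \<open>0 \<le> x\<close>, of y] by (meson add_left_mono order_trans)
qed

text \<open>Convexity along rays from 0: c (x y - \<phi> x) dominates x (c y) - \<phi> x. It brings
  a function with modular larger than 1 back into the dual ball.\<close>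

lemma psi_scale: "0 \<le> c \<Longrightarrow> c \<le> 1 \<Longrightarrow> psi (c * y) \<le> ennreal c * psi y"
proof (rule psi_le)
  fix x :: real assume c: "0 \<le> c" "c \<le> 1" and "0 \<le> x"
  have "c * \<phi> x \<le> 1 * \<phi> x" using c phi_nonneg by (intro mult_right_mono) auto
  then have "ennreal (x * (c * y) - \<phi> x) \<le> ennreal (c * (x * y - \<phi> x))"
    by (intro ennreal_leI) (simp add: algebra_simps)
  also have "\<dots> = ennreal c * ennreal (x * y - \<phi> x)" using c by (simp add: ennreal_mult')
  also have "\<dots> \<le> ennreal c * psi y" using psi_ge[OF \<open>0 \<le> x\<close>] by (intro mult_left_mono) auto
  finally show "ennreal (x * (c * y) - \<phi> x) \<le> ennreal c * psi y" .
qed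

text \<open>The lower growth of \<phi> dualised into an upper growth of \<open>psi\<close> with the
  conjugate exponent. The substitution is x = s C0 z with s = t^(1/(q-1)), for which s t and s^q
  both equal \<open>t powr q'\<close>.\<close>

lemma psi_growth:
  assumes t: "1 \<le> t" 
  shows "psi (t * y) \<le> ennreal (t powr q') * psi (C0 * y)"
proof (rule psi_le)
  fix x :: real assume x: "0 \<le> x"
  define s where "s = t powr (1 / (q - 1))"
  have s: "1 \<le> s" using t q by (simp add: s_def ge_one_powr_ge_zero)
  define z where "z = x / s / C0"
  have z: "0 \<le> z" using x s C0 by (simp add: z_def)
  have sq: "s powr q = t powr q'" using t by (simp add: s_def powr_powr)
  have "s * t = t powr (1 / (q - 1) + 1)" using t by (simp add: s_def powr_add)
  also have "1 / (q - 1) + 1 = q'" using q by (simp add: field_simps)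
  finally have st: "s * t = t powr q'" .
  have e1: "t powr q' * \<phi> z \<le> \<phi> x"
    using growth[OF s, of "x / s"] x s by (simp add: z_def sq)
  have e2: "x * (t * y) = t powr q' * (z * (C0 * y))" 
  proof -
    have "x = s * C0 * z" using s C0 by (simp add: z_def)
    then show ?thesis by (simp add: st[symmetric])
  qed
  have "ennreal (x * (t * y) - \<phi> x) \<le> ennreal (t powr q' * (z * (C0 * y) - \<phi> z))"
    unfolding e2 right_diff_distrib using e1 by (intro ennreal_leI) linarith
  also have "\<dots> = ennreal (t powr q') * ennreal (z * (C0 * y) - \<phi> z)" by (simp add: ennreal_mult')
  also have "\<dots> \<le> ennreal (t powr q') * psi (C0 * y)" using psi_ge[OF z] by (intro mult_left_mono) auto
  finally show "ennreal (x * (t * y) - \<phi> x) \<le> ennreal (t powr q') * psi (C0 * y)" .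
qed

text \<open>The value of \<open>psi\<close> may be infinite, so a positive argument with finite
  value must be exhibited. Beyond \<open>z\<close>, growth with q > 1 keeps \<phi> above the line
  through 0 of slope \<phi>(x0) / z; up to \<open>z\<close> that line is at most \<phi>(x0).\<close>

lemma psi_finite: "\<exists>c>0. psi c < \<infinity>"
proof -
  obtain x0 where x0: "0 < x0" "0 < \<phi> x0" using phi_pos by blast
  define z where "z = C0 * x0"
  have z: "0 < z" using C0 x0 by (simp add: z_def)
  let ?c = "\<phi> x0 / z"
  have "psi ?c \<le> ennreal (\<phi> x0)"
  proof (rule psi_le)
    fix x :: real assume x: "0 \<le> x"
    show "ennreal (x * ?c - \<phi> x) \<le> ennreal (\<phi> x0)"
    proof (cases "x \<le> z")
      case True
      have "x * ?c \<le> z * ?c" using True x0 z by (intro mult_right_mono) auto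
      then show ?thesis using z phi_nonneg[of x] by (intro ennreal_leI) simp
    next
      case False
      have "x / z * \<phi> x0 \<le> (x / z) powr q * \<phi> x0"
        using False z q x0 powr_mono[of 1 q "x / z"] by (intro mult_right_mono) auto
      also have "\<dots> \<le> \<phi> x" using growth[of "x / z" z] False z C0 x0 by (simp add: z_def)
      finally show ?thesis using x0 by (intro ennreal_leI) simp
    qed
  qed
  then show ?thesis using x0 z by (intro exI[of _ ?c]) (auto intro: le_less_trans)
qed

text \<open>\<open>psi\<close> is a supremum of the affine functions y \<mapsto> x y - \<phi>(x).
  Integrating one of them against W gives the bound for a fixed x, and the supremum over x is taken
  at the end.\<close>

lemma psi_jensen:
  assumes [measurable]: "g \<in> borel_measurable borel" and g: "\<And>x. 0 \<le> g x"
    and iW: "set_integrable lborel {u..v} W" and ig: "set_integrable lborel {u..v} (\<lambda>x. g x * W x)" 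
    and WI: "0 < (LINT x:{u..v}|lborel. W x)"
  shows "ennreal (LINT x:{u..v}|lborel. W x) * psi ((LINT x:{u..v}|lborel. g x * W x) / (LINT x:{u..v}|lborel. W x))
     \<le> (\<integral>\<^sup>+x. psi (g x) * ennreal (W x) * indicator {u..v} x \<partial>lborel)"
proof -
  let ?w = "LINT x:{u..v}|lborel. W x" and ?g = "LINT x:{u..v}|lborel. g x * W x"
  have "ennreal ?w * ennreal (x * (?g / ?w) - \<phi> x) \<le> (\<integral>\<^sup>+x. psi (g x) * ennreal (W x) * indicator {u..v} x \<partial>lborel)" 
    if x: "0 \<le> x" for x
  proof -
    have i: "integrable lborel (\<lambda>y. x * (indicator {u..v} y * (g y * W y)) - \<phi> x * (indicator {u..v} y * W y))"
      using iW ig by (auto simp: set_integrable_def)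
    have "ennreal ?w * ennreal (x * (?g / ?w) - \<phi> x) = ennreal (x * ?g - \<phi> x * ?w)"
      using WI by (simp add: ennreal_mult'[symmetric] right_diff_distrib mult.commute)
    also have "x * ?g - \<phi> x * ?w = (\<integral>y. x * (indicator {u..v} y * (g y * W y)) - \<phi> x * (indicator {u..v} y * W y) \<partial>lborel)"
      using iW ig by (simp add: set_lebesgue_integral_def set_integrable_def)
    also have "\<dots> \<le> (\<integral>y. max 0 (x * (indicator {u..v} y * (g y * W y)) - \<phi> x * (indicator {u..v} y * W y)) \<partial>lborel)"
      using i by (intro integral_mono) auto
    then have "ennreal (\<integral>y. x * (indicator {u..v} y * (g y * W y)) - \<phi> x * (indicator {u..v} y * W y) \<partial>lborel) 
       \<le> ennreal (\<integral>y. max 0 (x * (indicator {u..v} y * (g y * W y)) - \<phi> x * (indicator {u..v} y * W y)) \<partial>lborel)"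
      by (rule ennreal_leI)
    also have "\<dots> = (\<integral>\<^sup>+y. ennreal (max 0 (x * (indicator {u..v} y * (g y * W y)) - \<phi> x * (indicator {u..v} y * W y))) \<partial>lborel)"
      using i by (intro nn_integral_eq_integral[symmetric]) auto
    also have "\<dots> \<le> (\<integral>\<^sup>+y. psi (g y) * ennreal (W y) * indicator {u..v} y \<partial>lborel)"
    proof (rule nn_integral_mono)
      fix y
      have "ennreal (max 0 (x * (g y * W y) - \<phi> x * W y)) = ennreal (x * g y - \<phi> x) * ennreal (W y)"
        using W_pos[of y] by (subst ennreal_mult''[symmetric]) (auto simp: max_def ennreal_neg algebra_simps)
      also have "\<dots> \<le> psi (g y) * ennreal (W y)" using psi_ge[OF x] by (intro mult_right_mono) auto
      finally show "ennreal (max 0 (x * (indicator {u..v} y * (g y * W y)) - \<phi> x * (indicator {u..v} y * W y)))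
        \<le> psi (g y) * ennreal (W y) * indicator {u..v} y" by (auto split: split_indicator)
    qed
    finally show ?thesis .
  qed
  then show ?thesis
    unfolding complementary_def[of \<phi> "?g / ?w"] by (subst SUP_mult_left_ennreal) (auto intro!: SUP_least)
qed

text \<open>The 1 stems from the points where W is at least twice its mean, the second term from the
  other points by way of the weight condition; compare the bound by
  \<open>1 + (2 * wb / W x) powr q'\<close> in \<open>modular_interval\<close>.\<close>

definition "Cmod = 1 + 2 powr q' * B powr (1 / (q - 1))"

lemma Cmod_ge: "1 \<le> Cmod" by (simp add: Cmod_def)

text \<open>With \<open>l\<close> the W-mean of g and \<open>wb\<close> the mean of W, the function
  in question is (2 wb / W) l / C0. By \<open>psi_growth\<close> the variable factor leaves
  \<open>psi\<close> as its q'-th power; the weight condition bounds the integral of this power, and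
  Jensen's inequality bounds psi(l). The factor 1 / h on an interval of length 2 h is meant for
  windows of length h inside it.\<close>

lemma modular_interval:
  assumes [measurable]: "g \<in> borel_measurable borel" and g: "\<And>x. 0 \<le> g x" and h: "0 < h"
    and ig: "set_integrable lborel {y-h..y+h} (\<lambda>x. g x * W x)" 
  shows "(\<integral>\<^sup>+x. psi ((1 / C0) * ((1 / h) * (LINT x:{y-h..y+h}|lborel. g x * W x)) / W x) * ennreal (W x) * indicator {y-h..y+h} x \<partial>lborel)
     \<le> ennreal Cmod * (\<integral>\<^sup>+x. psi (g x) * ennreal (W x) * indicator {y-h..y+h} x \<partial>lborel)"
proof -
  let ?I = "{y-h..y+h}"
  have uv: "y - h < y + h" using h by simp
  have iW: "set_integrable lborel ?I W" and iS: "set_integrable lborel ?I (\<lambda>x. W x powr (1 / (1 - q)))"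
    and bd: "(1 / (2 * h) * (LINT x:?I|lborel. W x)) * (1 / (2 * h) * (LINT x:?I|lborel. W x powr (1 / (1 - q)))) powr (q - 1) \<le> B"
    using ap[unfolded ap_bound_def, rule_format, OF uv] by simp_all
  define w where "w = (LINT x:?I|lborel. W x)"
  define s where "s = (LINT x:?I|lborel. W x powr (1 / (1 - q)))"
  define G where "G = (LINT x:?I|lborel. g x * W x)"
  have w: "0 < w" unfolding w_def using set_integral_pos_Icc[OF iW W_pos uv] .
  have s: "0 < s" unfolding s_def using W_pos by (intro set_integral_pos_Icc[OF iS _ uv]) (simp add: less_imp_neq[THEN not_sym])
  have G: "0 \<le> G" unfolding G_def set_lebesgue_integral_def
    using g W_pos by (intro Bochner_Integration.integral_nonneg) (auto simp: less_imp_le)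
  define wb where "wb = w / (2 * h)"
  have wb: "0 < wb" using w h by (simp add: wb_def)
  have B0: "0 \<le> B" using bd w s h by (intro order_trans[OF _ bd]) (auto simp: w_def[symmetric] s_def[symmetric])
  define l where "l = G / w"
  have l: "0 \<le> l" using G w by (simp add: l_def)
  have pt: "psi ((1 / C0) * ((1 / h) * G) / W x) * ennreal (W x)
     \<le> ennreal (W x + (2 * wb) powr q' * W x powr (1 / (1 - q))) * psi l" for x
  proof -
    define t where "t = max 1 (2 * wb / W x)"
    have "(1 / C0) * ((1 / h) * G) / W x = (2 * wb / W x) * ((1 / C0) * l)"
      using h w by (simp add: wb_def l_def)
    also have "\<dots> \<le> t * ((1 / C0) * l)" using l C0 by (intro mult_right_mono) (auto simp: t_def)
    finally have "psi ((1 / C0) * ((1 / h) * G) / W x) \<le> psi (t * ((1 / C0) * l))" by (rule psi_mono)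
    also have "\<dots> \<le> ennreal (t powr q') * psi (C0 * ((1 / C0) * l))" by (rule psi_growth) (simp add: t_def)
    also have "C0 * ((1 / C0) * l) = l" using C0 by simp
    also have "ennreal (t powr q') * psi l \<le> ennreal (1 + (2 * wb / W x) powr q') * psi l"
      by (intro mult_right_mono ennreal_leI) (auto simp: t_def max_def)
    finally have "psi ((1 / C0) * ((1 / h) * G) / W x) * ennreal (W x) \<le> ennreal (1 + (2 * wb / W x) powr q') * psi l * ennreal (W x)"
      by (rule mult_right_mono) simp
    also have "\<dots> = ennreal ((1 + (2 * wb / W x) powr q') * W x) * psi l"
      using W_pos[of x] by (simp add: ennreal_mult'' mult.commute mult.left_commute)
    also have "(1 + (2 * wb / W x) powr q') * W x = W x + (2 * wb) powr q' * W x powr (1 / (1 - q))"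
    proof -
      have "1 / (1 - q) = 1 - q'" using q by (simp add: field_simps)
      then have "W x powr (1 / (1 - q)) = W x / W x powr q'" using W_pos[of x] by (simp add: powr_diff)
      then show ?thesis using W_pos[of x] wb by (simp add: powr_divide distrib_right)
    qed
    finally show ?thesis .
  qed
  have re: "w + (2 * wb) powr q' * s \<le> Cmod * w"
  proof -
    \<comment> \<open>The weight condition, solved for the integral \<open>s\<close> of W^(1/(1-q));
      this is the power met above because 1 / (1 - q) = 1 - q'.\<close>
    have "(s / (2 * h)) powr (q - 1) \<le> B / wb"
    proof -
      have "wb * (s / (2 * h)) powr (q - 1) \<le> B" using bd unfolding w_def[symmetric] s_def[symmetric] wb_def by simp
      then show ?thesis using wb by (simp add: field_simps)
    qed
    then have "((s / (2 * h)) powr (q - 1)) powr (1 / (q - 1)) \<le> (B / wb) powr (1 / (q - 1))"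
      using q by (intro powr_mono2) auto
    then have "s / (2 * h) \<le> B powr (1 / (q - 1)) / wb powr (1 / (q - 1))"
      using q s h wb B0 by (simp add: powr_powr powr_divide)
    then have "s \<le> 2 * h * (B powr (1 / (q - 1)) / wb powr (1 / (q - 1)))" using h by (simp add: field_simps)
    then have "(2 * wb) powr q' * s \<le> (2 * wb) powr q' * (2 * h * (B powr (1 / (q - 1)) / wb powr (1 / (q - 1))))"
      by (intro mult_left_mono) auto
    also have "\<dots> = 2 powr q' * B powr (1 / (q - 1)) * (2 * h * (wb powr q' / wb powr (1 / (q - 1))))"
      using wb by (simp add: powr_mult)
    also have "wb powr q' / wb powr (1 / (q - 1)) = wb powr (q' - 1 / (q - 1))" by (simp add: powr_diff)
    also have "q' - 1 / (q - 1) = 1" using q by (simp add: diff_divide_distrib[symmetric])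
    also have "2 * h * (wb powr 1) = w" using wb h w by (simp add: wb_def)
    finally show ?thesis by (simp add: Cmod_def distrib_right)
  qed
  have "(\<integral>\<^sup>+x. psi ((1 / C0) * ((1 / h) * G) / W x) * ennreal (W x) * indicator ?I x \<partial>lborel)
    \<le> (\<integral>\<^sup>+x. (ennreal (W x) * indicator ?I x + ennreal ((2 * wb) powr q') * (ennreal (W x powr (1 / (1 - q))) * indicator ?I x)) * psi l \<partial>lborel)"
  proof (rule nn_integral_mono)
    fix x
    have "ennreal (W x + (2 * wb) powr q' * W x powr (1 / (1 - q))) = ennreal (W x) + ennreal ((2 * wb) powr q') * ennreal (W x powr (1 / (1 - q)))"
      using W_pos[of x] by (simp add: ennreal_mult')
    then show "psi ((1 / C0) * ((1 / h) * G) / W x) * ennreal (W x) * indicator ?I x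
      \<le> (ennreal (W x) * indicator ?I x + ennreal ((2 * wb) powr q') * (ennreal (W x powr (1 / (1 - q))) * indicator ?I x)) * psi l"
      using pt[of x] by (auto split: split_indicator)
  qed
  also have "\<dots> = (ennreal w + ennreal ((2 * wb) powr q') * ennreal s) * psi l"
    using nn_integral_eq_set_integral_Icc[OF iW] nn_integral_eq_set_integral_Icc[OF iS] W_pos
    by (simp add: nn_integral_multc nn_integral_add nn_integral_cmult w_def s_def less_imp_le)
  also have "ennreal w + ennreal ((2 * wb) powr q') * ennreal s = ennreal (w + (2 * wb) powr q' * s)"
    using w s by (simp add: ennreal_mult')
  also have "\<dots> * psi l \<le> ennreal (Cmod * w) * psi l" by (intro mult_right_mono ennreal_leI re) auto
  also have "\<dots> = ennreal Cmod * (ennreal w * psi l)" using Cmod_ge w by (simp add: ennreal_mult mult.assoc)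
  also have "\<dots> \<le> ennreal Cmod * (\<integral>\<^sup>+x. psi (g x) * ennreal (W x) * indicator ?I x \<partial>lborel)"
    using psi_jensen[OF assms(1) g iW ig] w by (intro mult_left_mono) (auto simp: w_def l_def G_def)
  finally show ?thesis unfolding G_def .
qed

end

subsection \<open>Averaging operators in the dual norm\<close>

text \<open>\<open>periodic\<close> for arbitrary value types, to cover functions with values in
  \<open>ennreal\<close> and in the complex numbers.\<close>

definition periodic2pi :: "(real \<Rightarrow> 'a) \<Rightarrow> bool" where
  "periodic2pi f \<longleftrightarrow> (\<forall>x. f (x + 2 * pi) = f x)"

lemma periodic2piD: "periodic2pi f \<Longrightarrow> f (x + 2 * pi) = f x"
  by (simp add: periodic2pi_def)

lemma periodic2pi_of_int:
  assumes "periodic2pi f" shows "f (x + of_int k * (2 * pi)) = f x"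
proof -
  interpret periodic_fun_simple f "2 * pi" by standard (rule periodic2piD[OF assms])
  show ?thesis by (rule plus_of_int)
qed

text \<open>The half-open interval makes translates by multiples of the period tile the line without
  overlap.\<close>

definition tint :: "(real \<Rightarrow> ennreal) \<Rightarrow> ennreal" where
  "tint F = (\<integral>\<^sup>+x. F x * indicator {0..<2 * pi} x \<partial>lborel)"

lemma nn_integral_lborel_shift:
  fixes F :: "real \<Rightarrow> ennreal"
  assumes "F \<in> borel_measurable borel"
  shows "(\<integral>\<^sup>+x. F (x + t) \<partial>lborel) = (\<integral>\<^sup>+x. F x \<partial>lborel)"
  using nn_integral_real_affine[OF assms, of 1 t] by (simp add: add.commute)

lemma nn_integral_lborel_reflect:
  fixes F :: "real \<Rightarrow> ennreal"
  assumes "F \<in> borel_measurable borel"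
  shows "(\<integral>\<^sup>+x. F (t - x) \<partial>lborel) = (\<integral>\<^sup>+x. F x \<partial>lborel)"
  using nn_integral_real_affine[OF assms, of "-1" t] by simp

lemma tint_any_period:
  fixes F :: "real \<Rightarrow> ennreal"
  assumes [measurable]: "F \<in> borel_measurable borel" and per: "periodic2pi F"
  shows "(\<integral>\<^sup>+x. F x * indicator {a..<a + 2 * pi} x \<partial>lborel) = tint F"
proof -
  define m where "m = \<lfloor>a / (2 * pi)\<rfloor>"
  define b where "b = a - of_int m * (2 * pi)"
  have b: "0 \<le> b" "b < 2 * pi"
    using floor_divide_lower[of "2 * pi" a] floor_divide_upper[of "2 * pi" a] by (auto simp: b_def m_def algebra_simps)
  have "(\<integral>\<^sup>+x. F x * indicator {a..<a + 2 * pi} x \<partial>lborel) 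
     = (\<integral>\<^sup>+x. F (x + of_int m * (2 * pi)) * indicator {a..<a + 2 * pi} (x + of_int m * (2 * pi)) \<partial>lborel)"
    by (rule nn_integral_lborel_shift[symmetric]) measurable
  also have "\<dots> = (\<integral>\<^sup>+x. F x * indicator {b..<2 * pi} x + F x * indicator {2 * pi..<b + 2 * pi} x \<partial>lborel)"
    using b by (intro nn_integral_cong) (auto simp: periodic2pi_of_int[OF per] b_def split: split_indicator)
  also have "\<dots> = (\<integral>\<^sup>+x. F x * indicator {b..<2 * pi} x \<partial>lborel) + (\<integral>\<^sup>+x. F x * indicator {2 * pi..<b + 2 * pi} x \<partial>lborel)"
    by (rule nn_integral_add) auto
  also have "(\<integral>\<^sup>+x. F x * indicator {2 * pi..<b + 2 * pi} x \<partial>lborel)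
    = (\<integral>\<^sup>+x. F (x + 2 * pi) * indicator {2 * pi..<b + 2 * pi} (x + 2 * pi) \<partial>lborel)"
    by (rule nn_integral_lborel_shift[symmetric]) measurable
  also have "\<dots> = (\<integral>\<^sup>+x. F x * indicator {0..<b} x \<partial>lborel)"
    by (intro nn_integral_cong) (auto simp: periodic2piD[OF per] split: split_indicator)
  also have "(\<integral>\<^sup>+x. F x * indicator {b..<2 * pi} x \<partial>lborel) + (\<integral>\<^sup>+x. F x * indicator {0..<b} x \<partial>lborel)
    = (\<integral>\<^sup>+x. F x * indicator {b..<2 * pi} x + F x * indicator {0..<b} x \<partial>lborel)"
    by (rule nn_integral_add[symmetric]) auto
  also have "\<dots> = tint F" unfolding tint_def
    using b by (intro nn_integral_cong) (auto split: split_indicator)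
  finally show ?thesis .
qed

lemma tint_shift:
  fixes F :: "real \<Rightarrow> ennreal"
  assumes [measurable]: "F \<in> borel_measurable borel" and per: "periodic2pi F"
  shows "tint (\<lambda>x. F (x + t)) = tint F"
proof -
  have "tint (\<lambda>x. F (x + t)) = (\<integral>\<^sup>+x. F (x + t) * indicator {t..<t + 2 * pi} (x + t) \<partial>lborel)"
    unfolding tint_def by (intro nn_integral_cong) (auto split: split_indicator)
  also have "\<dots> = (\<integral>\<^sup>+x. F x * indicator {t..<t + 2 * pi} x \<partial>lborel)"
    by (rule nn_integral_lborel_shift) measurable
  finally show ?thesis using tint_any_period[OF assms] by simp
qed

lemma nn_integral_periods:
  fixes F :: "real \<Rightarrow> ennreal"
  assumes [measurable]: "F \<in> borel_measurable borel" and per: "periodic2pi F"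
  shows "(\<integral>\<^sup>+x. F x * indicator {a..<a + real n * (2 * pi)} x \<partial>lborel) = of_nat n * tint F"
proof (induction n)
  case (Suc n)
  have "(\<integral>\<^sup>+x. F x * indicator {a..<a + real (Suc n) * (2 * pi)} x \<partial>lborel)
    = (\<integral>\<^sup>+x. F x * indicator {a..<a + real n * (2 * pi)} x + F x * indicator {a + real n * (2 * pi)..<(a + real n * (2 * pi)) + 2 * pi} x \<partial>lborel)"
  proof (rule nn_integral_cong)
    fix x
    have *: "F x * indicator {a..<a + y + p} x = F x * indicator {a..<a + y} x + F x * indicator {a + y..<a + y + p} x"
      if "0 \<le> y" "0 < p" for y p using that by (auto split: split_indicator)
    show "F x * indicator {a..<a + real (Suc n) * (2 * pi)} x = F x * indicator {a..<a + real n * (2 * pi)} x + F x * indicator {a + real n * (2 * pi)..<(a + real n * (2 * pi)) + 2 * pi} x"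
      using *[of "real n * (2 * pi)" "2 * pi"] by (simp add: algebra_simps)
  qed
  also have "\<dots> = of_nat n * tint F + tint F"
    by (subst nn_integral_add) (auto simp: Suc tint_any_period per)
  finally show ?case by (simp add: algebra_simps)
qed simp

lemma tint_mono: "(\<And>x. F x \<le> G x) \<Longrightarrow> tint F \<le> tint G"
  unfolding tint_def by (intro nn_integral_mono mult_right_mono) auto

lemma tint_cmult: "F \<in> borel_measurable borel \<Longrightarrow> tint (\<lambda>x. c * F x) = c * tint F"
  unfolding tint_def by (simp add: mult.assoc nn_integral_cmult)

lemma tint_add: "F \<in> borel_measurable borel \<Longrightarrow> G \<in> borel_measurable borel \<Longrightarrow> tint (\<lambda>x. F x + G x) = tint F + tint G"
  unfolding tint_def by (simp add: distrib_right nn_integral_add)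

lemma tint_suminf: "(\<And>i. F i \<in> borel_measurable borel) \<Longrightarrow> tint (\<lambda>x. \<Sum>i. F i x) = (\<Sum>i. tint (F i))"
  unfolding tint_def by (subst nn_integral_suminf[symmetric]) (auto simp: ennreal_suminf_multc)

text \<open>The argument is x + t, as in \<open>steklov\<close>, so this is the adjoint of
  convolution with K. Integration is over the whole line, with K not made periodic; values in
  \<open>ennreal\<close> spare every integrability condition.\<close>

definition nconv :: "(real \<Rightarrow> ennreal) \<Rightarrow> (real \<Rightarrow> ennreal) \<Rightarrow> real \<Rightarrow> ennreal" where
  "nconv K F x = (\<integral>\<^sup>+t. K t * F (x + t) \<partial>lborel)"

lemma nconv_borel [measurable]:
  assumes [measurable]: "K \<in> borel_measurable borel" "F \<in> borel_measurable borel"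
  shows "nconv K F \<in> borel_measurable borel"
  unfolding nconv_def by measurable

lemma nconv_periodic: "periodic2pi F \<Longrightarrow> periodic2pi (nconv K F)"
  unfolding periodic2pi_def nconv_def
proof (intro allI)
  fix x assume a: "\<forall>x. F (x + 2 * pi) = F x"
  have "F (x + 2 * pi + t) = F (x + t)" for t using a[rule_format, of "x + t"] by (simp add: algebra_simps)
  then show "(\<integral>\<^sup>+t. K t * F (x + 2 * pi + t) \<partial>lborel) = (\<integral>\<^sup>+t. K t * F (x + t) \<partial>lborel)" by simp
qed

text \<open>Fubini and translation invariance over a period; this is how an operator moves from F to
  the dual function.\<close>

lemma tint_nconv:
  assumes [measurable]: "K \<in> borel_measurable borel" "F \<in> borel_measurable borel" "G \<in> borel_measurable borel"
    and per: "periodic2pi F" "periodic2pi G"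
  shows "tint (\<lambda>x. nconv K F x * G x) = tint (\<lambda>x. F x * (\<integral>\<^sup>+t. K t * G (x - t) \<partial>lborel))"
proof -
  have "tint (\<lambda>x. nconv K F x * G x) = (\<integral>\<^sup>+x. (\<integral>\<^sup>+t. K t * F (x + t) * G x * indicator {0..<2 * pi} x \<partial>lborel) \<partial>lborel)"
    unfolding tint_def nconv_def by (intro nn_integral_cong) (simp add: nn_integral_multc)
  also have "\<dots> = (\<integral>\<^sup>+t. (\<integral>\<^sup>+x. K t * F (x + t) * G x * indicator {0..<2 * pi} x \<partial>lborel) \<partial>lborel)"
    by (rule lborel_pair.Fubini'[symmetric]) measurable
  also have "\<dots> = (\<integral>\<^sup>+t. (\<integral>\<^sup>+x. K t * F x * G (x - t) * indicator {0..<2 * pi} x \<partial>lborel) \<partial>lborel)"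
  proof (rule nn_integral_cong)
    fix t
    have "periodic2pi (\<lambda>x. K t * (F x * G (x - t)))"
      using periodic2piD[OF per(1)] periodic2piD[OF per(2), of "x - t" for x] 
      by (auto simp: periodic2pi_def algebra_simps)
    then have "tint (\<lambda>x. K t * (F (x + t) * G ((x + t) - t))) = tint (\<lambda>x. K t * (F x * G (x - t)))"
      by (intro tint_shift) measurable
    then show "(\<integral>\<^sup>+x. K t * F (x + t) * G x * indicator {0..<2 * pi} x \<partial>lborel) = (\<integral>\<^sup>+x. K t * F x * G (x - t) * indicator {0..<2 * pi} x \<partial>lborel)"
      by (simp add: tint_def mult.assoc)
  qed
  also have "\<dots> = (\<integral>\<^sup>+x. (\<integral>\<^sup>+t. K t * F x * G (x - t) * indicator {0..<2 * pi} x \<partial>lborel) \<partial>lborel)"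
    by (rule lborel_pair.Fubini') measurable
  also have "\<dots> = tint (\<lambda>x. F x * (\<integral>\<^sup>+t. K t * G (x - t) \<partial>lborel))"
    unfolding tint_def 
  proof (rule nn_integral_cong)
    fix x
    have "(\<integral>\<^sup>+t. K t * F x * G (x - t) * indicator {0..<2 * pi} x \<partial>lborel) = (\<integral>\<^sup>+t. F x * indicator {0..<2 * pi} x * (K t * G (x - t)) \<partial>lborel)"
      by (intro nn_integral_cong) (simp add: mult_ac)
    also have "\<dots> = F x * indicator {0..<2 * pi} x * (\<integral>\<^sup>+t. K t * G (x - t) \<partial>lborel)"
      by (rule nn_integral_cmult) measurable
    finally show "(\<integral>\<^sup>+t. K t * F x * G (x - t) * indicator {0..<2 * pi} x \<partial>lborel) = F x * (\<integral>\<^sup>+t. K t * G (x - t) \<partial>lborel) * indicator {0..<2 * pi} x"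
      by (simp add: mult_ac)
  qed
  finally show ?thesis .
qed

definition boxk :: "real \<Rightarrow> real \<Rightarrow> ennreal" where
  "boxk h t = ennreal (1 / h) * indicator {- h / 2..h / 2} t"

lemma box_borel [measurable]: "boxk h \<in> borel_measurable borel"
  unfolding boxk_def by measurable

lemma nn_integral_box: "0 < h \<Longrightarrow> (\<integral>\<^sup>+t. boxk h t \<partial>lborel) = 1"
  unfolding boxk_def by (subst nn_integral_cmult_indicator) (auto simp: ennreal_mult[symmetric])

lemma box_reflect: "(\<integral>\<^sup>+t. boxk h t * G (x - t) \<partial>lborel) = nconv (boxk h) G x"
  if [measurable]: "G \<in> borel_measurable borel" for G :: "real \<Rightarrow> ennreal"
proof -
  have "(\<integral>\<^sup>+t. boxk h (0 - t) * G (x - (0 - t)) \<partial>lborel) = (\<integral>\<^sup>+t. boxk h t * G (x - t) \<partial>lborel)"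
    by (rule nn_integral_lborel_reflect[where F = "\<lambda>t. boxk h t * G (x - t)"]) measurable
  moreover have "boxk h (0 - t) = boxk h t" for t by (auto simp: boxk_def split: split_indicator)
  ultimately show ?thesis by (simp add: nconv_def)
qed

lemma tint_nconv_box:
  assumes [measurable]: "G \<in> borel_measurable borel" and "periodic2pi G" "0 < h"
  shows "tint (nconv (boxk h) G) = tint G"
proof -
  have "tint (\<lambda>x. nconv (boxk h) (\<lambda>_. 1) x * G x) = tint (\<lambda>x. 1 * (\<integral>\<^sup>+t. boxk h t * G (x - t) \<partial>lborel))"
    using assms by (intro tint_nconv) (auto simp: periodic2pi_def)
  then show ?thesis using \<open>0 < h\<close> by (simp add: box_reflect nconv_def[of _ "\<lambda>_. 1"] nn_integral_box)
qed

lemma nconv_box_eq: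
  assumes [measurable]: "G \<in> borel_measurable borel" 
  shows "nconv (boxk h) G x = ennreal (1 / h) * (\<integral>\<^sup>+y. G y * indicator {x - h / 2..x + h / 2} y \<partial>lborel)"
proof -
  have "nconv (boxk h) G x = ennreal (1 / h) * (\<integral>\<^sup>+t. G (t + x) * indicator {x - h / 2..x + h / 2} (t + x) \<partial>lborel)"
    unfolding nconv_def boxk_def
    by (subst nn_integral_cmult[symmetric]) (auto intro!: nn_integral_cong split: split_indicator simp: add.commute)
  also have "(\<integral>\<^sup>+t. G (t + x) * indicator {x - h / 2..x + h / 2} (t + x) \<partial>lborel) = (\<integral>\<^sup>+y. G y * indicator {x - h / 2..x + h / 2} y \<partial>lborel)"
    by (rule nn_integral_lborel_shift) measurable
  finally show ?thesis .
qed

context orlicz_weight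
begin

text \<open>Competitors of \<open>orlicz_norm\<close> normalised to be nonnegative, Borel and
  periodic on the line; by \<open>orlicz_norm_eq_Nn\<close> the supremum is the same.\<close>

definition dual_ball :: "(real \<Rightarrow> real) set" where
  "dual_ball = {g. g \<in> borel_measurable borel \<and> (\<forall>x. 0 \<le> g x) \<and> periodic2pi g \<and>
     tint (\<lambda>x. psi (g x) * ennreal (W x)) \<le> 1}"

definition Nn :: "(real \<Rightarrow> ennreal) \<Rightarrow> ennreal" where
  "Nn F = (SUP g\<in>dual_ball. tint (\<lambda>x. F x * ennreal (g x * W x)))"

lemma Nn_upper: "g \<in> dual_ball \<Longrightarrow> tint (\<lambda>x. F x * ennreal (g x * W x)) \<le> Nn F"
  unfolding Nn_def by (rule SUP_upper)

lemma Nn_least: "(\<And>g. g \<in> dual_ball \<Longrightarrow> tint (\<lambda>x. F x * ennreal (g x * W x)) \<le> z) \<Longrightarrow> Nn F \<le> z"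
  unfolding Nn_def by (rule SUP_least)

lemma Nn_mono: "(\<And>x. F x \<le> G x) \<Longrightarrow> Nn F \<le> Nn G"
  by (rule Nn_least, rule order_trans[OF tint_mono Nn_upper]) (auto intro: mult_right_mono)

lemma Nn_suminf:
  assumes [measurable]: "\<And>i. F i \<in> borel_measurable borel"
  shows "Nn (\<lambda>x. \<Sum>i. F i x) \<le> (\<Sum>i. Nn (F i))"
proof (rule Nn_least)
  fix g assume g: "g \<in> dual_ball"
  then have [measurable]: "g \<in> borel_measurable borel" by (simp add: dual_ball_def)
  have "tint (\<lambda>x. (\<Sum>i. F i x) * ennreal (g x * W x)) = (\<Sum>i. tint (\<lambda>x. F i x * ennreal (g x * W x)))"
    by (subst tint_suminf[symmetric]) auto
  also have "\<dots> \<le> (\<Sum>i. Nn (F i))" by (intro suminf_le Nn_upper g) auto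
  finally show "tint (\<lambda>x. (\<Sum>i. F i x) * ennreal (g x * W x)) \<le> (\<Sum>i. Nn (F i))" .
qed

lemma Nn_cmult:
  assumes [measurable]: "F \<in> borel_measurable borel"
  shows "Nn (\<lambda>x. c * F x) \<le> c * Nn F"
proof (rule Nn_least)
  fix g assume g: "g \<in> dual_ball"
  then have [measurable]: "g \<in> borel_measurable borel" by (simp add: dual_ball_def)
  have "tint (\<lambda>x. c * F x * ennreal (g x * W x)) = c * tint (\<lambda>x. F x * ennreal (g x * W x))"
    by (subst tint_cmult[symmetric]) (auto simp: mult.assoc)
  also have "\<dots> \<le> c * Nn F" by (intro mult_left_mono Nn_upper g) auto
  finally show "tint (\<lambda>x. c * F x * ennreal (g x * W x)) \<le> c * Nn F" .
qed

lemma Nn_add: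
  assumes [measurable]: "F \<in> borel_measurable borel" "G \<in> borel_measurable borel"
  shows "Nn (\<lambda>x. F x + G x) \<le> Nn F + Nn G"
proof (rule Nn_least)
  fix g assume g: "g \<in> dual_ball"
  then have [measurable]: "g \<in> borel_measurable borel" by (simp add: dual_ball_def)
  have "tint (\<lambda>x. (F x + G x) * ennreal (g x * W x)) = tint (\<lambda>x. F x * ennreal (g x * W x)) + tint (\<lambda>x. G x * ennreal (g x * W x))"
    by (subst tint_add[symmetric]) (auto simp: distrib_right)
  also have "\<dots> \<le> Nn F + Nn G" by (intro add_mono Nn_upper g)
  finally show "tint (\<lambda>x. (F x + G x) * ennreal (g x * W x)) \<le> Nn F + Nn G" .
qed

lemma tint_W_finite: "tint (\<lambda>x. ennreal (W x)) < \<infinity>"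
proof -
  have i: "set_integrable lborel {0..2 * pi} W" using ap by (simp add: ap_bound_def)
  have "tint (\<lambda>x. ennreal (W x)) = ennreal (LINT x:{0..2 * pi}|lborel. W x)"
    unfolding tint_def nn_integral_Ico_eq_Icc 
    by (rule nn_integral_eq_set_integral_Icc[OF i]) (simp add: W_pos less_imp_le)
  then show ?thesis by simp
qed

text \<open>Young's inequality with x = 1. It makes g W locally integrable, so that the averages of
  g W are finite.\<close>

lemma dual_ball_integrable:
  assumes g: "g \<in> dual_ball"
  shows "tint (\<lambda>x. ennreal (g x * W x)) \<le> 1 + ennreal (\<phi> 1) * tint (\<lambda>x. ennreal (W x))"
proof -
  have [measurable]: "g \<in> borel_measurable borel" and g0: "\<And>x. 0 \<le> g x" using g by (auto simp: dual_ball_def)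
  have "tint (\<lambda>x. ennreal (g x * W x)) \<le> tint (\<lambda>x. psi (g x) * ennreal (W x) + ennreal (\<phi> 1) * ennreal (W x))"
  proof (rule tint_mono)
    fix x
    have "ennreal (g x * W x) = ennreal (1 * g x) * ennreal (W x)" using g0 W_pos[of x] by (simp add: ennreal_mult')
    also have "\<dots> \<le> (ennreal (\<phi> 1) + psi (g x)) * ennreal (W x)" by (intro mult_right_mono young_ineq) (auto simp: g0)
    finally show "ennreal (g x * W x) \<le> psi (g x) * ennreal (W x) + ennreal (\<phi> 1) * ennreal (W x)"
      by (simp add: distrib_right add.commute)
  qed
  also have "\<dots> = tint (\<lambda>x. psi (g x) * ennreal (W x)) + ennreal (\<phi> 1) * tint (\<lambda>x. ennreal (W x))"
    by (subst tint_add) (auto simp: tint_cmult)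
  also have "\<dots> \<le> 1 + ennreal (\<phi> 1) * tint (\<lambda>x. ennreal (W x))"
    using g by (intro add_mono) (auto simp: dual_ball_def)
  finally show ?thesis .
qed

lemma dual_ball_set_integrable:
  assumes g: "g \<in> dual_ball"
  shows "set_integrable lborel {u..v} (\<lambda>x. g x * W x)"
proof -
  have [measurable]: "g \<in> borel_measurable borel" and g0: "\<And>x. 0 \<le> g x" and gp: "periodic2pi g" 
    using g by (auto simp: dual_ball_def)
  have fin: "tint (\<lambda>x. ennreal (g x * W x)) < \<infinity>"
    using tint_W_finite by (intro le_less_trans[OF dual_ball_integrable[OF g]]) (auto simp: ennreal_mult_less_top)
  have per: "periodic2pi (\<lambda>x. ennreal (g x * W x))" using gp W_periodic by (simp add: periodic2pi_def)
  obtain n where n: "(v - u) / (2 * pi) < real n" using reals_Archimedean2 by blast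
  then have n: "v < u + real n * (2 * pi)" by (simp add: field_simps)
  have "(\<integral>\<^sup>+x. ennreal (indicator {u..v} x * (g x * W x)) \<partial>lborel) \<le> (\<integral>\<^sup>+x. ennreal (g x * W x) * indicator {u..<u + real n * (2 * pi)} x \<partial>lborel)"
    using n by (intro nn_integral_mono) (auto split: split_indicator)
  also have "\<dots> = of_nat n * tint (\<lambda>x. ennreal (g x * W x))" by (rule nn_integral_periods) (auto simp: per)
  also have "\<dots> < \<infinity>" using fin by (auto simp: ennreal_mult_less_top of_nat_less_top)
  finally show ?thesis
    unfolding set_integrable_def real_scaleR_def using g0 W_pos
    by (intro integrableI_nonneg) (auto simp: less_imp_le)
qed

text \<open>2 Cmod bounds the modular of the averaged dual function and is divided out by
  \<open>psi_scale\<close>; C0 is the dilation lost in \<open>modular_interval\<close>.\<close>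

definition "Kbox = 2 * Cmod * C0"

lemma Kbox_pos: "0 < Kbox" using Cmod_ge C0 by (simp add: Kbox_def)

text \<open>The modular of the averaged function is itself averaged over windows of length \<open>h\<close>; on each window
  the average of \<open>g W\<close> is dominated by a constant, which reduces the claim to a single interval.\<close>

lemma box_dual:
  assumes g: "g \<in> dual_ball" and h: "0 < h"
  shows "\<exists>g'\<in>dual_ball. \<forall>x. nconv (boxk h) (\<lambda>x. ennreal (g x * W x)) x = ennreal Kbox * ennreal (g' x * W x)"
proof -
  have [measurable]: "g \<in> borel_measurable borel" and g0: "\<And>x. 0 \<le> g x" and gp: "periodic2pi g" 
    using g by (auto simp: dual_ball_def)
  define G where "G = (\<lambda>x. ennreal (g x * W x))"
  have [measurable]: "G \<in> borel_measurable borel" by (simp add: G_def)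
  have G: "(\<integral>\<^sup>+y. G y * indicator {u..v} y \<partial>lborel) = ennreal (LINT y:{u..v}|lborel. g y * W y)" for u v
    unfolding G_def using g0 W_pos
    by (intro nn_integral_eq_set_integral_Icc dual_ball_set_integrable g) (auto simp: less_imp_le)
  define A where "A = nconv (boxk h) G"
  have Gper: "periodic2pi G" using gp W_periodic by (simp add: G_def periodic2pi_def)
  have [measurable]: "A \<in> borel_measurable borel" by (simp add: A_def)
  have Aper: "periodic2pi A" unfolding A_def by (rule nconv_periodic[OF Gper])
  have A: "A x = ennreal ((1 / h) * (LINT y:{x - h / 2..x + h / 2}|lborel. g y * W y))" for x
    unfolding A_def nconv_box_eq[OF \<open>G \<in> borel_measurable borel\<close>] G using h by (subst ennreal_mult') auto
  have Ifin: "A x = ennreal (enn2real (A x))" for x by (simp add: A)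
  have LI: "0 \<le> (LINT y:{u..v}|lborel. g y * W y)" for u v
    unfolding set_lebesgue_integral_def using g0 W_pos by (intro Bochner_Integration.integral_nonneg) (auto simp: less_imp_le)
  have Areal: "enn2real (A x) = (1 / h) * (LINT y:{x - h / 2..x + h / 2}|lborel. g y * W y)" for x
    unfolding A using h LI by (subst enn2real_ennreal) auto
  define g1 where "g1 = (\<lambda>x. (1 / C0) * enn2real (A x) / W x)"
  have [measurable]: "g1 \<in> borel_measurable borel" unfolding g1_def by measurable
  have g1nn: "0 \<le> g1 x" for x using C0 W_pos[of x] by (simp add: g1_def less_imp_le)
  have g1per: "periodic2pi g1" using Aper W_periodic by (simp add: g1_def periodic2pi_def)
  define P where "P = (\<lambda>x. psi (g x) * ennreal (W x))"
  have [measurable]: "P \<in> borel_measurable borel" unfolding P_def by measurable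
  have Pper: "periodic2pi P" using gp W_periodic by (simp add: P_def periodic2pi_def)
  define P1 where "P1 = (\<lambda>x. psi (g1 x) * ennreal (W x))"
  have [measurable]: "P1 \<in> borel_measurable borel" unfolding P1_def by measurable
  have P1per: "periodic2pi P1" using g1per W_periodic by (simp add: P1_def periodic2pi_def)
  have "tint P1 = tint (nconv (boxk h) P1)" by (rule tint_nconv_box[symmetric]) (auto simp: P1per h)
  also have "\<dots> \<le> tint (\<lambda>y. ennreal (2 * Cmod) * nconv (boxk (2 * h)) P y)"
  proof (rule tint_mono)
    fix y
    have "nconv (boxk h) P1 y = ennreal (1 / h) * (\<integral>\<^sup>+x. P1 x * indicator {y - h / 2..y + h / 2} x \<partial>lborel)"
      by (rule nconv_box_eq) measurable
    also have "\<dots> \<le> ennreal (1 / h) * (ennreal Cmod * (\<integral>\<^sup>+x. P x * indicator {y-h..y+h} x \<partial>lborel))"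
    proof (rule mult_left_mono)
    have "(\<integral>\<^sup>+x. P1 x * indicator {y - h / 2..y + h / 2} x \<partial>lborel) 
      \<le> (\<integral>\<^sup>+x. psi ((1 / C0) * ((1 / h) * (LINT x:{y-h..y+h}|lborel. g x * W x)) / W x) * ennreal (W x) * indicator {y-h..y+h} x \<partial>lborel)"
    proof (rule nn_integral_mono)
      fix x
      have "P1 x \<le> psi ((1 / C0) * ((1 / h) * (LINT x:{y-h..y+h}|lborel. g x * W x)) / W x) * ennreal (W x)"
        if x: "x \<in> {y - h / 2..y + h / 2}"
      proof -
        have "ennreal (LINT y:{x - h / 2..x + h / 2}|lborel. g y * W y) \<le> ennreal (LINT x:{y-h..y+h}|lborel. g x * W x)"
          unfolding G[symmetric] using x by (intro nn_integral_mono) (auto split: split_indicator)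
        then have "(LINT y:{x - h / 2..x + h / 2}|lborel. g y * W y) \<le> (LINT x:{y-h..y+h}|lborel. g x * W x)"
          using LI by simp
        then have "g1 x \<le> (1 / C0) * ((1 / h) * (LINT x:{y-h..y+h}|lborel. g x * W x)) / W x"
          unfolding g1_def Areal using C0 h W_pos[of x] by (intro divide_right_mono mult_left_mono) auto
        then show ?thesis unfolding P1_def by (intro mult_right_mono psi_mono) auto
      qed
      then show "P1 x * indicator {y - h / 2..y + h / 2} x \<le> psi ((1 / C0) * ((1 / h) * (LINT x:{y-h..y+h}|lborel. g x * W x)) / W x) * ennreal (W x) * indicator {y-h..y+h} x"
        using h by (auto split: split_indicator)
    qed
    also have "\<dots> \<le> ennreal Cmod * (\<integral>\<^sup>+x. P x * indicator {y-h..y+h} x \<partial>lborel)"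
      unfolding P_def by (rule modular_interval[OF _ g0 h dual_ball_set_integrable[OF g]]) measurable
    finally show "(\<integral>\<^sup>+x. P1 x * indicator {y - h / 2..y + h / 2} x \<partial>lborel) \<le> ennreal Cmod * (\<integral>\<^sup>+x. P x * indicator {y-h..y+h} x \<partial>lborel)" .
    qed simp
    also have "ennreal (1 / h) * (ennreal Cmod * (\<integral>\<^sup>+x. P x * indicator {y-h..y+h} x \<partial>lborel))
      = ennreal (2 * Cmod) * nconv (boxk (2 * h)) P y"
    proof -
      \<comment> \<open>The doubled window [y - h, y + h] is averaged with weight 1 / (2 h), hence
        the factor 2.\<close>
      have "ennreal (1 / h) * ennreal Cmod = ennreal (2 * Cmod) * ennreal (1 / (2 * h))"
        using h Cmod_ge by (simp add: ennreal_mult'[symmetric])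
      then show ?thesis by (subst nconv_box_eq) (auto simp: mult.assoc[symmetric])
    qed
    finally show "nconv (boxk h) P1 y \<le> ennreal (2 * Cmod) * nconv (boxk (2 * h)) P y" .
  qed
  also have "\<dots> = ennreal (2 * Cmod) * tint P"
    using h Pper by (subst tint_cmult) (auto simp: tint_nconv_box)
  also have "\<dots> \<le> ennreal (2 * Cmod) * 1" using g by (intro mult_left_mono) (auto simp: P_def dual_ball_def)
  finally have m: "tint P1 \<le> ennreal (2 * Cmod)" by simp
  define g' where "g' = (\<lambda>x. (1 / (2 * Cmod)) * g1 x)"
  have "tint (\<lambda>x. psi (g' x) * ennreal (W x)) \<le> tint (\<lambda>x. ennreal (1 / (2 * Cmod)) * P1 x)"
  proof (rule tint_mono)
    fix x
    have "psi (g' x) \<le> ennreal (1 / (2 * Cmod)) * psi (g1 x)"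
      unfolding g'_def using Cmod_ge by (intro psi_scale) auto
    then show "psi (g' x) * ennreal (W x) \<le> ennreal (1 / (2 * Cmod)) * P1 x"
      unfolding P1_def by (simp add: mult.assoc[symmetric] mult_right_mono)
  qed
  also have "\<dots> = ennreal (1 / (2 * Cmod)) * tint P1" by (rule tint_cmult) measurable
  also have "\<dots> \<le> ennreal (1 / (2 * Cmod)) * ennreal (2 * Cmod)" by (intro mult_left_mono m) auto
  also have "\<dots> = 1" using Cmod_ge by (simp add: ennreal_mult'[symmetric])
  finally have "g' \<in> dual_ball"
    using g1per g1nn Cmod_ge by (auto simp: dual_ball_def g'_def periodic2pi_def)
  moreover have "A x = ennreal Kbox * ennreal (g' x * W x)" for x
  proof -
    have "Kbox * (g' x * W x) = enn2real (A x)"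
      using Cmod_ge C0 W_pos[of x] by (simp add: Kbox_def g'_def g1_def)
    then show ?thesis using Ifin[of x] Kbox_pos by (simp add: ennreal_mult'[symmetric])
  qed
  ultimately show ?thesis unfolding A_def G_def by blast
qed

text \<open>The total mass of K is bounded together with its action on \<open>Nn\<close>: the mass
  makes the kernels integrable, which their Fourier transforms and the convolution theorem
  require.\<close>

definition opbd :: "(real \<Rightarrow> ennreal) \<Rightarrow> ennreal \<Rightarrow> bool" where
  "opbd K A \<longleftrightarrow> K \<in> borel_measurable borel \<and> (\<integral>\<^sup>+t. K t \<partial>lborel) \<le> A \<and>
     (\<forall>F. F \<in> borel_measurable borel \<longrightarrow> periodic2pi F \<longrightarrow> Nn (nconv K F) \<le> A * Nn F)"

text \<open>The box kernel is even, so its adjoint is the same average, and \<open>box_dual\<close>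
  keeps the dual function in a multiple of the ball. The summand 1 accounts for the mass of the
  kernel.\<close>

lemma opbd_box:
  assumes h: "0 < h" shows "opbd (boxk h) (ennreal (1 + Kbox))"
  unfolding opbd_def
proof (intro conjI allI impI)
  have "ennreal 1 \<le> ennreal (1 + Kbox)" using Kbox_pos by (intro ennreal_leI) simp
  then show "(\<integral>\<^sup>+t. boxk h t \<partial>lborel) \<le> ennreal (1 + Kbox)" using nn_integral_box[OF h] by simp
  fix F :: "real \<Rightarrow> ennreal" assume [measurable]: "F \<in> borel_measurable borel" and per: "periodic2pi F"
  show "Nn (nconv (boxk h) F) \<le> ennreal (1 + Kbox) * Nn F"
  proof (rule Nn_least)
    fix g assume g: "g \<in> dual_ball"
    then have [measurable]: "g \<in> borel_measurable borel" and gp: "periodic2pi g" by (auto simp: dual_ball_def)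
    obtain g' where g': "g' \<in> dual_ball" "\<And>x. nconv (boxk h) (\<lambda>x. ennreal (g x * W x)) x = ennreal Kbox * ennreal (g' x * W x)"
      using box_dual[OF g h] by blast
    then have [measurable]: "g' \<in> borel_measurable borel" by (auto simp: dual_ball_def)
    have "tint (\<lambda>x. nconv (boxk h) F x * ennreal (g x * W x)) = tint (\<lambda>x. F x * (\<integral>\<^sup>+t. boxk h t * ennreal (g (x - t) * W (x - t)) \<partial>lborel))"
      using gp W_periodic by (intro tint_nconv) (auto simp: per, simp add: periodic2pi_def)
    also have "\<dots> = tint (\<lambda>x. ennreal Kbox * (F x * ennreal (g' x * W x)))"
    proof -
      have "(\<integral>\<^sup>+t. boxk h t * ennreal (g (x - t) * W (x - t)) \<partial>lborel) = nconv (boxk h) (\<lambda>x. ennreal (g x * W x)) x" for x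
        by (rule box_reflect) measurable
      then show ?thesis unfolding g'(2) by (simp only: mult.left_commute)
    qed
    also have "\<dots> = ennreal Kbox * tint (\<lambda>x. F x * ennreal (g' x * W x))" by (rule tint_cmult) measurable
    also have "\<dots> \<le> ennreal Kbox * Nn F" by (intro mult_left_mono Nn_upper g') auto
    also have "\<dots> \<le> ennreal (1 + Kbox) * Nn F" by (intro mult_right_mono ennreal_leI) auto
    finally show "tint (\<lambda>x. nconv (boxk h) F x * ennreal (g x * W x)) \<le> ennreal (1 + Kbox) * Nn F" .
  qed
qed measurable

lemma opbd_mono:
  assumes "opbd K A" "K' \<in> borel_measurable borel" "\<And>t. K' t \<le> K t" "A \<le> A'"
  shows "opbd K' A'"
  unfolding opbd_def
proof (intro conjI allI impI)
  show "(\<integral>\<^sup>+t. K' t \<partial>lborel) \<le> A'"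
    using assms nn_integral_mono[of lborel K' K] by (auto simp: opbd_def intro: order_trans)
  fix F :: "real \<Rightarrow> ennreal" assume F: "F \<in> borel_measurable borel" "periodic2pi F"
  have "Nn (nconv K' F) \<le> Nn (nconv K F)"
    unfolding nconv_def by (intro Nn_mono nn_integral_mono mult_right_mono assms) auto
  also have "\<dots> \<le> A * Nn F" using assms F by (auto simp: opbd_def)
  also have "\<dots> \<le> A' * Nn F" using assms by (intro mult_right_mono) auto
  finally show "Nn (nconv K' F) \<le> A' * Nn F" .
qed (rule assms)

lemma opbd_suminf:
  assumes "\<And>i. opbd (K i) (A i)"
  shows "opbd (\<lambda>t. \<Sum>i. K i t) (\<Sum>i. A i)"
  unfolding opbd_def
proof (intro conjI allI impI)
  have [measurable]: "K i \<in> borel_measurable borel" for i using assms by (simp add: opbd_def)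
  show "(\<lambda>t. \<Sum>i. K i t) \<in> borel_measurable borel" by measurable
  show "(\<integral>\<^sup>+t. (\<Sum>i. K i t) \<partial>lborel) \<le> (\<Sum>i. A i)"
    using assms by (subst nn_integral_suminf) (auto intro!: suminf_le simp: opbd_def)
  fix F :: "real \<Rightarrow> ennreal" assume F [measurable]: "F \<in> borel_measurable borel" and p: "periodic2pi F"
  have "nconv (\<lambda>t. \<Sum>i. K i t) F = (\<lambda>x. \<Sum>i. nconv (K i) F x)"
    unfolding nconv_def by (intro ext) (simp add: nn_integral_suminf[symmetric])
  then have "Nn (nconv (\<lambda>t. \<Sum>i. K i t) F) \<le> (\<Sum>i. Nn (nconv (K i) F))" by (simp add: Nn_suminf)
  also have "\<dots> \<le> (\<Sum>i. A i * Nn F)" using assms F p by (intro suminf_le) (auto simp: opbd_def)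
  finally show "Nn (nconv (\<lambda>t. \<Sum>i. K i t) F) \<le> (\<Sum>i. A i) * Nn F" by simp
qed

lemma opbd_cmult:
  assumes "opbd K A" shows "opbd (\<lambda>t. c * K t) (c * A)"
  unfolding opbd_def
proof (intro conjI allI impI)
  have [measurable]: "K \<in> borel_measurable borel" using assms by (simp add: opbd_def)
  show "(\<lambda>t. c * K t) \<in> borel_measurable borel" by measurable
  show "(\<integral>\<^sup>+t. c * K t \<partial>lborel) \<le> c * A" using assms by (auto simp: nn_integral_cmult opbd_def intro: mult_left_mono)
  fix F :: "real \<Rightarrow> ennreal" assume F [measurable]: "F \<in> borel_measurable borel" and p: "periodic2pi F"
  have "nconv (\<lambda>t. c * K t) F = (\<lambda>x. c * nconv K F x)"
    unfolding nconv_def by (simp add: mult.assoc nn_integral_cmult)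
  then have "Nn (nconv (\<lambda>t. c * K t) F) \<le> c * Nn (nconv K F)" by (simp add: Nn_cmult)
  also have "\<dots> \<le> c * (A * Nn F)" using assms F p by (intro mult_left_mono) (auto simp: opbd_def)
  finally show "Nn (nconv (\<lambda>t. c * K t) F) \<le> c * A * Nn F" by (simp add: mult.assoc)
qed

definition "Kdec = 16 * (1 + Kbox)"

lemma Kdec_pos: "0 < Kdec" using Kbox_pos by (simp add: Kdec_def)

text \<open>On the shell 2^(i-1) / N < |t| \<le> 2^i / N the kernel is at most 4 A N / 4^i, which is
  8 A / 2^i times the value of the box kernel of length 2^(i+1) / N. The coefficients sum to 16 A,
  the origin of \<open>Kdec\<close>. Boxes of all lengths have the same operator bound, so their
  superposition is bounded.\<close>

lemma opbd_decay:
  assumes [measurable]: "k \<in> borel_measurable borel" and N: "0 < N" and A: "0 \<le> A"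
    and b1: "\<And>t. \<bar>k t\<bar> \<le> A * N" and b2: "\<And>t. \<bar>k t\<bar> * t\<^sup>2 \<le> A / N"
  shows "opbd (\<lambda>t. ennreal \<bar>k t\<bar>) (ennreal (A * Kdec))"
proof (rule opbd_mono)
  define s where "s = (\<lambda>i::nat. 2 ^ Suc i / N)"
  have s: "0 < s i" for i using N by (simp add: s_def)
  show "opbd (\<lambda>t. \<Sum>i. ennreal (8 * A * (1/2) ^ i) * boxk (s i) t) (\<Sum>i. ennreal (8 * A * (1/2) ^ i) * ennreal (1 + Kbox))"
    by (intro opbd_suminf opbd_cmult opbd_box s)
  have "(\<lambda>i. 8 * A * (1/2) ^ i) sums (8 * A * (1 / (1 - 1/2)))" by (intro sums_mult geometric_sums) simp
  then have "(\<Sum>i. ennreal (8 * A * (1/2) ^ i)) = ennreal (16 * A)"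
    using A by (subst suminf_ennreal2) (auto simp: sums_iff)
  then show "(\<Sum>i. ennreal (8 * A * (1/2) ^ i) * ennreal (1 + Kbox)) \<le> ennreal (A * Kdec)"
    unfolding ennreal_suminf_multc using A Kbox_pos
    by (simp add: ennreal_mult''[symmetric] Kdec_def mult_ac del: ennreal_plus)
  fix t
  define i where "i = (LEAST i. \<bar>t\<bar> \<le> 2 ^ i / N)"
  have ex: "\<exists>i::nat. \<bar>t\<bar> \<le> 2 ^ i / N"
  proof -
    obtain i where "\<bar>t\<bar> * N < 2 ^ i" using real_arch_pow[of 2 "\<bar>t\<bar> * N"] by auto
    then show ?thesis using N by (intro exI[of _ i]) (simp add: field_simps)
  qed
  have i: "\<bar>t\<bar> \<le> 2 ^ i / N" unfolding i_def using ex by (rule LeastI_ex)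
  have "\<bar>k t\<bar> \<le> 4 * A * N / 4 ^ i"
  proof (cases i)
    case 0
    then show ?thesis using b1[of t] A N by (auto intro: order_trans)
  next
    case (Suc j)
    then have "\<not> \<bar>t\<bar> \<le> 2 ^ j / N" using not_less_Least[of j "\<lambda>i. \<bar>t\<bar> \<le> 2 ^ i / N"] by (simp add: i_def)
    then have t: "2 ^ j / N < \<bar>t\<bar>" by simp
    then have t2: "(2 ^ j / N)\<^sup>2 \<le> t\<^sup>2" using N by (metis abs_le_square_iff abs_of_pos less_imp_le divide_pos_pos zero_less_numeral zero_less_power)
    have "\<bar>k t\<bar> * (2 ^ j / N)\<^sup>2 \<le> A / N" using b2[of t] mult_left_mono[OF t2, of "\<bar>k t\<bar>"] by simp
    moreover have "(2 ^ j)\<^sup>2 = (4::real) ^ j" by (simp add: power_mult[symmetric] mult.commute power2_eq_square power_mult_distrib[symmetric])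
    ultimately show ?thesis using N Suc by (simp add: power_divide field_simps power2_eq_square)
  qed
  also have "\<dots> = 8 * A * (1/2) ^ i * (1 / s i)" 
  proof -
    have "(4::real) ^ i = 2 ^ i * 2 ^ i" by (simp flip: power_mult_distrib)
    then show ?thesis using N by (simp add: s_def power_divide field_simps)
  qed
  finally have "ennreal \<bar>k t\<bar> \<le> ennreal (8 * A * (1/2) ^ i) * boxk (s i) t"
    using i N A by (auto simp: boxk_def s_def ennreal_mult'[symmetric] split: split_indicator intro!: ennreal_leI)
  also have "\<dots> = (\<Sum>j\<in>{i}. ennreal (8 * A * (1/2) ^ j) * boxk (s j) t)" by simp
  also have "\<dots> \<le> (\<Sum>j. ennreal (8 * A * (1/2) ^ j) * boxk (s j) t)" by (intro sum_le_suminf) auto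
  finally show "ennreal \<bar>k t\<bar> \<le> \<dots>" .
qed measurable

end

section \<open>Borel versions and the Orlicz norm in terms of them\<close>

lemma periodic_iff_periodic2pi: "periodic f \<longleftrightarrow> periodic2pi f"
  by (simp add: periodic_def periodic2pi_def)

lemma borel_imp_lebesgue: "f \<in> borel_measurable borel \<Longrightarrow> f \<in> borel_measurable lebesgue"
  by (rule measurable_completion) simp

lemma integral_lebesgue_eq_lborel:
  fixes f :: "real \<Rightarrow> 'b :: {banach, second_countable_topology}"
  assumes f: "f \<in> borel_measurable lebesgue" and f0: "f0 \<in> borel_measurable borel" and ae: "AE x in lborel. f x = f0 x"
  shows "integrable lebesgue f \<longleftrightarrow> integrable lborel f0" "integral\<^sup>L lebesgue f = integral\<^sup>L lborel f0"
proof -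
  have ae': "AE x in lebesgue. f x = f0 x" using ae by (rule AE_completion)
  have "integrable lebesgue f \<longleftrightarrow> integrable lebesgue f0"
    by (rule integrable_cong_AE[OF f borel_imp_lebesgue[OF f0] ae'])
  also have "\<dots> \<longleftrightarrow> integrable lborel f0" by (rule integrable_completion) (use f0 in simp)
  finally show "integrable lebesgue f \<longleftrightarrow> integrable lborel f0" .
  have "integral\<^sup>L lebesgue f = integral\<^sup>L lebesgue f0"
    by (rule integral_cong_AE[OF f borel_imp_lebesgue[OF f0] ae'])
  also have "\<dots> = integral\<^sup>L lborel f0" by (rule integral_completion) (use f0 in simp)
  finally show "integral\<^sup>L lebesgue f = integral\<^sup>L lborel f0" .
qed

definition wrap :: "real \<Rightarrow> real" where
  "wrap x = x - of_int \<lfloor>x / (2 * pi)\<rfloor> * (2 * pi)"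

lemma wrap_borel [measurable]: "wrap \<in> borel_measurable borel"
  unfolding wrap_def by measurable

lemma wrap_range: "0 \<le> wrap x" "wrap x < 2 * pi"
  using floor_divide_lower[of "2 * pi" x] floor_divide_upper[of "2 * pi" x] by (auto simp: wrap_def algebra_simps)

lemma wrap_id: "0 \<le> x \<Longrightarrow> x < 2 * pi \<Longrightarrow> wrap x = x"
proof -
  assume "0 \<le> x" "x < 2 * pi"
  then have "\<lfloor>x / (2 * pi)\<rfloor> = 0" by (simp add: floor_eq_iff)
  then show ?thesis by (simp add: wrap_def)
qed

lemma wrap_periodic: "wrap (x + 2 * pi) = wrap x"
proof -
  have "(x + 2 * pi) / (2 * pi) = x / (2 * pi) + 1" by (simp add: field_simps)
  then show ?thesis by (simp add: wrap_def algebra_simps)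
qed

lemma periodic2pi_wrap: "periodic2pi f \<Longrightarrow> f (wrap x) = f x"
  using periodic2pi_of_int[of f "wrap x" "\<lfloor>x / (2 * pi)\<rfloor>"] by (simp add: wrap_def)

text \<open>The exceptional set is covered by the countably many translates of a null set of one
  period. The property need only pass from \<open>wrap x\<close> to x, which suits equations between
  periodic functions.\<close>

lemma AE_periodic:
  assumes per: "\<And>x. P (wrap x) \<Longrightarrow> P x" and ae: "AE x in lborel. x \<in> {0..<2 * pi} \<longrightarrow> P x"
  shows "AE x in lborel. P x"
proof -
  obtain N where N: "N \<in> null_sets lborel" "{x \<in> space lborel. \<not> (x \<in> {0..<2 * pi} \<longrightarrow> P x)} \<subseteq> N"
    using ae by (auto elim!: AE_E simp: null_sets_def)
  define M where "M = (\<Union>k::int. {x. x - of_int k * (2 * pi) \<in> N})"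
  have M: "M \<in> null_sets lborel"
    unfolding M_def by (intro null_sets_UN null_sets_translation N)
  have "{x \<in> space lborel. \<not> P x} \<subseteq> M"
  proof
    fix x assume "x \<in> {x \<in> space lborel. \<not> P x}"
    then have "\<not> P (wrap x)" using per by auto
    then have "wrap x \<in> N" using wrap_range[of x] N(2) by auto
    then show "x \<in> M" by (auto simp: M_def wrap_def)
  qed
  with M show ?thesis by (rule AE_I')
qed

text \<open>A Borel version given by completion need not be periodic; composing it with
  \<open>wrap\<close> restores periodicity and changes nothing on the first period.\<close>

lemma periodic_borel_version:
  fixes f :: "real \<Rightarrow> real"
  assumes f: "f \<in> borel_measurable lebesgue" and per: "periodic2pi f"
  obtains f0 where "f0 \<in> borel_measurable borel" "periodic2pi f0" "AE x in lborel. f x = f0 x"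
proof -
  obtain f1 where f1 [measurable]: "f1 \<in> borel_measurable lborel" and ae: "AE x in lborel. f x = f1 x"
    using completion_ex_borel_measurable_real[OF f] by blast
  define f0 where "f0 = (\<lambda>x. f1 (wrap x))"
  have "f0 \<in> borel_measurable borel" unfolding f0_def by measurable
  moreover have p0: "periodic2pi f0" by (simp add: f0_def periodic2pi_def wrap_periodic)
  moreover have "AE x in lborel. f x = f0 x"
  proof (rule AE_periodic)
    show "f x = f0 x" if "f (wrap x) = f0 (wrap x)" for x using that periodic2pi_wrap per p0 by metis
    show "AE x in lborel. x \<in> {0..<2 * pi} \<longrightarrow> f x = f0 x"
      using ae by eventually_elim (auto simp: f0_def wrap_id)
  qed
  ultimately show ?thesis by (rule that)
qed

text \<open>Values that are not positive are replaced by 1, so that positivity holds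
  everywhere.\<close>

lemma weight_borel_version:
  assumes "weight w"
  obtains w0 where "w0 \<in> borel_measurable borel" "periodic2pi w0" "\<And>x. 0 < w0 x" "AE x in lborel. w x = w0 x"
proof -
  have w: "w \<in> borel_measurable lebesgue" "periodic2pi w" "AE x in lborel. 0 < w x"
    using assms by (auto simp: weight_def periodic_iff_periodic2pi AE_completion_iff)
  obtain f where f [measurable]: "f \<in> borel_measurable borel" "periodic2pi f" "AE x in lborel. w x = f x"
    using periodic_borel_version[OF w(1,2)] by blast
  show ?thesis
  proof (rule that[of "\<lambda>x. if 0 < f x then f x else 1"])
    show "AE x in lborel. w x = (if 0 < f x then f x else 1)"
      using f(3) w(3) by eventually_elim auto
  qed (use f in \<open>auto simp: periodic2pi_def\<close>)
qed

lemma muckenhoupt_ap_bound: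
  assumes w: "w \<in> muckenhoupt p" and w0: "w0 \<in> borel_measurable borel" and ae: "AE x in lborel. w x = w0 x"
  shows "\<exists>B. ap_bound w0 p B"
proof -
  note [measurable] = w0
  have m: "w \<in> borel_measurable lebesgue" using w by (simp add: muckenhoupt_def weight_def)
  note [measurable] = m
  have e: "set_integrable lebesgue {a..b} u \<longleftrightarrow> set_integrable lborel {a..b} v"
     "(LINT x:{a..b}|lebesgue. u x) = (LINT x:{a..b}|lborel. v x)"
     if [measurable]: "u \<in> borel_measurable lebesgue" "v \<in> borel_measurable borel" and ae: "AE x in lborel. u x = v x" for a b and u v :: "real \<Rightarrow> real"
  proof -
    have "(\<lambda>x. indicator {a..b} x *\<^sub>R u x) \<in> borel_measurable lebesgue" 
      "(\<lambda>x. indicator {a..b} x *\<^sub>R v x) \<in> borel_measurable borel" 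
      by (intro borel_measurable_scaleR borel_measurable_indicator that; simp)+
    moreover have "AE x in lborel. indicator {a..b} x *\<^sub>R u x = indicator {a..b} x *\<^sub>R v x"
      using ae by eventually_elim simp
    ultimately show "set_integrable lebesgue {a..b} u \<longleftrightarrow> set_integrable lborel {a..b} v"
     "(LINT x:{a..b}|lebesgue. u x) = (LINT x:{a..b}|lborel. v x)"
      unfolding set_integrable_def set_lebesgue_integral_def by (rule integral_lebesgue_eq_lborel)+
  qed
  note e1 = e[OF m w0 ae]
  have "AE x in lborel. w x powr c = w0 x powr c" for c using ae by eventually_elim simp
  then have e2: "set_integrable lebesgue {a..b} (\<lambda>x. w x powr c) \<longleftrightarrow> set_integrable lborel {a..b} (\<lambda>x. w0 x powr c)"
     "(LINT x:{a..b}|lebesgue. w x powr c) = (LINT x:{a..b}|lborel. w0 x powr c)" for a b c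
    by (intro e; measurable)+
  obtain B where B: "\<forall>a b. a < b \<longrightarrow>
        (1 / (b - a) * (LINT x:{a..b}|lebesgue. w x)) *
        (1 / (b - a) * (LINT x:{a..b}|lebesgue. w x powr (1 / (1 - p)))) powr (p - 1) \<le> B"
    using w unfolding muckenhoupt_def by blast
  have si: "set_integrable lebesgue {a..b} w \<and> set_integrable lebesgue {a..b} (\<lambda>x. w x powr (1 / (1 - p)))" if "a < b" for a b
    using w that unfolding muckenhoupt_def by blast
  have "ap_bound w0 p B"
    unfolding ap_bound_def
  proof (intro allI impI)
    fix a b :: real assume "a < b"
    then show "set_integrable lborel {a..b} w0 \<and>
        set_integrable lborel {a..b} (\<lambda>x. w0 x powr (1 / (1 - p))) \<and>
        (1 / (b - a) * (LINT x:{a..b}|lborel. w0 x)) *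
        (1 / (b - a) * (LINT x:{a..b}|lborel. w0 x powr (1 / (1 - p)))) powr (p - 1) \<le> B"
      using si[of a b] B[rule_format, of a b] e1[of a b] e2[of a b "1 / (1 - p)"] by (simp only: simp_thms)
  qed
  then show ?thesis by blast
qed

lemma nn_integral_lebesgue_on_torus: "(\<integral>\<^sup>+x. h x \<partial>lebesgue_on torus) = tint h"
proof -
  have "(\<integral>\<^sup>+x. h x \<partial>lebesgue_on torus) = (\<integral>\<^sup>+x. h x * indicator torus x \<partial>lebesgue)"
    by (rule nn_integral_restrict_space) auto
  also have "\<dots> = (\<integral>\<^sup>+x. h x * indicator torus x \<partial>lborel)" by (rule nn_integral_completion)
  also have "\<dots> = tint h" unfolding tint_def
    by (intro nn_integral_cong_AE eventually_mono[OF AE_lborel_singleton[of "2 * pi"]]) (auto split: split_indicator)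
  finally show ?thesis .
qed

lemma tint_cong_AE: "AE x in lborel. F x = G x \<Longrightarrow> tint F = tint G"
  unfolding tint_def by (rule nn_integral_cong_AE) (auto elim: eventually_mono)

context orlicz_weight
begin

text \<open>Every admissible g agrees in absolute value, almost everywhere on a period, with a
  member of \<open>dual_ball\<close>, and each member of the ball is admissible. From here on norms
  are computed on Borel versions of weight and function.\<close>

lemma orlicz_norm_eq_Nn:
  assumes w: "AE x in lborel. w x = W x" and f: "AE x in lborel. f x = f0 x"
  shows "orlicz_norm \<phi> w f = Nn (\<lambda>x. ennreal \<bar>f0 x\<bar>)"
proof (rule antisym)
  show "orlicz_norm \<phi> w f \<le> Nn (\<lambda>x. ennreal \<bar>f0 x\<bar>)"
    unfolding orlicz_norm_def nn_integral_lebesgue_on_torus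
  proof (rule SUP_least)
    fix g assume "g \<in> {g. g \<in> borel_measurable (lebesgue_on torus) \<and> tint (\<lambda>x. complementary \<phi> \<bar>g x\<bar> * ennreal (w x)) \<le> 1}"
    then have g: "g \<in> borel_measurable (lebesgue_on torus)" and gb: "tint (\<lambda>x. psi \<bar>g x\<bar> * ennreal (w x)) \<le> 1" by auto
    have "(\<lambda>x. indicator torus x *\<^sub>R g x) \<in> borel_measurable lebesgue"
      using g by (subst (asm) borel_measurable_restrict_space_iff) auto
    then obtain g1 where g1 [measurable]: "g1 \<in> borel_measurable lborel" and ae: "AE x in lborel. indicator torus x *\<^sub>R g x = g1 x"
      using completion_ex_borel_measurable_real by blast
    \<comment> \<open>\<open>g1\<close> is tied to g on one period only; composing with
      \<open>wrap\<close> and taking absolute values yields a periodic, nonnegative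
      competitor.\<close>
    define g' where "g' = (\<lambda>x. \<bar>g1 (wrap x)\<bar>)"
    have eq: "AE x in lborel. x \<in> {0..<2 * pi} \<longrightarrow> g' x = \<bar>g x\<bar>"
      using ae by eventually_elim (auto simp: g'_def wrap_id)
    have cong: "tint F = tint G" if "AE x in lborel. x \<in> {0..<2 * pi} \<longrightarrow> F x = G x" for F G
      unfolding tint_def using that by (intro nn_integral_cong_AE) (auto elim!: eventually_mono split: split_indicator)
    have "tint (\<lambda>x. psi (g' x) * ennreal (W x)) = tint (\<lambda>x. psi \<bar>g x\<bar> * ennreal (w x))"
      by (rule cong) (use eq w in eventually_elim, auto)
    then have "g' \<in> dual_ball" using gb by (auto simp: dual_ball_def g'_def periodic2pi_def wrap_periodic)
    have "tint (\<lambda>x. ennreal (\<bar>f x * g x\<bar> * w x)) = tint (\<lambda>x. ennreal \<bar>f0 x\<bar> * ennreal (g' x * W x))"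
      by (rule cong) (use eq w f in eventually_elim, auto simp: ennreal_mult'[symmetric] abs_mult mult.assoc)
    also have "\<dots> \<le> Nn (\<lambda>x. ennreal \<bar>f0 x\<bar>)" by (rule Nn_upper) fact
    finally show "tint (\<lambda>x. ennreal (\<bar>f x * g x\<bar> * w x)) \<le> Nn (\<lambda>x. ennreal \<bar>f0 x\<bar>)" .
  qed
next
  show "Nn (\<lambda>x. ennreal \<bar>f0 x\<bar>) \<le> orlicz_norm \<phi> w f"
  proof (rule Nn_least)
    fix g assume g: "g \<in> dual_ball"
    then have gm [measurable]: "g \<in> borel_measurable borel" and g0: "\<And>x. 0 \<le> g x" by (auto simp: dual_ball_def)
    have "tint (\<lambda>x. psi \<bar>g x\<bar> * ennreal (w x)) = tint (\<lambda>x. psi (g x) * ennreal (W x))"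
      by (rule tint_cong_AE) (use w in eventually_elim, use g0 in simp)
    moreover have "g \<in> borel_measurable (lebesgue_on torus)"
      by (rule measurable_restrict_space1) (rule borel_imp_lebesgue[OF gm])
    ultimately have g': "g \<in> {g. g \<in> borel_measurable (lebesgue_on torus) \<and> tint (\<lambda>x. psi \<bar>g x\<bar> * ennreal (w x)) \<le> 1}"
      using g by (auto simp: dual_ball_def)
    have "tint (\<lambda>x. ennreal \<bar>f0 x\<bar> * ennreal (g x * W x)) = tint (\<lambda>x. ennreal (\<bar>f x * g x\<bar> * w x))"
      by (rule tint_cong_AE) (use w f in eventually_elim, use g0 in \<open>simp add: ennreal_mult'[symmetric] abs_mult mult.assoc\<close>)
    also have "\<dots> \<le> orlicz_norm \<phi> w f"
      unfolding orlicz_norm_def nn_integral_lebesgue_on_torus by (rule SUP_upper[OF g'])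
    finally show "tint (\<lambda>x. ennreal \<bar>f0 x\<bar> * ennreal (g x * W x)) \<le> orlicz_norm \<phi> w f" .
  qed
qed

text \<open>Young's inequality for c |f| and g bounds every pairing by (modular of c f plus 1) /
  c.\<close>

lemma Nn_finite:
  assumes [measurable]: "f \<in> borel_measurable borel" and c: "0 < c" 
    and fin: "tint (\<lambda>x. ennreal (\<phi> (c * \<bar>f x\<bar>) * W x)) < \<infinity>"
  shows "Nn (\<lambda>x. ennreal \<bar>f x\<bar>) < \<infinity>"
proof -
  have "Nn (\<lambda>x. ennreal \<bar>f x\<bar>) \<le> ennreal (1 / c) * (tint (\<lambda>x. ennreal (\<phi> (c * \<bar>f x\<bar>) * W x)) + 1)"
  proof (rule Nn_least)
    fix g assume g: "g \<in> dual_ball"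
    then have gm [measurable]: "g \<in> borel_measurable borel" and g0: "\<And>x. 0 \<le> g x" 
      and gb: "tint (\<lambda>x. psi (g x) * ennreal (W x)) \<le> 1" by (auto simp: dual_ball_def)
    have "tint (\<lambda>x. ennreal \<bar>f x\<bar> * ennreal (g x * W x)) 
      \<le> tint (\<lambda>x. ennreal (1 / c) * (ennreal (\<phi> (c * \<bar>f x\<bar>) * W x) + psi (g x) * ennreal (W x)))"
    proof (rule tint_mono)
      fix x
      have "ennreal \<bar>f x\<bar> * ennreal (g x * W x) = ennreal (1 / c) * (ennreal (c * \<bar>f x\<bar> * g x) * ennreal (W x))"
        using c g0[of x] W_pos[of x] by (simp add: ennreal_mult'[symmetric] less_imp_le)
      also have "\<dots> \<le> ennreal (1 / c) * ((ennreal (\<phi> (c * \<bar>f x\<bar>)) + psi (g x)) * ennreal (W x))"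
        using c g0 by (intro mult_left_mono mult_right_mono young_ineq) auto
      finally show "ennreal \<bar>f x\<bar> * ennreal (g x * W x) \<le> ennreal (1 / c) * (ennreal (\<phi> (c * \<bar>f x\<bar>) * W x) + psi (g x) * ennreal (W x))"
        using phi_nonneg by (simp add: ennreal_mult' distrib_right)
    qed
    also have "\<dots> = ennreal (1 / c) * (tint (\<lambda>x. ennreal (\<phi> (c * \<bar>f x\<bar>) * W x)) + tint (\<lambda>x. psi (g x) * ennreal (W x)))"
      by (simp add: tint_cmult tint_add)
    also have "\<dots> \<le> ennreal (1 / c) * (tint (\<lambda>x. ennreal (\<phi> (c * \<bar>f x\<bar>) * W x)) + 1)"
      by (intro mult_left_mono add_left_mono gb) auto
    finally show "tint (\<lambda>x. ennreal \<bar>f x\<bar> * ennreal (g x * W x)) \<le> \<dots>" .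
  qed
  also have "\<dots> < \<infinity>" using fin by (simp add: ennreal_mult_less_top)
  finally show ?thesis .
qed

lemma Nn_const_finite: "Nn (\<lambda>x. ennreal c) < \<infinity>"
proof -
  have "tint (\<lambda>x. ennreal (\<phi> (1 * \<bar>max 0 c\<bar>) * W x)) = ennreal (\<phi> (max 0 c)) * tint (\<lambda>x. ennreal (W x))"
    by (subst tint_cmult[symmetric]) (auto simp: ennreal_mult' phi_nonneg)
  also have "\<dots> < \<infinity>" using tint_W_finite by (simp add: ennreal_mult_less_top)
  finally have "Nn (\<lambda>x. ennreal \<bar>max 0 c\<bar>) < \<infinity>" by (intro Nn_finite[of _ 1]) auto
  then show ?thesis by (cases "0 \<le> c") (auto simp: ennreal_neg)
qed

text \<open>The test function is a small multiple of 1 / W, whose product with W is constant. Its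
  modular is finite: by \<open>psi_growth\<close>, psi(b / W) W is at most a multiple of W +
  W^(1/(1-q)), and both terms are integrable over a period by the weight condition.\<close>

lemma embedding_L1: "\<exists>c>0. \<forall>F\<in>borel_measurable borel. ennreal c * tint F \<le> Nn F"
proof -
  obtain c0 where c0: "0 < c0" "psi c0 < \<infinity>" using psi_finite by blast
  define b where "b = c0 / C0"
  have b: "0 < b" using c0 C0 by (simp add: b_def)
  define g where "g = (\<lambda>x. b / W x)"
  have [measurable]: "g \<in> borel_measurable borel" by (simp add: g_def)
  define A where "A = tint (\<lambda>x. psi (g x) * ennreal (W x))"
  have e: "1 - q' = 1 / (1 - q)" using q by (simp add: field_simps)
  have "A \<le> tint (\<lambda>x. psi c0 * ennreal (W x) + psi c0 * ennreal (W x powr (1 / (1 - q))))" unfolding A_def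
  proof (rule tint_mono)
    fix x
    define t where "t = max 1 (1 / W x)"
    have "1 / W x * b \<le> t * b" using b by (intro mult_right_mono) (auto simp: t_def)
    then have "g x \<le> t * b" by (simp add: g_def)
    then have "psi (g x) \<le> psi (t * b)" by (rule psi_mono)
    also have "\<dots> \<le> ennreal (t powr q') * psi (C0 * b)" by (rule psi_growth) (simp add: t_def)
    also have "C0 * b = c0" using C0 by (simp add: b_def)
    also have "ennreal (t powr q') * psi c0 \<le> ennreal (1 + (1 / W x) powr q') * psi c0"
      by (intro mult_right_mono ennreal_leI) (auto simp: t_def max_def)
    finally have "psi (g x) * ennreal (W x) \<le> ennreal (1 + (1 / W x) powr q') * psi c0 * ennreal (W x)"
      by (rule mult_right_mono) simp
    also have "\<dots> = psi c0 * ennreal ((1 + (1 / W x) powr q') * W x)"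
      using W_pos[of x] by (simp add: ennreal_mult'' mult_ac)
    also have "(1 + (1 / W x) powr q') * W x = W x + W x powr (1 / (1 - q))"
      unfolding e[symmetric] using W_pos[of x] by (simp add: powr_diff powr_divide distrib_right)
    also have "psi c0 * ennreal (W x + W x powr (1 / (1 - q))) = psi c0 * ennreal (W x) + psi c0 * ennreal (W x powr (1 / (1 - q)))"
      using W_pos[of x] by (simp add: distrib_left)
    finally show "psi (g x) * ennreal (W x) \<le> psi c0 * ennreal (W x) + psi c0 * ennreal (W x powr (1 / (1 - q)))" .
  qed
  also have "\<dots> = psi c0 * tint (\<lambda>x. ennreal (W x)) + psi c0 * tint (\<lambda>x. ennreal (W x powr (1 / (1 - q))))"
    by (simp add: tint_add tint_cmult)
  also have "tint (\<lambda>x. ennreal (W x powr (1 / (1 - q)))) = ennreal (LINT x:{0..2 * pi}|lborel. W x powr (1 / (1 - q)))"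
    unfolding tint_def nn_integral_Ico_eq_Icc using ap by (intro nn_integral_eq_set_integral_Icc) (auto simp: ap_bound_def)
  also have "psi c0 * tint (\<lambda>x. ennreal (W x)) + psi c0 * \<dots> < \<infinity>"
    using c0 tint_W_finite by (auto simp: ennreal_mult_less_top)
  finally obtain a where a: "A = ennreal a" "0 \<le> a" by (metis ennreal_cases infinity_ennreal_def less_irrefl)
  \<comment> \<open>Brings the modular a below 1, since \<open>psi_scale\<close> takes out the
    factor c and c a \<le> 1.\<close>
  define c where "c = 1 / (1 + a)"
  have c: "0 < c" "c \<le> 1" "c * a \<le> 1" using a by (auto simp: c_def)
  have "tint (\<lambda>x. psi (c * g x) * ennreal (W x)) \<le> tint (\<lambda>x. ennreal c * (psi (g x) * ennreal (W x)))"
    using c by (intro tint_mono) (auto simp: mult.assoc[symmetric] intro!: mult_right_mono psi_scale)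
  also have "\<dots> = ennreal c * A" unfolding A_def by (rule tint_cmult) measurable
  also have "\<dots> \<le> 1" using c a by (simp add: ennreal_mult'[symmetric])
  finally have g: "(\<lambda>x. c * g x) \<in> dual_ball"
    using c b W_pos W_periodic by (auto simp: dual_ball_def g_def periodic2pi_def less_imp_le)
  have "ennreal (c * b) * tint F \<le> Nn F" if [measurable]: "F \<in> borel_measurable borel" for F
  proof -
    have "c * g x * W x = c * b" for x using W_pos[of x] by (simp add: g_def)
    then have "tint (\<lambda>x. ennreal (c * b) * F x) = tint (\<lambda>x. F x * ennreal (c * g x * W x))" by (simp only: mult.commute)
    then show ?thesis using Nn_upper[OF g, of F] by (simp add: tint_cmult)
  qed
  then show ?thesis using c b by (intro exI[of _ "c * b"]) auto
qed

end

subsection \<open>Fourier coefficients\<close>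

text \<open>Lebesgue measure of one period as a measure on the whole line: its measurable functions
  are the Borel functions, so periodic functions need not be restricted.\<close>

definition torusM :: "real measure" where
  "torusM = density lborel (indicator {0..<2 * pi})"

lemma sets_torusM [measurable_cong, simp]: "sets torusM = sets borel"
  by (simp add: torusM_def)

lemma space_torusM [simp]: "space torusM = UNIV"
  by (simp add: torusM_def)

lemma nn_integral_torusM: "F \<in> borel_measurable borel \<Longrightarrow> (\<integral>\<^sup>+x. F x \<partial>torusM) = tint F"
  by (simp add: torusM_def nn_integral_density tint_def mult.commute)

lemma emeasure_torusM: "emeasure torusM UNIV = ennreal (2 * pi)"
  by (simp add: torusM_def emeasure_density)

lemma finite_measure_torusM: "finite_measure torusM"
  by (rule finite_measureI) (simp add: emeasure_torusM)

interpretation torusM: finite_measure torusM by (rule finite_measure_torusM)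
interpretation torus_lborel: pair_sigma_finite torusM lborel ..

lemma AE_torusM: "(AE x in lborel. P x) \<Longrightarrow> (AE x in torusM. P x)"
  unfolding torusM_def by (subst AE_density) (auto elim: eventually_mono)

lemma AE_torusM_range: "AE x in torusM. x \<in> {0..<2 * pi}"
  unfolding torusM_def by (subst AE_density) (auto intro!: AE_I2 split: split_indicator_asm)

lemma AE_torusM_imp_lborel:
  assumes "AE x in torusM. P x" "\<And>x. P (wrap x) \<Longrightarrow> P x"
  shows "AE x in lborel. P x"
proof (rule AE_periodic[OF assms(2)])
  show "AE x in lborel. x \<in> {0..<2 * pi} \<longrightarrow> P x"
    using assms(1) unfolding torusM_def by (subst (asm) AE_density) (auto elim!: eventually_mono split: split_indicator_asm)
qed

text \<open>Independence of the period, expressed as an image measure so that it serves Bochner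
  integrals of any type at once.\<close>

lemma distr_wrap: "distr (density lborel (indicator {a..<a + 2 * pi})) borel wrap = torusM"
proof (rule measure_eqI)
  fix A assume "A \<in> sets (distr (density lborel (indicator {a..<a + 2 * pi})) borel wrap)"
  then have [measurable]: "A \<in> sets borel" by simp
  have [measurable]: "{x. wrap x \<in> A} \<in> sets borel"
    using measurable_sets[OF wrap_borel, of A] by (simp add: vimage_def)
  have "emeasure (distr (density lborel (indicator {a..<a + 2 * pi})) borel wrap) A
     = (\<integral>\<^sup>+x. indicator {a..<a + 2 * pi} x * indicator {x. wrap x \<in> A} x \<partial>lborel)"
    by (subst emeasure_distr) (auto simp: emeasure_density vimage_def)
  also have "\<dots> = (\<integral>\<^sup>+x. indicator {x. wrap x \<in> A} x * indicator {a..<a + 2 * pi} x \<partial>lborel)"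
    by (simp add: mult.commute)
  also have "\<dots> = tint (indicator {x. wrap x \<in> A})"
    by (rule tint_any_period) (auto simp: periodic2pi_def wrap_periodic indicator_def)
  also have "\<dots> = tint (indicator A)"
    unfolding tint_def by (intro nn_integral_cong) (auto simp: wrap_id split: split_indicator)
  also have "\<dots> = emeasure torusM A" by (simp add: nn_integral_torusM[symmetric])
  finally show "emeasure (distr (density lborel (indicator {a..<a + 2 * pi})) borel wrap) A = emeasure torusM A" .
qed simp

lemma integral_period:
  fixes F :: "real \<Rightarrow> 'b :: {banach, second_countable_topology}"
  assumes [measurable]: "F \<in> borel_measurable borel" and per: "periodic2pi F"
  shows "(\<integral>x. indicator {a..<a + 2 * pi} x *\<^sub>R F x \<partial>lborel) = (\<integral>x. F x \<partial>torusM)"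
    and "integrable lborel (\<lambda>x. indicator {a..<a + 2 * pi} x *\<^sub>R F x) \<longleftrightarrow> integrable torusM F"
proof -
  have d: "density lborel (indicator {a..<a + 2 * pi}) = density lborel (\<lambda>x. ennreal (indicator {a..<a + 2 * pi} x))"
    by (simp add: ennreal_indicator)
  have "(\<integral>x. F x \<partial>torusM) = (\<integral>x. F (wrap x) \<partial>density lborel (indicator {a..<a + 2 * pi}))"
    unfolding distr_wrap[of a, symmetric] by (rule integral_distr) auto
  also have "\<dots> = (\<integral>x. F x \<partial>density lborel (indicator {a..<a + 2 * pi}))"
    by (simp add: periodic2pi_wrap[OF per])
  also have "\<dots> = (\<integral>x. indicator {a..<a + 2 * pi} x *\<^sub>R F x \<partial>lborel)"
    unfolding d by (rule integral_density) auto
  finally show "(\<integral>x. indicator {a..<a + 2 * pi} x *\<^sub>R F x \<partial>lborel) = (\<integral>x. F x \<partial>torusM)" ..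
  have "integrable torusM F \<longleftrightarrow> integrable (density lborel (indicator {a..<a + 2 * pi})) (\<lambda>x. F (wrap x))"
    unfolding distr_wrap[of a, symmetric] by (rule integrable_distr_eq) auto
  also have "\<dots> \<longleftrightarrow> integrable (density lborel (indicator {a..<a + 2 * pi})) F"
    by (simp add: periodic2pi_wrap[OF per])
  also have "\<dots> \<longleftrightarrow> integrable lborel (\<lambda>x. indicator {a..<a + 2 * pi} x *\<^sub>R F x)"
    unfolding d by (rule integrable_density) auto
  finally show "integrable lborel (\<lambda>x. indicator {a..<a + 2 * pi} x *\<^sub>R F x) \<longleftrightarrow> integrable torusM F" ..
qed

lemma integral_torusM:
  fixes F :: "real \<Rightarrow> 'b :: {banach, second_countable_topology}"
  assumes [measurable]: "F \<in> borel_measurable borel"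
  shows "(\<integral>x. F x \<partial>torusM) = (\<integral>x. indicator {0..<2 * pi} x *\<^sub>R F x \<partial>lborel)"
    and "integrable torusM F \<longleftrightarrow> integrable lborel (\<lambda>x. indicator {0..<2 * pi} x *\<^sub>R F x)"
proof -
  have d: "torusM = density lborel (\<lambda>x. ennreal (indicator {0..<2 * pi} x))"
    by (simp add: ennreal_indicator torusM_def)
  show "(\<integral>x. F x \<partial>torusM) = (\<integral>x. indicator {0..<2 * pi} x *\<^sub>R F x \<partial>lborel)"
    unfolding d by (rule integral_density) auto
  show "integrable torusM F \<longleftrightarrow> integrable lborel (\<lambda>x. indicator {0..<2 * pi} x *\<^sub>R F x)"
    unfolding d by (rule integrable_density) auto
qed

lemma integral_torusM_shift:
  fixes F :: "real \<Rightarrow> 'b :: {banach, second_countable_topology}"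
  assumes [measurable]: "F \<in> borel_measurable borel" and per: "periodic2pi F"
  shows "(\<integral>x. F (x + t) \<partial>torusM) = (\<integral>x. F x \<partial>torusM)"
proof -
  have "(\<integral>x. F (x + t) \<partial>torusM) = (\<integral>x. indicator {t..<t + 2 * pi} (t + 1 * x) *\<^sub>R F (t + 1 * x) \<partial>lborel)"
    by (subst integral_torusM) (auto intro!: Bochner_Integration.integral_cong simp: add.commute split: split_indicator)
  also have "\<dots> = (\<integral>x. indicator {t..<t + 2 * pi} x *\<^sub>R F x \<partial>lborel)"
    using lborel_integral_real_affine[of 1 "\<lambda>x. indicator {t..<t + 2 * pi} x *\<^sub>R F x" t] by simp
  also have "\<dots> = (\<integral>x. F x \<partial>torusM)" by (rule integral_period(1)) (use per in auto)
  finally show ?thesis .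
qed

lemma cis_borel [measurable]: "cis \<in> borel_measurable borel"
  by (intro borel_measurable_continuous_onI continuous_intros)

lemma cis_int_periodic: "cis (of_int k * (x + 2 * pi)) = cis (of_int k * x)"
proof -
  have "cis (of_int k * (x + 2 * pi)) = cis (of_int k * x) * cis (2 * pi * of_int k)"
    by (simp add: cis_mult algebra_simps)
  also have "cis (2 * pi * of_int k) = 1" by (rule cis_multiple_2pi) simp
  finally show ?thesis by simp
qed

lemma integral_cis_torusM: "(\<integral>x. cis (of_int k * x) \<partial>torusM) = (if k = 0 then 2 * pi else 0)"
proof (cases "k = 0")
  case True
  then show ?thesis by (simp add: measure_def emeasure_torusM scaleR_conv_of_real)
next
  case False
  let ?I = "\<integral>x. cis (of_int k * x) \<partial>torusM"
  \<comment> \<open>Translation by pi / k multiplies the integrand by -1, so the integral equals its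
    negative.\<close>
  have "?I = (\<integral>x. cis (of_int k * (x + pi / of_int k)) \<partial>torusM)"
    by (rule integral_torusM_shift[symmetric]) (auto simp: periodic2pi_def cis_int_periodic)
  also have "\<dots> = (\<integral>x. cis (of_int k * x) * cis pi \<partial>torusM)"
    using False by (simp only: cis_mult) (simp add: distrib_left)
  also have "\<dots> = - ?I" by (simp del: cis_pi) simp
  finally show ?thesis using False by simp
qed

lemma integrable_torusM_bounded_mult:
  fixes f u :: "real \<Rightarrow> complex"
  assumes "integrable torusM f" and [measurable]: "u \<in> borel_measurable borel" and "\<And>x. norm (u x) \<le> B"
  shows "integrable torusM (\<lambda>x. u x * f x)"
proof (rule Bochner_Integration.integrable_bound)
  show "integrable torusM (\<lambda>x. B * norm (f x))" using assms by auto
  have [measurable]: "f \<in> borel_measurable borel" using assms(1) borel_measurable_integrable by fastforce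
  show "(\<lambda>x. u x * f x) \<in> borel_measurable torusM" by measurable
  show "AE x in torusM. norm (u x * f x) \<le> norm (B * norm (f x))"
  proof (rule AE_I2)
    fix x
    have "norm (u x) * norm (f x) \<le> B * norm (f x)" using assms(3) by (intro mult_right_mono) auto
    moreover have "B * norm (f x) \<le> \<bar>B\<bar> * norm (f x)" by (intro mult_right_mono) auto
    ultimately show "norm (u x * f x) \<le> norm (B * norm (f x))" unfolding norm_mult by simp
  qed
qed

text \<open>The orthogonality hypothesis is inherited by \<open>p (cis x) f x\<close>, which handles products of polynomials.\<close>

lemma orthogonal_polynomial_cis:
  fixes f :: "real \<Rightarrow> complex"
  assumes "real_polynomial_function p" and "integrable torusM f" and "\<And>k::int. (\<integral>x. f x * cis (of_int k * x) \<partial>torusM) = 0"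
  shows "integrable torusM (\<lambda>x. of_real (p (cis x)) * f x)" "(\<integral>x. of_real (p (cis x)) * f x * cis (of_int k * x) \<partial>torusM) = 0"
proof -
  have "integrable torusM (\<lambda>x. of_real (p (cis x)) * f x) \<and> (\<forall>k::int. (\<integral>x. of_real (p (cis x)) * f x * cis (of_int k * x) \<partial>torusM) = 0)"
    using assms
  proof (induction arbitrary: f rule: real_polynomial_function.induct)
    case (linear g)
    have ck: "integrable torusM (\<lambda>x. cis (of_int k * x) * f x)" for k :: int
      by (rule integrable_torusM_bounded_mult[OF linear(2), where B = 1]) auto
    \<comment> \<open>A real linear functional of cis x is a combination of cos x and sin x, hence
      of cis x and cis (-x); multiplying by it shifts the frequency by one in either
      direction.\<close>
    have g: "of_real (g (cis x)) = (of_real (g 1) - \<i> * of_real (g \<i>)) / 2 * cis (of_int 1 * x) + (of_real (g 1) + \<i> * of_real (g \<i>)) / 2 * cis (of_int (-1) * x)" for x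
    proof -
      interpret bounded_linear g by fact
      have "cis x = cos x *\<^sub>R 1 + sin x *\<^sub>R \<i>" by (simp add: cis_conv_exp complex_eq_iff Re_exp Im_exp)
      then have "g (cis x) = cos x * g 1 + sin x * g \<i>" by (simp only: add scale) simp
      then show ?thesis by (simp add: complex_eq_iff field_simps)
    qed
    define c d where "c = (of_real (g 1) - \<i> * of_real (g \<i>)) / 2" and "d = (of_real (g 1) + \<i> * of_real (g \<i>)) / 2"
    have "of_real (g (cis x)) * f x = c * (cis (of_int 1 * x) * f x) + d * (cis (of_int (-1) * x) * f x)" for x
      unfolding g c_def d_def by (simp add: algebra_simps)
    then have "integrable torusM (\<lambda>x. of_real (g (cis x)) * f x)"
      using ck[of 1] ck[of "-1"] by (simp only:) auto
    moreover have "(\<integral>x. of_real (g (cis x)) * f x * cis (of_int k * x) \<partial>torusM) = 0" for k :: int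
    proof -
      have "of_real (g (cis x)) * f x * cis (of_int k * x) = c * (f x * cis (of_int (k + 1) * x)) + d * (f x * cis (of_int (k - 1) * x))" for x
      proof -
        have "cis (of_int (k + 1) * x) = cis (of_int 1 * x) * cis (of_int k * x)" "cis (of_int (k - 1) * x) = cis (of_int (-1) * x) * cis (of_int k * x)"
          unfolding cis_mult by (simp_all add: algebra_simps)
        then show ?thesis unfolding g c_def d_def by (simp only:) (simp add: algebra_simps)
      qed
      moreover have i: "integrable torusM (\<lambda>x. f x * cis (of_int k * x))" for k :: int using ck[of k] by (simp add: mult.commute)
      have "(\<integral>x. c * (f x * cis (of_int (k + 1) * x)) + d * (f x * cis (of_int (k - 1) * x)) \<partial>torusM)
        = c * (\<integral>x. f x * cis (of_int (k + 1) * x) \<partial>torusM) + d * (\<integral>x. f x * cis (of_int (k - 1) * x) \<partial>torusM)"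
        by (subst Bochner_Integration.integral_add) (simp_all only: integral_mult_right_zero integrable_mult_right[OF i])
      ultimately show ?thesis by (simp only: linear(3)) simp
    qed
    ultimately show ?case by blast
  next
    case (const c)
    then show ?case by (auto simp: mult.assoc)
  next
    case (add g h)
    have gi: "integrable torusM (\<lambda>x. of_real (g (cis x)) * f x)" and g0: "\<And>k::int. (\<integral>x. of_real (g (cis x)) * f x * cis (of_int k * x) \<partial>torusM) = 0"
      and hi: "integrable torusM (\<lambda>x. of_real (h (cis x)) * f x)" and h0: "\<And>k::int. (\<integral>x. of_real (h (cis x)) * f x * cis (of_int k * x) \<partial>torusM) = 0"
      using add by auto
    have "integrable torusM (\<lambda>x. of_real (g (cis x)) * f x * cis (of_int k * x))" "integrable torusM (\<lambda>x. of_real (h (cis x)) * f x * cis (of_int k * x))" for k :: int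
      using integrable_torusM_bounded_mult[OF gi, of "\<lambda>x. cis (of_int k * x)" 1] integrable_torusM_bounded_mult[OF hi, of "\<lambda>x. cis (of_int k * x)" 1]
      by (simp_all add: mult.commute)
    then show ?case using gi hi g0 h0 by (auto simp: distrib_right)
  next
    case (mult g h)
    have hi: "integrable torusM (\<lambda>x. of_real (h (cis x)) * f x)" and h0: "\<And>k::int. (\<integral>x. of_real (h (cis x)) * f x * cis (of_int k * x) \<partial>torusM) = 0"
      using mult by auto
    show ?case using mult.IH(1)[OF hi h0] by (simp add: mult.assoc)
  qed
  then show "integrable torusM (\<lambda>x. of_real (p (cis x)) * f x)" "(\<integral>x. of_real (p (cis x)) * f x * cis (of_int k * x) \<partial>torusM) = 0" by auto
qed

text \<open>Stone-Weierstrass on the unit circle: polynomials in the two coordinates are uniformly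
  dense, and a small uniform error is harmless against an integrable f.\<close>

lemma orthogonal_continuous_cis:
  fixes f :: "real \<Rightarrow> complex"
  assumes f: "integrable torusM f" "\<And>k::int. (\<integral>x. f x * cis (of_int k * x) \<partial>torusM) = 0"
    and g: "continuous_on UNIV (g :: complex \<Rightarrow> real)"
  shows "(\<integral>x. of_real (g (cis x)) * f x \<partial>torusM) = 0"
proof -
  define A where "A = (\<integral>x. norm (f x) \<partial>torusM)"
  have A: "0 \<le> A" unfolding A_def by simp
  have gm [measurable]: "g \<in> borel_measurable borel" by (rule borel_measurable_continuous_onI[OF g])
  have "compact (g ` sphere 0 1)" by (rule compact_continuous_image[OF continuous_on_subset[OF g]]) auto
  then obtain B where B: "\<And>z. z \<in> sphere 0 1 \<Longrightarrow> norm (g z) \<le> B" by (meson compact_imp_bounded bounded_iff imageI)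
  have gi: "integrable torusM (\<lambda>x. of_real (g (cis x)) * f x)"
    by (rule integrable_torusM_bounded_mult[OF f(1), where B = B]) (use B in auto)
  have "norm (\<integral>x. of_real (g (cis x)) * f x \<partial>torusM) \<le> e" if e: "0 < e" for e
  proof -
    obtain p where p: "real_polynomial_function p" "\<And>z. z \<in> sphere 0 1 \<Longrightarrow> \<bar>g z - p z\<bar> < e / (A + 1)"
      using Stone_Weierstrass_real_polynomial_function[of "sphere 0 (1::real)" g "e / (A + 1)"]
        Stone_Weierstrass_real_polynomial_function[of "sphere (0::complex) 1" g "e / (A + 1)"] continuous_on_subset[OF g] e A
      by (metis add_nonneg_pos compact_sphere divide_pos_pos subset_UNIV zero_less_one)
    note pi = orthogonal_polynomial_cis[OF p(1) f]
    have "(\<integral>x. of_real (p (cis x)) * f x \<partial>torusM) = 0" using pi(2)[of 0] by simp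
    then have "norm (\<integral>x. of_real (g (cis x)) * f x \<partial>torusM) = norm (\<integral>x. of_real (g (cis x)) * f x - of_real (p (cis x)) * f x \<partial>torusM)"
      using gi pi(1) by simp
    also have "\<dots> \<le> (\<integral>x. norm (of_real (g (cis x)) * f x - of_real (p (cis x)) * f x) \<partial>torusM)"
      by (rule integral_norm_bound)
    also have "\<dots> \<le> (\<integral>x. e / (A + 1) * norm (f x) \<partial>torusM)"
    proof (rule integral_mono)
      show "integrable torusM (\<lambda>x. norm (of_real (g (cis x)) * f x - of_real (p (cis x)) * f x))" using gi pi(1) by auto
      show "integrable torusM (\<lambda>x. e / (A + 1) * norm (f x))" using f by auto
      fix x
      have "norm (of_real (g (cis x)) * f x - of_real (p (cis x)) * f x) = \<bar>g (cis x) - p (cis x)\<bar> * norm (f x)"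
        by (metis left_diff_distrib norm_mult norm_of_real of_real_diff)
      also have "\<dots> \<le> e / (A + 1) * norm (f x)" using p(2)[of "cis x"] by (intro mult_right_mono) auto
      finally show "norm (of_real (g (cis x)) * f x - of_real (p (cis x)) * f x) \<le> e / (A + 1) * norm (f x)" .
    qed
    also have "\<dots> = e * (A / (A + 1))" by (simp add: A_def)
    also have "\<dots> \<le> e * 1" using A e by (intro mult_left_mono) auto
    finally show ?thesis by simp
  qed
  then have "norm (\<integral>x. of_real (g (cis x)) * f x \<partial>torusM) \<le> 0" by (rule field_le_epsilon[where y = 0, simplified])
  then show ?thesis by simp
qed

text \<open>Exhibits the arc (0, u) as a set where a continuous function of cis x exceeds a
  threshold, which makes its indicator a limit of functions to which
  \<open>orthogonal_continuous_cis\<close> applies.\<close>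

lemma cos_arc:
  assumes "0 < u" "u < 2 * pi" "0 \<le> x" "x < 2 * pi"
  shows "cos (u / 2) < cos (x - u / 2) \<longleftrightarrow> x \<in> {0<..<u}"
proof (cases "x - u / 2 \<le> pi")
  case True
  have "cos (x - u / 2) = cos \<bar>x - u / 2\<bar>" by simp
  moreover have "cos (u / 2) < cos \<bar>x - u / 2\<bar> \<longleftrightarrow> \<bar>x - u / 2\<bar> < u / 2"
    using True assms by (intro cos_mono_less_eq) auto
  moreover have "\<bar>x - u / 2\<bar> < u / 2 \<longleftrightarrow> x \<in> {0<..<u}" unfolding abs_less_iff by auto
  ultimately show ?thesis by simp
next
  case False
  have "cos (x - u / 2) = cos (2 * pi - (x - u / 2))" by (simp only: cos_2pi_minus)
  moreover have "cos (u / 2) < cos (2 * pi - (x - u / 2)) \<longleftrightarrow> 2 * pi - (x - u / 2) < u / 2"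
    using False assms by (intro cos_mono_less_eq) auto
  ultimately show ?thesis using assms False by auto
qed

text \<open>Orthogonality to continuous functions passes to arcs by dominated convergence and from
  arcs to half-lines. Hence the measures with densities max(f, 0) and max(-f, 0) agree on
  half-lines, so they are equal, and being carried by disjoint sets they vanish.\<close>

lemma fourier_uniqueness:
  fixes f :: "real \<Rightarrow> real"
  assumes f: "integrable torusM f" and z: "\<And>k::int. (\<integral>x. of_real (f x) * cis (of_int k * x) \<partial>torusM) = 0"
  shows "AE x in torusM. f x = 0"
proof -
  have [measurable]: "f \<in> borel_measurable borel" using f borel_measurable_integrable by fastforce
  have fc: "integrable torusM (\<lambda>x. complex_of_real (f x))" using f by auto
  have cont: "(\<integral>x. g (cis x) * f x \<partial>torusM) = 0" if "continuous_on UNIV (g :: complex \<Rightarrow> real)" for g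
    using orthogonal_continuous_cis[OF fc z that] by (simp flip: of_real_mult)
  have arc: "(\<integral>x. indicator {0<..<u} x * f x \<partial>torusM) = 0" if u: "0 < u" "u < 2 * pi" for u
  proof -
    \<comment> \<open>A continuous ramp whose values at cis x converge on the period to the
      indicator of the arc as M grows.\<close>
    define g where "g = (\<lambda>(M::nat) z. min 1 (real M * max 0 (Re (z * cis (- u / 2)) - cos (u / 2))))"
    have gc: "continuous_on UNIV (g M)" for M unfolding g_def by (intro continuous_intros)
    have gm [measurable]: "g M \<in> borel_measurable borel" for M by (rule borel_measurable_continuous_onI[OF gc])
    have gb: "\<bar>g M z\<bar> \<le> 1" for M z by (auto simp: g_def)
    have "(\<lambda>M. \<integral>x. g M (cis x) * f x \<partial>torusM) \<longlonglongrightarrow> (\<integral>x. indicator {0<..<u} x * f x \<partial>torusM)"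
    proof (rule integral_dominated_convergence[where w = "\<lambda>x. \<bar>f x\<bar>"])
      show "AE x in torusM. norm (g M (cis x) * f x) \<le> \<bar>f x\<bar>" for M
        using gb by (intro AE_I2) (auto simp: abs_mult intro: mult_left_le_one_le)
      have "AE x in torusM. x \<in> {0..<2 * pi}"
        by (rule AE_torusM_range)
      then show "AE x in torusM. (\<lambda>M. g M (cis x) * f x) \<longlonglongrightarrow> indicator {0<..<u} x * f x"
      proof eventually_elim
        case (elim x)
        have re: "Re (cis x * cis (- u / 2)) = cos (x - u / 2)" unfolding cis_mult by simp
        have "(\<lambda>M. g M (cis x)) \<longlonglongrightarrow> indicator {0<..<u} x"
        proof (cases "x \<in> {0<..<u}")
          case True
          then have p: "0 < cos (x - u / 2) - cos (u / 2)" using cos_arc[of u x] u elim by auto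
          have "eventually (\<lambda>M. g M (cis x) = 1) sequentially"
          proof -
            obtain n where n: "1 / (cos (x - u / 2) - cos (u / 2)) < real n" using reals_Archimedean2 by blast
            show ?thesis
            proof (rule eventually_sequentiallyI)
              fix M assume "n \<le> M"
              then have "1 / (cos (x - u / 2) - cos (u / 2)) \<le> real M" using n by linarith
              then have "1 \<le> real M * (cos (x - u / 2) - cos (u / 2))" using p by (simp add: field_simps)
              then show "g M (cis x) = 1" using p unfolding g_def re by (simp add: max_def)
            qed
          qed
          then show ?thesis using True by (simp add: tendsto_eventually)
        next
          case False
          then have "cos (x - u / 2) - cos (u / 2) \<le> 0" using cos_arc[of u x] u elim by auto
          then have "g M (cis x) = 0" for M unfolding g_def re by (simp add: max_def)
          then show ?thesis using False by simp
        qed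
        then show ?case by (rule tendsto_mult_right)
      qed
    qed (use f in auto)
    then have "(\<lambda>M::nat. 0) \<longlonglongrightarrow> (\<integral>x. indicator {0<..<u} x * f x \<partial>torusM)" using cont[OF gc] by simp
    then show ?thesis using LIMSEQ_unique tendsto_const by blast
  qed
  have total: "(\<integral>x. f x \<partial>torusM) = 0" using cont[of "\<lambda>_. 1"] by simp
  have ind: "integrable torusM (\<lambda>x. indicator A x * f x)" if "A \<in> sets borel" for A
    using f that integrable_mult_indicator[of A torusM f] by simp
  have half: "(\<integral>x. indicator {a<..} x * f x \<partial>torusM) = 0" for a
  proof -
    have T: "AE x in torusM. x \<in> {0..<2 * pi}" by (rule AE_torusM_range)
    have ae0: "AE x in torusM. x \<noteq> c" for c by (rule AE_torusM[OF AE_lborel_singleton])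
    consider "a < 0" | "a = 0" | "0 < a" "a < 2 * pi" | "2 * pi \<le> a" by linarith
    then show ?thesis
    proof cases
      case 1
      have "(\<integral>x. indicator {a<..} x * f x \<partial>torusM) = (\<integral>x. f x \<partial>torusM)"
      proof (rule integral_cong_AE)
        show "AE x in torusM. indicator {a<..} x * f x = f x"
          using T by eventually_elim (use 1 in \<open>auto simp: indicator_def\<close>)
      qed auto
      then show ?thesis using total by simp
    next
      case 2
      have "(\<integral>x. indicator {a<..} x * f x \<partial>torusM) = (\<integral>x. f x \<partial>torusM)"
      proof (rule integral_cong_AE)
        show "AE x in torusM. indicator {a<..} x * f x = f x"
          using T ae0[of 0] by eventually_elim (use 2 in \<open>auto simp: indicator_def\<close>)
      qed auto
      then show ?thesis using total by simp
    next
      case 3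
      have "(\<integral>x. indicator {a<..} x * f x \<partial>torusM) = (\<integral>x. f x - indicator {0<..<a} x * f x \<partial>torusM)"
      proof (rule integral_cong_AE)
        show "AE x in torusM. indicator {a<..} x * f x = f x - indicator {0<..<a} x * f x"
          using T ae0[of 0] ae0[of a] by eventually_elim (use 3 in \<open>auto simp: indicator_def\<close>)
      qed auto
      then show ?thesis using total arc[OF 3] f ind[of "{0<..<a}"] by simp
    next
      case 4
      have "(\<integral>x. indicator {a<..} x * f x \<partial>torusM) = (\<integral>x. 0 \<partial>torusM)"
      proof (rule integral_cong_AE)
        show "AE x in torusM. indicator {a<..} x * f x = 0"
          using T by eventually_elim (use 4 in \<open>auto simp: indicator_def\<close>)
      qed auto
      then show ?thesis by simp
    qed
  qed
  let ?M = "density torusM (\<lambda>x. ennreal (f x))" and ?N = "density torusM (\<lambda>x. ennreal (- f x))"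
  have eM: "emeasure ?M {a<..} = ennreal (\<integral>x. max 0 (indicator {a<..} x * f x) \<partial>torusM)" 
    and eN: "emeasure ?N {a<..} = ennreal (\<integral>x. max 0 (- (indicator {a<..} x * f x)) \<partial>torusM)" for a
  proof -
    have "emeasure ?M {a<..} = (\<integral>\<^sup>+x. ennreal (max 0 (indicator {a<..} x * f x)) \<partial>torusM)"
      by (auto simp: emeasure_density max_def ennreal_neg intro!: nn_integral_cong split: split_indicator)
    also have "\<dots> = ennreal (\<integral>x. max 0 (indicator {a<..} x * f x) \<partial>torusM)"
      using ind[of "{a<..}"] by (intro nn_integral_eq_integral) auto
    finally show "emeasure ?M {a<..} = ennreal (\<integral>x. max 0 (indicator {a<..} x * f x) \<partial>torusM)" .
    have "emeasure ?N {a<..} = (\<integral>\<^sup>+x. ennreal (max 0 (- (indicator {a<..} x * f x))) \<partial>torusM)"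
      by (auto simp: emeasure_density max_def ennreal_neg intro!: nn_integral_cong split: split_indicator)
    also have "\<dots> = ennreal (\<integral>x. max 0 (- (indicator {a<..} x * f x)) \<partial>torusM)"
      using ind[of "{a<..}"] by (intro nn_integral_eq_integral) auto
    finally show "emeasure ?N {a<..} = ennreal (\<integral>x. max 0 (- (indicator {a<..} x * f x)) \<partial>torusM)" .
  qed
  have "?M = ?N"
  proof (rule measure_eqI_lessThan)
    fix a
    have "(\<integral>x. max 0 (indicator {a<..} x * f x) \<partial>torusM) - (\<integral>x. max 0 (- (indicator {a<..} x * f x)) \<partial>torusM)
      = (\<integral>x. max 0 (indicator {a<..} x * f x) - max 0 (- (indicator {a<..} x * f x)) \<partial>torusM)"
      using ind[of "{a<..}"] by (intro Bochner_Integration.integral_diff[symmetric]) auto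
    also have "\<dots> = (\<integral>x. indicator {a<..} x * f x \<partial>torusM)"
      by (intro Bochner_Integration.integral_cong) auto
    finally show "emeasure ?M {a<..} = emeasure ?N {a<..}" unfolding eM eN half by simp
    show "emeasure ?M {a<..} < \<infinity>" unfolding eM by simp
  qed auto
  then have e: "emeasure ?M {x. 0 < f x} = emeasure ?N {x. 0 < f x}" "emeasure ?M {x. f x < 0} = emeasure ?N {x. f x < 0}" by auto
  have [measurable]: "{x. 0 < f x} \<in> sets borel" "{x. f x < 0} \<in> sets borel"
    using borel_measurable_less[of "\<lambda>_. 0" borel f] borel_measurable_less[of f borel "\<lambda>_. 0"] by simp_all
  have "emeasure ?N {x. 0 < f x} = 0" "emeasure ?M {x. f x < 0} = 0"
    by (auto simp: emeasure_density ennreal_neg intro!: nn_integral_0_iff_AE[THEN iffD2] AE_I2 split: split_indicator)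
  with e have "emeasure ?M {x. 0 < f x} = 0" "emeasure ?N {x. f x < 0} = 0" by auto
  then have "AE x in torusM. ennreal (f x) * indicator {x. 0 < f x} x = 0" "AE x in torusM. ennreal (- f x) * indicator {x. f x < 0} x = 0"
    by (auto simp: emeasure_density nn_integral_0_iff_AE)
  then show ?thesis
    by eventually_elim (auto simp: indicator_def ennreal_eq_0_iff split: if_splits)
qed

text \<open>Without the factor 1 / (2 pi), and for nonnegative frequencies only: for a real function
  the others are complex conjugates. In terms of the usual coefficients it is pi (a_j - i
  b_j).\<close>

definition fc :: "(real \<Rightarrow> real) \<Rightarrow> nat \<Rightarrow> complex" where
  "fc f j = (\<integral>x. of_real (f x) * cis (- (real j * x)) \<partial>torusM)"

definition L1 :: "(real \<Rightarrow> real) \<Rightarrow> bool" where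
  "L1 f \<longleftrightarrow> f \<in> borel_measurable borel \<and> periodic2pi f \<and> integrable torusM f"

lemma L1_borel: "L1 f \<Longrightarrow> f \<in> borel_measurable borel" by (simp add: L1_def)

lemma L1_iff_tint: 
  assumes "f \<in> borel_measurable borel" "periodic2pi f"
  shows "L1 f \<longleftrightarrow> tint (\<lambda>x. ennreal \<bar>f x\<bar>) < \<infinity>"
  using assms by (simp add: L1_def integrable_iff_bounded nn_integral_torusM)

lemma L1_diff: "L1 f \<Longrightarrow> L1 g \<Longrightarrow> L1 (\<lambda>x. f x - g x)"
  by (auto simp: L1_def periodic2pi_def)

lemma L1_add: "L1 f \<Longrightarrow> L1 g \<Longrightarrow> L1 (\<lambda>x. f x + g x)"
  by (auto simp: L1_def periodic2pi_def)

lemma L1_cmult: "L1 f \<Longrightarrow> L1 (\<lambda>x. c * f x)"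
  by (auto simp: L1_def periodic2pi_def)

lemma integrable_cis_mult: "integrable torusM f \<Longrightarrow> integrable torusM (\<lambda>x. complex_of_real (f x) * cis (of_int k * x))"
  using integrable_torusM_bounded_mult[of "\<lambda>x. complex_of_real (f x)" "\<lambda>x. cis (of_int k * x)" 1]
  by (simp add: mult.commute)

lemma fc_eq: "fc f j = (\<integral>x. of_real (f x) * cis (of_int (- int j) * x) \<partial>torusM)"
  by (simp add: fc_def)

lemma integrable_fc: "integrable torusM f \<Longrightarrow> integrable torusM (\<lambda>x. complex_of_real (f x) * cis (- (real j * x)))"
  using integrable_cis_mult[of f "- int j"] by simp

lemma fc_diff: "L1 f \<Longrightarrow> L1 g \<Longrightarrow> fc (\<lambda>x. f x - g x) j = fc f j - fc g j"
  unfolding fc_def L1_def using integrable_fc by (simp add: left_diff_distrib)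

lemma fc_add: "L1 f \<Longrightarrow> L1 g \<Longrightarrow> fc (\<lambda>x. f x + g x) j = fc f j + fc g j"
  unfolding fc_def L1_def using integrable_fc by (simp add: distrib_right)

lemma fc_cmult: "fc (\<lambda>x. c * f x) j = of_real c * fc f j"
  unfolding fc_def by (simp add: mult.assoc)

lemma fc_eq_0_imp:
  assumes f: "L1 f" and z: "\<And>j. fc f j = 0"
  shows "AE x in lborel. f x = 0"
proof (rule AE_torusM_imp_lborel)
  have i: "integrable torusM f" using f by (simp add: L1_def)
  have "(\<integral>x. of_real (f x) * cis (of_int k * x) \<partial>torusM) = 0" for k :: int
  proof (cases "k \<le> 0")
    case True
    then show ?thesis using z[of "nat (- k)"] unfolding fc_eq by simp
  next
    case False
    have "(\<integral>x. of_real (f x) * cis (of_int k * x) \<partial>torusM) = (\<integral>x. cnj (of_real (f x) * cis (of_int (- int (nat k)) * x)) \<partial>torusM)"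
      using False by (intro Bochner_Integration.integral_cong) (auto simp: cis_cnj)
    also have "\<dots> = cnj (fc f (nat k))" unfolding fc_eq by (rule Bochner_Integration.integral_cnj)
    finally show ?thesis using z by simp
  qed
  then show "AE x in torusM. f x = 0" by (rule fourier_uniqueness[OF i])
  show "f x = 0" if "f (wrap x) = 0" for x using that f periodic2pi_wrap[of f x] by (simp add: L1_def)
qed

lemma L1_bounded: 
  assumes "f \<in> borel_measurable borel" "periodic2pi f" "\<And>x. \<bar>f x\<bar> \<le> B"
  shows "L1 f"
  using assms unfolding L1_def by (auto intro!: torusM.integrable_const_bound[where B = B] AE_I2)

lemma cos_periodic_nat: "periodic2pi (\<lambda>x. cos (real j * x))" and sin_periodic_nat: "periodic2pi (\<lambda>x. sin (real j * x))"
proof -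
  have "cis (real j * (x + 2 * pi)) = cis (real j * x)" for x using cis_int_periodic[of "int j" x] by simp
  then have "Re (cis (real j * (x + 2 * pi))) = Re (cis (real j * x))" "Im (cis (real j * (x + 2 * pi))) = Im (cis (real j * x))" for x by simp_all
  then show "periodic2pi (\<lambda>x. cos (real j * x))" "periodic2pi (\<lambda>x. sin (real j * x))" by (simp_all add: periodic2pi_def)
qed

lemma L1_cos: "L1 (\<lambda>x. cos (real j * x))" and L1_sin: "L1 (\<lambda>x. sin (real j * x))"
  by (rule L1_bounded[where B = 1]; simp add: cos_periodic_nat sin_periodic_nat)+

lemma fc_cos: "fc (\<lambda>x. cos (real j * x)) m = (if j = m then (if j = 0 then 2 * pi else pi) else 0)"
proof -
  have e: "of_real (cos (real j * x)) * cis (- (real m * x)) = (1/2) * cis (of_int (int j - int m) * x) + (1/2) * cis (of_int (- int j - int m) * x)" for x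
  proof -
    have "cis (of_int (int j - int m) * x) = cis (real j * x) * cis (- (real m * x))"
      "cis (of_int (- int j - int m) * x) = cis (- (real j * x)) * cis (- (real m * x))"
      unfolding cis_mult by (simp_all add: algebra_simps)
    moreover have "complex_of_real (cos (real j * x)) = (cis (real j * x) + cis (- (real j * x))) / 2" by (simp add: complex_eq_iff)
    ultimately show ?thesis by (simp only:) (simp add: algebra_simps)
  qed
  have i: "integrable torusM (\<lambda>x. cis (of_int k * x))" for k :: int
    using integrable_cis_mult[of "\<lambda>_. 1" k] by simp
  have "fc (\<lambda>x. cos (real j * x)) m = (1/2) * (\<integral>x. cis (of_int (int j - int m) * x) \<partial>torusM) + (1/2) * (\<integral>x. cis (of_int (- int j - int m) * x) \<partial>torusM)"
    unfolding fc_def e by (subst Bochner_Integration.integral_add) (simp_all only: integral_mult_right_zero integrable_mult_right[OF i])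
  then show ?thesis unfolding integral_cis_torusM by auto
qed

lemma fc_sin: "fc (\<lambda>x. sin (real j * x)) m = (if j = m \<and> j \<noteq> 0 then - \<i> * pi else 0)"
proof -
  have e: "of_real (sin (real j * x)) * cis (- (real m * x)) = (- \<i> / 2) * cis (of_int (int j - int m) * x) + (\<i> / 2) * cis (of_int (- int j - int m) * x)" for x
  proof -
    have "cis (of_int (int j - int m) * x) = cis (real j * x) * cis (- (real m * x))"
      "cis (of_int (- int j - int m) * x) = cis (- (real j * x)) * cis (- (real m * x))"
      unfolding cis_mult by (simp_all add: algebra_simps)
    moreover have "complex_of_real (sin (real j * x)) = (- \<i> / 2) * cis (real j * x) + (\<i> / 2) * cis (- (real j * x))" by (simp add: complex_eq_iff)
    ultimately show ?thesis by (simp only:) (simp add: algebra_simps)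
  qed
  have i: "integrable torusM (\<lambda>x. cis (of_int k * x))" for k :: int
    using integrable_cis_mult[of "\<lambda>_. 1" k] by simp
  have "fc (\<lambda>x. sin (real j * x)) m = (- \<i> / 2) * (\<integral>x. cis (of_int (int j - int m) * x) \<partial>torusM) + (\<i> / 2) * (\<integral>x. cis (of_int (- int j - int m) * x) \<partial>torusM)"
    unfolding fc_def e by (subst Bochner_Integration.integral_add) (simp_all only: integral_mult_right_zero integrable_mult_right[OF i])
  then show ?thesis unfolding integral_cis_torusM by auto
qed

lemma L1_sum: "finite A \<Longrightarrow> (\<And>i. i \<in> A \<Longrightarrow> L1 (f i)) \<Longrightarrow> L1 (\<lambda>x. \<Sum>i\<in>A. f i x)"
proof (induction A rule: finite_induct)
  case empty
  show ?case by (auto intro!: L1_bounded[where B = 0] simp: periodic2pi_def)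
next
  case (insert i A)
  then show ?case using L1_add[of "f i" "\<lambda>x. \<Sum>i\<in>A. f i x"] by simp
qed

lemma fc_sum: "finite A \<Longrightarrow> (\<And>i. i \<in> A \<Longrightarrow> L1 (f i)) \<Longrightarrow> fc (\<lambda>x. \<Sum>i\<in>A. f i x) m = (\<Sum>i\<in>A. fc (f i) m)"
proof (induction A rule: finite_induct)
  case (insert i A)
  then show ?case using fc_add[of "f i" "\<lambda>x. \<Sum>i\<in>A. f i x" m] L1_sum[of A f] by simp
qed (simp add: fc_def)

lemma fc_trig_poly:
  fixes c :: real and a b :: "nat \<Rightarrow> real" and n :: nat
  defines "T \<equiv> \<lambda>x. c + (\<Sum>j=1..n. a j * cos (real j * x) + b j * sin (real j * x))"
  shows "L1 T" "fc T m = (if m = 0 then 2 * pi * c else if m \<le> n then pi * Complex (a m) (- b m) else 0)"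
proof -
  define t where "t = (\<lambda>j x. a j * cos (real j * x) + b j * sin (real j * x))"
  have t: "L1 (t j)" for j unfolding t_def by (intro L1_add L1_cmult L1_cos L1_sin)
  have S: "L1 (\<lambda>x. \<Sum>j=1..n. t j x)" by (intro L1_sum t) simp
  have cc: "L1 (\<lambda>x. c * cos (real 0 * x))" by (intro L1_cmult L1_cos)
  \<comment> \<open>The constant is written as a multiple of cos (0 x), so that
    \<open>fc_cos\<close> covers it.\<close>
  have T: "T = (\<lambda>x. c * cos (real 0 * x) + (\<Sum>j=1..n. t j x))" by (simp add: T_def t_def)
  show "L1 T" unfolding T by (rule L1_add[OF cc S])
  have ft: "fc (t j) m = (if j = m \<and> j \<noteq> 0 then pi * Complex (a m) (- b m) else if j = m then 2 * pi * a 0 else 0)" for j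
    unfolding t_def by (subst fc_add) (auto simp: fc_cmult fc_cos fc_sin complex_eq_iff intro: L1_cmult L1_cos L1_sin)
  have "fc T m = fc (\<lambda>x. c * cos (real 0 * x)) m + (\<Sum>j=1..n. fc (t j) m)"
    unfolding T by (subst fc_add[OF cc S]) (simp add: fc_sum t)
  also have "(\<Sum>j=1..n. fc (t j) m) = (\<Sum>j=1..n. if j = m then pi * Complex (a m) (- b m) else 0)"
    by (intro sum.cong) (auto simp: ft)
  finally show "fc T m = (if m = 0 then 2 * pi * c else if m \<le> n then pi * Complex (a m) (- b m) else 0)"
    unfolding fc_cmult fc_cos by (auto simp: sum.delta)
qed

text \<open>Uniqueness identifies the function with the polynomial that has the same coefficients.
  This is the source of the approximating polynomial, which arises as a difference of two functions
  whose coefficients agree above n.\<close>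

lemma finite_spectrum_trig_poly:
  assumes f: "L1 f" and z: "\<And>m. n < m \<Longrightarrow> fc f m = 0"
  shows "\<exists>T\<in>trig_polys n. AE x in lborel. f x = T x"
proof -
  define c where "c = Re (fc f 0) / (2 * pi)"
  define a where "a = (\<lambda>j. Re (fc f j) / pi)"
  define b where "b = (\<lambda>j. - Im (fc f j) / pi)"
  define T where "T = (\<lambda>x. c + (\<Sum>j=1..n. a j * cos (real j * x) + b j * sin (real j * x)))"
  note T = fc_trig_poly[where c = c and n = n and a = a and b = b, folded T_def]
  have "Im (fc f 0) = 0" by (simp add: fc_def)
  then have "fc f m = fc T m" for m
    unfolding T(2) using z[of m] by (auto simp: a_def b_def c_def complex_eq_iff)
  then have "fc (\<lambda>x. f x - T x) m = 0" for m using fc_diff[OF f T(1)] by simp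
  then have "AE x in lborel. f x - T x = 0" by (rule fc_eq_0_imp[OF L1_diff[OF f T(1)]])
  then have "AE x in lborel. f x = T x" by simp
  moreover have "T \<in> trig_polys n" unfolding trig_polys_def T_def by blast
  ultimately show ?thesis by blast
qed

lemma lebesgue_measurable_AE:
  fixes f :: "real \<Rightarrow> real"
  assumes f0 [measurable]: "f0 \<in> borel_measurable borel" and ae: "AE x in lborel. f x = f0 x"
  shows "f \<in> borel_measurable lebesgue"
proof (rule measurableI)
  fix A :: "real set" assume [measurable]: "A \<in> sets borel"
  obtain N where N: "N \<in> null_sets lborel" "{x \<in> space lborel. f x \<noteq> f0 x} \<subseteq> N"
    using ae by (auto elim!: AE_E simp: null_sets_def)
  have "f0 -` A \<in> sets borel" using measurable_sets[OF f0, of A] by simp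
  then have S: "f0 -` A - N \<in> sets lborel" using N by auto
  have "f -` A \<inter> space lebesgue = (f0 -` A - N) \<union> (f -` A \<inter> N)" using N(2) by auto
  then show "f -` A \<inter> space lebesgue \<in> sets lebesgue"
    by (rule sets_completionI[OF _ _ N(1) S]) auto
qed simp

lemma AE_lborel_shift:
  assumes "AE x in lborel. P x" shows "AE t in lborel. P (x + t :: real)"
proof -
  obtain N where N: "N \<in> null_sets lborel" "{x \<in> space lborel. \<not> P x} \<subseteq> N"
    using assms by (auto elim!: AE_E simp: null_sets_def)
  have "{t. t - (- x) \<in> N} \<in> null_sets lborel" by (rule null_sets_translation[OF N(1)])
  then show ?thesis by (rule AE_I') (use N(2) in \<open>auto simp: add.commute\<close>)
qed

lemma set_integral_lebesgue_torus:
  fixes f f0 u :: "real \<Rightarrow> real"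
  assumes f: "f \<in> borel_measurable lebesgue" and f0 [measurable]: "f0 \<in> borel_measurable borel" and ae: "AE x in lborel. f x = f0 x"
    and [measurable]: "u \<in> borel_measurable borel"
  shows "(LINT x:torus|lebesgue. f x * u x) = (\<integral>x. f0 x * u x \<partial>torusM)"
    "set_integrable lebesgue torus f \<longleftrightarrow> integrable torusM f0"
proof -
  have "(LINT x:torus|lebesgue. f x * u x) = (\<integral>x. indicator {0..<2 * pi} x *\<^sub>R (f0 x * u x) \<partial>lborel)"
    unfolding set_lebesgue_integral_def
  proof (rule integral_lebesgue_eq_lborel(2))
    show *: "AE x in lborel. indicator torus x *\<^sub>R (f x * u x) = indicator {0..<2 * pi} x *\<^sub>R (f0 x * u x)"
      using ae AE_lborel_singleton[of "2 * pi"] by eventually_elim (auto split: split_indicator)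
    show "(\<lambda>x. indicator {0..<2 * pi} x *\<^sub>R (f0 x * u x)) \<in> borel_measurable borel" by measurable
    then show "(\<lambda>x. indicator torus x *\<^sub>R (f x * u x)) \<in> borel_measurable lebesgue"
      by (rule lebesgue_measurable_AE) (rule *)
  qed
  then show "(LINT x:torus|lebesgue. f x * u x) = (\<integral>x. f0 x * u x \<partial>torusM)" by (simp add: integral_torusM(1))
  have "set_integrable lebesgue torus f \<longleftrightarrow> integrable lborel (\<lambda>x. indicator {0..<2 * pi} x *\<^sub>R f0 x)"
    unfolding set_integrable_def
  proof (rule integral_lebesgue_eq_lborel(1))
    show *: "AE x in lborel. indicator torus x *\<^sub>R f x = indicator {0..<2 * pi} x *\<^sub>R f0 x"
      using ae AE_lborel_singleton[of "2 * pi"] by eventually_elim (auto split: split_indicator)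
    show "(\<lambda>x. indicator {0..<2 * pi} x *\<^sub>R f0 x) \<in> borel_measurable borel" by measurable
    then show "(\<lambda>x. indicator torus x *\<^sub>R f x) \<in> borel_measurable lebesgue"
      by (rule lebesgue_measurable_AE) (rule *)
  qed
  then show "set_integrable lebesgue torus f \<longleftrightarrow> integrable torusM f0" by (simp add: integral_torusM(2))
qed

lemma fourier_cos_eq:
  assumes "f \<in> borel_measurable lebesgue" "L1 f0" "AE x in lborel. f x = f0 x"
  shows "fourier_cos f j = Re (fc f0 j) / pi" "fourier_sin f j = - Im (fc f0 j) / pi"
proof -
  have [measurable]: "f0 \<in> borel_measurable borel" using assms(2) by (rule L1_borel)
  have i: "integrable torusM (\<lambda>x. complex_of_real (f0 x) * cis (- (real j * x)))"
    using assms(2) integrable_fc by (auto simp: L1_def)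
  have "fourier_cos f j = 1 / pi * (\<integral>x. f0 x * cos (real j * x) \<partial>torusM)"
    unfolding fourier_cos_def by (subst set_integral_lebesgue_torus(1)[OF assms(1) _ assms(3)]) auto
  also have "(\<integral>x. f0 x * cos (real j * x) \<partial>torusM) = Re (fc f0 j)"
    unfolding fc_def by (subst integral_Re[OF i, symmetric]) simp
  finally show "fourier_cos f j = Re (fc f0 j) / pi" by simp
  have "fourier_sin f j = 1 / pi * (\<integral>x. f0 x * sin (real j * x) \<partial>torusM)"
    unfolding fourier_sin_def by (subst set_integral_lebesgue_torus(1)[OF assms(1) _ assms(3)]) auto
  also have "(\<integral>x. f0 x * sin (real j * x) \<partial>torusM) = - Im (fc f0 j)"
    unfolding fc_def by (subst integral_Im[OF i, symmetric]) simp
  finally show "fourier_sin f j = - Im (fc f0 j) / pi" by simp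
qed

section \<open>Convolution operators and the Fourier transforms of their kernels\<close>

definition rconv :: "(real \<Rightarrow> real) \<Rightarrow> (real \<Rightarrow> real) \<Rightarrow> real \<Rightarrow> real" where
  "rconv K f x = (\<integral>t. K t * f (x + t) \<partial>lborel)"

text \<open>The sign in the exponent is positive because \<open>rconv\<close> evaluates f at x + t;
  with it the coefficients of \<open>rconv K f\<close> are products.\<close>

definition kc :: "(real \<Rightarrow> real) \<Rightarrow> nat \<Rightarrow> complex" where
  "kc K j = (\<integral>t. of_real (K t) * cis (real j * t) \<partial>lborel)"

lemma rconv_le_nconv:
  "ennreal \<bar>rconv K f x\<bar> \<le> nconv (\<lambda>t. ennreal \<bar>K t\<bar>) (\<lambda>x. ennreal \<bar>f x\<bar>) x"
proof -
  have "ennreal (norm (rconv K f x)) \<le> (\<integral>\<^sup>+t. ennreal (norm (K t * f (x + t))) \<partial>lborel)"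
  proof (cases "integrable lborel (\<lambda>t. K t * f (x + t))")
    case True
    then show ?thesis unfolding rconv_def by (rule integral_norm_bound_ennreal)
  next
    case False
    \<comment> \<open>By convention the integral is 0 here, and the estimate is trivial.\<close>
    then show ?thesis unfolding rconv_def by (simp add: not_integrable_integral_eq)
  qed
  also have "\<dots> = nconv (\<lambda>t. ennreal \<bar>K t\<bar>) (\<lambda>x. ennreal \<bar>f x\<bar>) x"
    unfolding nconv_def by (simp add: abs_mult ennreal_mult)
  finally show ?thesis by simp
qed

lemma tint_nconv_mass:
  assumes [measurable]: "K \<in> borel_measurable borel" "F \<in> borel_measurable borel" and "periodic2pi F"
  shows "tint (nconv K F) = (\<integral>\<^sup>+t. K t \<partial>lborel) * tint F"
proof -
  have "tint (\<lambda>x. nconv K F x * 1) = tint (\<lambda>x. F x * (\<integral>\<^sup>+t. K t * 1 \<partial>lborel))"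
    using assms by (intro tint_nconv) (auto simp: periodic2pi_def)
  moreover have "tint (\<lambda>x. F x * (\<integral>\<^sup>+t. K t \<partial>lborel)) = (\<integral>\<^sup>+t. K t \<partial>lborel) * tint F"
    by (subst tint_cmult[symmetric]) (simp_all add: mult.commute)
  ultimately show ?thesis by simp
qed

text \<open>Fubini on the product of a period with the line; the integral of the absolute value
  there is the product of the two L^1 norms, by \<open>tint_nconv_mass\<close>.\<close>

lemma rconv_L1:
  assumes K: "integrable lborel K" and f: "L1 f"
  shows "L1 (rconv K f)" and "fc (rconv K f) j = kc K j * fc f j"
proof -
  have [measurable]: "K \<in> borel_measurable borel" using borel_measurable_integrable[OF K] by simp
  have [measurable]: "f \<in> borel_measurable borel" and fp: "periodic2pi f" using f by (auto simp: L1_def)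
  have fin: "tint (nconv (\<lambda>t. ennreal \<bar>K t\<bar>) (\<lambda>x. ennreal \<bar>f x\<bar>)) < \<infinity>"
  proof -
    have "periodic2pi (\<lambda>x. ennreal \<bar>f x\<bar>)" using fp by (simp add: periodic2pi_def)
    moreover have "(\<integral>\<^sup>+t. ennreal \<bar>K t\<bar> \<partial>lborel) < \<infinity>" using K by (simp add: integrable_iff_bounded)
    moreover have "tint (\<lambda>x. ennreal \<bar>f x\<bar>) < \<infinity>" using f fp by (simp add: L1_iff_tint)
    ultimately show ?thesis by (subst tint_nconv_mass) (auto simp: ennreal_mult_less_top)
  qed
  have [measurable]: "rconv K f \<in> borel_measurable borel" unfolding rconv_def by measurable
  have per: "periodic2pi (rconv K f)"
    unfolding periodic2pi_def rconv_def
  proof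
    fix x
    have "f (x + 2 * pi + t) = f (x + t)" for t using periodic2piD[OF fp, of "x + t"] by (simp add: algebra_simps)
    then show "(\<integral>t. K t * f (x + 2 * pi + t) \<partial>lborel) = (\<integral>t. K t * f (x + t) \<partial>lborel)" by simp
  qed
  have "tint (\<lambda>x. ennreal \<bar>rconv K f x\<bar>) < \<infinity>"
    by (rule le_less_trans[OF tint_mono[OF rconv_le_nconv] fin])
  then show L: "L1 (rconv K f)" by (subst L1_iff_tint) (auto simp: per)
  define h where "h = (\<lambda>(x, t). complex_of_real (K t * f (x + t)) * cis (- (real j * x)))"
  have [measurable]: "h \<in> borel_measurable (torusM \<Otimes>\<^sub>M lborel)" unfolding h_def by measurable
  have "(\<integral>\<^sup>+p. ennreal (norm (h p)) \<partial>(torusM \<Otimes>\<^sub>M lborel)) = (\<integral>\<^sup>+x. \<integral>\<^sup>+t. ennreal (norm (h (x, t))) \<partial>lborel \<partial>torusM)"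
    by (rule lborel.nn_integral_fst[symmetric]) measurable
  also have "\<dots> = (\<integral>\<^sup>+x. nconv (\<lambda>t. ennreal \<bar>K t\<bar>) (\<lambda>x. ennreal \<bar>f x\<bar>) x \<partial>torusM)"
    unfolding nconv_def h_def by (simp add: norm_mult abs_mult ennreal_mult)
  also have "\<dots> < \<infinity>" using fin by (simp add: nn_integral_torusM)
  finally have hi: "integrable (torusM \<Otimes>\<^sub>M lborel) h" by (intro integrableI_bounded) auto
  have "fc (rconv K f) j = (\<integral>x. \<integral>t. h (x, t) \<partial>lborel \<partial>torusM)"
    unfolding fc_def rconv_def h_def by (simp del: of_real_mult)
  also have "\<dots> = (\<integral>t. \<integral>x. h (x, t) \<partial>torusM \<partial>lborel)"
    using torus_lborel.Fubini_integral[of "\<lambda>x t. h (x, t)"] hi by simp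
  also have "\<dots> = (\<integral>t. of_real (K t) * cis (real j * t) * fc f j \<partial>lborel)"
  proof (rule Bochner_Integration.integral_cong[OF refl])
    fix t
    have "h (x, t) = of_real (K t) * cis (real j * t) * (of_real (f (x + t)) * cis (of_int (- int j) * (x + t)))" for x
    proof -
      have "cis (- (real j * x)) = cis (real j * t) * cis (of_int (- int j) * (x + t))" unfolding cis_mult by (simp add: algebra_simps)
      then show ?thesis by (simp add: h_def mult_ac)
    qed
    then have "(\<integral>x. h (x, t) \<partial>torusM) = of_real (K t) * cis (real j * t) * (\<integral>x. of_real (f (x + t)) * cis (of_int (- int j) * (x + t)) \<partial>torusM)"
      by (simp only: integral_mult_right_zero)
    also have "(\<integral>x. of_real (f (x + t)) * cis (of_int (- int j) * (x + t)) \<partial>torusM) = fc f j"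
      unfolding fc_eq by (rule integral_torusM_shift[where F = "\<lambda>x. of_real (f x) * cis (of_int (- int j) * x)"])
        (measurable, unfold periodic2pi_def cis_int_periodic, use periodic2piD[OF fp] in auto)
    finally show "(\<integral>x. h (x, t) \<partial>torusM) = of_real (K t) * cis (real j * t) * fc f j" .
  qed
  also have "\<dots> = kc K j * fc f j" unfolding kc_def by simp
  finally show "fc (rconv K f) j = kc K j * fc f j" .
qed

definition rbox :: "real \<Rightarrow> real \<Rightarrow> real" where
  "rbox h t = 1 / h * indicator {- h / 2..h / 2} t"

lemma rbox_integrable: "integrable lborel (rbox h)"
  unfolding rbox_def by (intro integrable_mult_right) (simp add: less_top[symmetric] integrable_real_indicator emeasure_lborel_Icc_eq)

lemma rbox_borel [measurable]: "rbox h \<in> borel_measurable borel"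
  unfolding rbox_def by measurable

lemma abs_rbox: "0 < h \<Longrightarrow> ennreal \<bar>rbox h t\<bar> = boxk h t"
  by (auto simp: rbox_def boxk_def split: split_indicator)

lemma kc_rbox:
  assumes h: "0 < h" and j: "1 \<le> j"
  shows "kc (rbox h) j = of_real (sin (real j * h / 2) / (real j * h / 2))"
proof -
  have c: "continuous_on {- h / 2..h / 2} (\<lambda>t. cis (real j * t))" by (intro continuous_intros)
  have "kc (rbox h) j = (\<integral>t. of_real (1 / h) * (indicator {- h / 2..h / 2} t *\<^sub>R cis (real j * t)) \<partial>lborel)"
    unfolding kc_def rbox_def by (intro Bochner_Integration.integral_cong) (auto split: split_indicator)
  also have "\<dots> = of_real (1 / h) * (LINT t:{- h / 2..h / 2}|lborel. cis (real j * t))"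
    by (simp only: integral_mult_right_zero set_lebesgue_integral_def)
  also have "(LINT t:{- h / 2..h / 2}|lborel. cis (real j * t)) = integral {- h / 2..h / 2} (\<lambda>t. cis (real j * t))"
    by (rule set_borel_integral_eq_integral(2)) (rule borel_integrable_atLeastAtMost'[OF c])
  also have "\<dots> = - \<i> / j * cis (real j * (h / 2)) - (- \<i> / j * cis (real j * (- h / 2)))"
  proof (intro integral_unique fundamental_theorem_of_calculus)
    fix t
    show "((\<lambda>t. - \<i> / j * cis (real j * t)) has_vector_derivative cis (real j * t)) (at t within {- h / 2..h / 2})"
      using j unfolding has_vector_derivative_complex_iff
      by (auto intro!: derivative_eq_intros simp: has_real_derivative_iff_has_vector_derivative[symmetric])
  qed (use h in auto)
  also have "\<dots> = of_real (2 * sin (real j * h / 2) / j)"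
    using j by (simp add: complex_eq_iff field_simps)
  finally show ?thesis using h j by (simp add: field_simps)
qed

text \<open>From almost everywhere to everywhere: an average does not see null sets. From the first
  average on, the iterates of two versions of a function therefore coincide at every point.\<close>

lemma steklov_eq_rconv:
  assumes f: "AE x in lborel. f x = f0 x" and [measurable]: "f0 \<in> borel_measurable borel" 
  shows "steklov h f x = rconv (rbox h) f0 x"
proof -
  have "(LINT t:{- h / 2..h / 2}|lebesgue. f (x + t)) = (\<integral>t. indicator {- h / 2..h / 2} t *\<^sub>R f0 (x + t) \<partial>lborel)"
    unfolding set_lebesgue_integral_def
  proof (rule integral_lebesgue_eq_lborel(2))
    show *: "AE t in lborel. indicator {- h / 2..h / 2} t *\<^sub>R f (x + t) = indicator {- h / 2..h / 2} t *\<^sub>R f0 (x + t)"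
      using AE_lborel_shift[OF f, of x] by eventually_elim simp
    show "(\<lambda>t. indicator {- h / 2..h / 2} t *\<^sub>R f0 (x + t)) \<in> borel_measurable borel" by measurable
    then show "(\<lambda>t. indicator {- h / 2..h / 2} t *\<^sub>R f (x + t)) \<in> borel_measurable lebesgue"
      by (rule lebesgue_measurable_AE) (rule *)
  qed
  then show ?thesis by (simp add: steklov_def rconv_def rbox_def mult.assoc)
qed

subsection \<open>Kernels of Fourier multipliers\<close>

text \<open>Of the two exponentials in the cosine only the one of negative frequency can cancel the
  frequency m \<ge> 1. So a real kernel can carry a multiplier with the constant argument
  -g.\<close>

lemma integral_cos_phase_cis:
  assumes m: "1 \<le> m"
  shows "(\<integral>t. of_real (cos (real j * t + g)) * cis (real m * t) \<partial>torusM) = (if j = m then pi * cis (- g) else 0)"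
proof -
  have e: "of_real (cos (real j * t + g)) * cis (real m * t) = (cis g / 2) * cis (of_int (int j + int m) * t) + (cis (- g) / 2) * cis (of_int (int m - int j) * t)" for t
  proof -
    have "complex_of_real (cos u) = (cis u + cis (- u)) / 2" for u by (simp add: complex_eq_iff)
    from this[of "real j * t + g"]
    have "complex_of_real (cos (real j * t + g)) = (cis (real j * t + g) + cis (- (real j * t + g))) / 2" .
    also have "\<dots> * cis (real m * t) = (cis (real j * t + g) * cis (real m * t) + cis (- (real j * t + g)) * cis (real m * t)) / 2" by (simp add: algebra_simps)
    also have "\<dots> = (cis g * cis (of_int (int j + int m) * t) + cis (- g) * cis (of_int (int m - int j) * t)) / 2"
      unfolding cis_mult by (simp add: algebra_simps)
    finally show ?thesis by (simp add: add_divide_distrib)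
  qed
  have i: "integrable torusM (\<lambda>x. cis (of_int k * x))" for k :: int
    using integrable_cis_mult[of "\<lambda>_. 1" k] by (simp add: L1_bounded[unfolded L1_def, where B = 1] finite_measure.integrable_const[OF finite_measure_torusM])
  have "(\<integral>t. of_real (cos (real j * t + g)) * cis (real m * t) \<partial>torusM) 
    = (cis g / 2) * (\<integral>t. cis (of_int (int j + int m) * t) \<partial>torusM) + (cis (- g) / 2) * (\<integral>t. cis (of_int (int m - int j) * t) \<partial>torusM)"
    unfolding e by (subst Bochner_Integration.integral_add) (simp_all only: integral_mult_right_zero integrable_mult_right[OF i])
  then show ?thesis unfolding integral_cis_torusM using m by auto
qed

text \<open>Multiplication by 2 - 2 cos t acts on the sequence cos (j t + g) as minus the second
  difference, which is then shifted onto \<mu>. Since \<mu>(0) = 0, the only boundary term is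
  \<mu>(1) times the cosine of index 0; the phase g is arbitrary throughout.\<close>

lemma summation_by_parts_cos:
  fixes \<mu> :: "nat \<Rightarrow> real"
  assumes s: "summable (\<lambda>j. \<bar>\<mu> j\<bar>)" and m0: "\<mu> 0 = 0"
    and b: "\<And>J. \<bar>\<mu> 1\<bar> + (\<Sum>j<J. \<bar>\<mu> (j + 2) - 2 * \<mu> (j + 1) + \<mu> j\<bar>) \<le> A"
  shows "(2 - 2 * cos t) * \<bar>\<Sum>j. \<mu> j * cos (real j * t + g)\<bar> \<le> A"
proof -
  define c where "c = (\<lambda>j. cos (real j * t + g))"
  have c1: "\<bar>c j\<bar> \<le> 1" for j by (simp add: c_def)
  have sm: "summable (\<lambda>j. \<mu> (j + k) * c (j + l))" for k l
  proof (rule summable_comparison_test'[of "\<lambda>j. \<bar>\<mu> (j + k)\<bar>" 0])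
    show "summable (\<lambda>j. \<bar>\<mu> (j + k)\<bar>)" using s by (subst summable_iff_shift)
    show "norm (\<mu> (n + k) * c (n + l)) \<le> \<bar>\<mu> (n + k)\<bar>" for n
      using c1 by (auto simp: abs_mult intro: mult_left_le)
  qed
  have shift: "(\<Sum>j. f j) = f 0 + (\<Sum>j. f (j + 1))" if "summable f" for f :: "nat \<Rightarrow> real"
    using suminf_split_head[OF that] by simp
  have rec: "(2 - 2 * cos t) * c (j + 1) = 2 * c (j + 1) - c (j + 2) - c j" for j
  proof -
    have "c (j + 2) + c j = 2 * cos t * c (j + 1)"
      using cos_add[of "real (j + 1) * t + g" t] cos_diff[of "real (j + 1) * t + g" t]
      by (simp add: c_def algebra_simps)
    then show ?thesis by (simp add: algebra_simps)
  qed
  have "(\<Sum>j. \<mu> j * c j) = (\<Sum>j. \<mu> (j + 1) * c (j + 1))" using shift[of "\<lambda>j. \<mu> j * c j"] sm[of 0 0] m0 by simp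
  then have "(2 - 2 * cos t) * (\<Sum>j. \<mu> j * c j) = (\<Sum>j. (2 - 2 * cos t) * (\<mu> (j + 1) * c (j + 1)))"
    using suminf_mult[OF sm[of 1 1]] by simp
  also have "\<dots> = (\<Sum>j. 2 * (\<mu> (j + 1) * c (j + 1)) - \<mu> (j + 1) * c (j + 2) - \<mu> (j + 1) * c (j + 0))"
    using rec by (intro suminf_cong) (simp add: mult.left_commute[of "2 - 2 * cos t"] right_diff_distrib)
  also have "\<dots> = 2 * (\<Sum>j. \<mu> (j + 1) * c (j + 1)) - (\<Sum>j. \<mu> (j + 1) * c (j + 2)) - (\<Sum>j. \<mu> (j + 1) * c (j + 0))"
    using sm by (simp only: suminf_diff[symmetric] suminf_mult[symmetric] summable_diff summable_mult)
  also have "(\<Sum>j. \<mu> (j + 1) * c (j + 2)) = (\<Sum>j. \<mu> (j + 0) * c (j + 1))"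
    using shift[OF sm[of 0 1]] m0 by simp
  also have "(\<Sum>j. \<mu> (j + 1) * c (j + 0)) = \<mu> 1 * c 0 + (\<Sum>j. \<mu> (j + 2) * c (j + 1))"
    using shift[OF sm[of 1 0]] by simp
  also have "2 * (\<Sum>j. \<mu> (j + 1) * c (j + 1)) - (\<Sum>j. \<mu> (j + 0) * c (j + 1)) - (\<mu> 1 * c 0 + (\<Sum>j. \<mu> (j + 2) * c (j + 1)))
    = (\<Sum>j. 2 * (\<mu> (j + 1) * c (j + 1)) - \<mu> (j + 0) * c (j + 1) - \<mu> (j + 2) * c (j + 1)) - \<mu> 1 * c 0"
    using sm by (simp only: suminf_diff[symmetric] suminf_mult[symmetric] summable_diff summable_mult)
  also have "(\<lambda>j. 2 * (\<mu> (j + 1) * c (j + 1)) - \<mu> (j + 0) * c (j + 1) - \<mu> (j + 2) * c (j + 1)) = (\<lambda>j. - (\<mu> (j + 2) - 2 * \<mu> (j + 1) + \<mu> j) * c (j + 1))"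
    by (auto simp: fun_eq_iff algebra_simps)
  finally have eq: "(2 - 2 * cos t) * (\<Sum>j. \<mu> j * c j) = (\<Sum>j. - (\<mu> (j + 2) - 2 * \<mu> (j + 1) + \<mu> j) * c (j + 1)) - \<mu> 1 * c 0" .
  define d where "d = (\<lambda>j. \<bar>\<mu> (j + 2) - 2 * \<mu> (j + 1) + \<mu> j\<bar>)"
  have db: "(\<Sum>j<J. d j) \<le> A - \<bar>\<mu> 1\<bar>" for J using b[of J] by (simp add: d_def)
  have dsum: "summable d" by (rule summableI_nonneg_bounded[OF _ db]) (simp add: d_def)
  have dle: "(\<Sum>j. d j) \<le> A - \<bar>\<mu> 1\<bar>" by (rule suminf_le_const[OF dsum db])
  have tb: "\<bar>- (\<mu> (j + 2) - 2 * \<mu> (j + 1) + \<mu> j) * c (j + 1)\<bar> \<le> d j" for j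
    using c1[of "j + 1"] by (simp only: abs_mult abs_minus_cancel d_def) (intro mult_left_le, auto)
  have ts: "summable (\<lambda>j. \<bar>- (\<mu> (j + 2) - 2 * \<mu> (j + 1) + \<mu> j) * c (j + 1)\<bar>)"
    by (rule summable_comparison_test'[OF dsum, of 0]) (use tb in auto)
  have "\<bar>\<Sum>j. - (\<mu> (j + 2) - 2 * \<mu> (j + 1) + \<mu> j) * c (j + 1)\<bar> \<le> (\<Sum>j. \<bar>- (\<mu> (j + 2) - 2 * \<mu> (j + 1) + \<mu> j) * c (j + 1)\<bar>)"
    by (rule summable_rabs[OF ts])
  also have "\<dots> \<le> (\<Sum>j. d j)" by (rule suminf_le[OF tb ts dsum])
  finally have "\<bar>\<Sum>j. - (\<mu> (j + 2) - 2 * \<mu> (j + 1) + \<mu> j) * c (j + 1)\<bar> \<le> A - \<bar>\<mu> 1\<bar>" using dle by simp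
  moreover have "\<bar>\<mu> 1 * c 0\<bar> \<le> \<bar>\<mu> 1\<bar>" using c1[of 0] by (simp add: abs_mult mult_left_le)
  ultimately have "\<bar>(2 - 2 * cos t) * (\<Sum>j. \<mu> j * c j)\<bar> \<le> A" unfolding eq by linarith
  moreover have "0 \<le> 2 - 2 * cos t" by simp
  ultimately show ?thesis by (simp only: abs_mult abs_of_nonneg c_def)
qed

text \<open>With x = t / 2 the right side is 4 (sin x)^2, and |x| \<le> 2 makes the cubic Taylor
  term at most 2 |x| / 3, which leaves |sin x| \<ge> |x| / 3.\<close>

lemma two_minus_two_cos_ge:
  assumes "\<bar>t\<bar> \<le> pi" shows "t\<^sup>2 / 9 \<le> 2 - 2 * cos t"
proof -
  define x where "x = t / 2"
  have x: "\<bar>x\<bar> \<le> 2" using assms pi_less_4 by (simp add: x_def)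
  have "\<bar>sin x - x\<bar> \<le> inverse (fact 3) * \<bar>x\<bar> ^ 3"
    using Maclaurin_sin_bound[of x 3] by (simp add: numeral_3_eq_3 sin_coeff_def)
  then have "\<bar>sin x - x\<bar> \<le> \<bar>x\<bar> ^ 3 / 6" by (simp add: fact_numeral)
  moreover have "\<bar>x\<bar> \<le> \<bar>sin x\<bar> + \<bar>sin x - x\<bar>" by linarith
  ultimately have "\<bar>x\<bar> - \<bar>x\<bar> ^ 3 / 6 \<le> \<bar>sin x\<bar>" by linarith
  moreover have "\<bar>x\<bar> ^ 3 \<le> \<bar>x\<bar> * 4"
  proof -
    have "\<bar>x\<bar>\<^sup>2 \<le> 2\<^sup>2" using x by (intro power_mono) auto
    then have "\<bar>x\<bar> * \<bar>x\<bar>\<^sup>2 \<le> \<bar>x\<bar> * 4" by (intro mult_left_mono) auto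
    then show ?thesis by (simp add: power3_eq_cube power2_eq_square)
  qed
  ultimately have "\<bar>x\<bar> / 3 \<le> \<bar>sin x\<bar>" by linarith
  then have "(\<bar>x\<bar> / 3)\<^sup>2 \<le> \<bar>sin x\<bar>\<^sup>2" by (intro power_mono) auto
  then have "x\<^sup>2 / 9 \<le> (sin x)\<^sup>2" by (simp add: power_divide)
  moreover have "2 - 2 * cos t = 4 * (sin x)\<^sup>2"
    using cos_double_sin[of x] by (simp add: x_def)
  ultimately show ?thesis by (simp add: x_def power_divide)
qed

context orlicz_weight
begin

text \<open>The kernel is one period of the cosine series with coefficients \<mu>, cut off outside
  [-pi, pi). The first sum bounds its size, the second its decay after division by 2 - 2 cos t \<ge>
  t^2 / 9, whence the factor 9; together they are the hypotheses of
  \<open>opbd_decay\<close>.\<close>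

lemma multiplier_kernel:
  fixes \<mu> :: "nat \<Rightarrow> real"
  assumes N: "0 < N" and A: "0 \<le> A" and m0: "\<mu> 0 = 0"
    and s: "\<And>J. (\<Sum>j<J. \<bar>\<mu> j\<bar>) \<le> A * N"
    and b: "\<And>J. \<bar>\<mu> 1\<bar> + (\<Sum>j<J. \<bar>\<mu> (j + 2) - 2 * \<mu> (j + 1) + \<mu> j\<bar>) \<le> A / N"
  shows "\<exists>K. K \<in> borel_measurable borel \<and> opbd (\<lambda>t. ennreal \<bar>K t\<bar>) (ennreal (9 * A * Kdec)) \<and>
    (\<forall>m\<ge>1. kc K m = of_real (\<mu> m) * cis (- g))"
proof -
  define K0 where "K0 = (\<lambda>t. \<Sum>j. \<mu> j * cos (real j * t + g))"
  define K where "K = (\<lambda>t. 1 / pi * indicator {-pi..<-pi + 2 * pi} t * K0 t)"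
  have [measurable]: "K0 \<in> borel_measurable borel" unfolding K0_def by measurable
  have [measurable]: "K \<in> borel_measurable borel" unfolding K_def by measurable
  have sm: "summable (\<lambda>j. \<bar>\<mu> j\<bar>)" by (rule summableI_nonneg_bounded[OF _ s]) simp
  have tb: "\<bar>\<mu> j * cos (real j * t + g)\<bar> \<le> \<bar>\<mu> j\<bar>" for j t by (simp add: abs_mult mult_left_le)
  have ts: "summable (\<lambda>j. \<bar>\<mu> j * cos (real j * t + g)\<bar>)" for t
    by (rule summable_comparison_test'[OF sm, of 0]) (use tb in auto)
  have K0b: "\<bar>K0 t\<bar> \<le> A * N" for t
  proof -
    have "\<bar>K0 t\<bar> \<le> (\<Sum>j. \<bar>\<mu> j * cos (real j * t + g)\<bar>)" unfolding K0_def by (rule summable_rabs[OF ts])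
    also have "\<dots> \<le> (\<Sum>j. \<bar>\<mu> j\<bar>)" by (rule suminf_le[OF tb ts sm])
    also have "\<dots> \<le> A * N" by (rule suminf_le_const[OF sm s])
    finally show ?thesis .
  qed
  have K0d: "t\<^sup>2 * \<bar>K0 t\<bar> \<le> 9 * A / N" if "\<bar>t\<bar> \<le> pi" for t
  proof -
    have "t\<^sup>2 / 9 * \<bar>K0 t\<bar> \<le> (2 - 2 * cos t) * \<bar>K0 t\<bar>" by (intro mult_right_mono two_minus_two_cos_ge that) auto
    also have "\<dots> \<le> A / N" unfolding K0_def by (rule summation_by_parts_cos[OF sm m0 b])
    finally show ?thesis by (simp add: mult.commute)
  qed
  have pi1: "1 / pi \<le> 1" using pi_gt3 by simp
  have KK0: "\<bar>K t\<bar> \<le> \<bar>K0 t\<bar>" and K0: "\<bar>K t\<bar> = 0 \<or> \<bar>t\<bar> \<le> pi" for t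
    using mult_right_mono[OF pi1, of "\<bar>K0 t\<bar>"] by (auto simp: K_def abs_mult indicator_def)
  have op: "opbd (\<lambda>t. ennreal \<bar>K t\<bar>) (ennreal (9 * A * Kdec))"
  proof (rule opbd_decay[OF _ N])
    fix t
    have "A * N \<le> 9 * A * N" using A N by simp
    then show "\<bar>K t\<bar> \<le> 9 * A * N" using KK0[of t] K0b[of t] by linarith
    show "\<bar>K t\<bar> * t\<^sup>2 \<le> 9 * A / N"
    proof (cases "\<bar>t\<bar> \<le> pi")
      case True
      have "\<bar>K t\<bar> * t\<^sup>2 \<le> \<bar>K0 t\<bar> * t\<^sup>2" by (intro mult_right_mono KK0) auto
      then show ?thesis using K0d[OF True] by (simp add: mult.commute)
    next
      case False
      then have "\<bar>K t\<bar> = 0" using K0[of t] by auto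
      then show ?thesis using A N by simp
    qed
  qed (use A in auto)
  have K0per: "periodic2pi K0"
    unfolding periodic2pi_def
  proof
    fix t
    have "cos (real j * (t + 2 * pi) + g) = cos (real j * t + g)" for j
    proof -
      have "cis (real j * (t + 2 * pi) + g) = cis (real j * t + g)"
        using cis_int_periodic[of "int j" t] by (simp flip: cis_mult)
      then have "Re (cis (real j * (t + 2 * pi) + g)) = Re (cis (real j * t + g))" by simp
      then show ?thesis by simp
    qed
    then show "K0 (t + 2 * pi) = K0 t" by (simp add: K0_def)
  qed
  have "kc K m = of_real (\<mu> m) * cis (- g)" if m: "1 \<le> m" for m
  proof -
    have ck: "cis (real m * t) = cis (of_int (int m) * t)" for t by simp
    have per: "periodic2pi (\<lambda>t. of_real (K0 t) * cis (real m * t))"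
      using periodic2piD[OF K0per] unfolding ck by (simp add: periodic2pi_def cis_int_periodic del: of_int_of_nat_eq)
    have "kc K m = (\<integral>t. of_real (1 / pi) * (indicator {-pi..<-pi + 2 * pi} t *\<^sub>R (of_real (K0 t) * cis (real m * t))) \<partial>lborel)"
      unfolding kc_def K_def by (intro Bochner_Integration.integral_cong) (auto split: split_indicator)
    also have "\<dots> = of_real (1 / pi) * (\<integral>t. of_real (K0 t) * cis (real m * t) \<partial>torusM)"
      using integral_period(1)[OF _ per, of "-pi"] by (simp only: integral_mult_right_zero) simp
    also have "(\<integral>t. of_real (K0 t) * cis (real m * t) \<partial>torusM) = (\<integral>t. (\<Sum>j. of_real (\<mu> j) * (of_real (cos (real j * t + g)) * cis (real m * t))) \<partial>torusM)"
    proof (rule Bochner_Integration.integral_cong[OF refl])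
      fix t
      have "(\<lambda>j. complex_of_real (\<mu> j * cos (real j * t + g))) sums of_real (K0 t)"
        unfolding K0_def by (rule sums_of_real[OF summable_sums[OF summable_rabs_cancel[OF ts]]])
      then have "(\<lambda>j. complex_of_real (\<mu> j * cos (real j * t + g)) * cis (real m * t)) sums (of_real (K0 t) * cis (real m * t))"
        by (rule sums_mult2)
      then show "of_real (K0 t) * cis (real m * t) = (\<Sum>j. of_real (\<mu> j) * (of_real (cos (real j * t + g)) * cis (real m * t)))"
        by (simp add: sums_iff mult.assoc)
    qed
    also have "\<dots> = (\<Sum>j. \<integral>t. of_real (\<mu> j) * (of_real (cos (real j * t + g)) * cis (real m * t)) \<partial>torusM)"
    proof (rule integral_suminf)
      have bd: "norm (of_real (\<mu> j) * (of_real (cos (real j * t + g)) * cis (real m * t))) \<le> \<bar>\<mu> j\<bar>" for j t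
        using tb[of j t] by (simp add: norm_mult abs_mult mult.assoc[symmetric])
      show i: "integrable torusM (\<lambda>t. of_real (\<mu> j) * (of_real (cos (real j * t + g)) * cis (real m * t)))" for j
        by (rule finite_measure.integrable_const_bound[OF finite_measure_torusM, where B = "\<bar>\<mu> j\<bar>"]) (use bd in auto)
      show "AE t in torusM. summable (\<lambda>j. norm (of_real (\<mu> j) * (of_real (cos (real j * t + g)) * cis (real m * t))))"
        by (intro AE_I2 summable_comparison_test'[OF sm, of 0]) (use bd in auto)
      show "summable (\<lambda>j. \<integral>t. norm (of_real (\<mu> j) * (of_real (cos (real j * t + g)) * cis (real m * t))) \<partial>torusM)"
      proof (rule summable_comparison_test'[of "\<lambda>j. 2 * pi * \<bar>\<mu> j\<bar>" 0])
        show "summable (\<lambda>j. 2 * pi * \<bar>\<mu> j\<bar>)" by (intro summable_mult sm)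
        fix j
        have "(\<integral>t. norm (of_real (\<mu> j) * (of_real (cos (real j * t + g)) * cis (real m * t))) \<partial>torusM) \<le> (\<integral>t. \<bar>\<mu> j\<bar> \<partial>torusM)"
          by (intro integral_mono integrable_norm i finite_measure.integrable_const[OF finite_measure_torusM] bd)
        also have "\<dots> = 2 * pi * \<bar>\<mu> j\<bar>" by (simp add: measure_def emeasure_torusM)
        finally show "norm (\<integral>t. norm (of_real (\<mu> j) * (of_real (cos (real j * t + g)) * cis (real m * t))) \<partial>torusM) \<le> 2 * pi * \<bar>\<mu> j\<bar>"
          by simp
      qed
    qed
    also have "\<dots> = (\<Sum>j. if j = m then of_real (\<mu> m) * (pi * cis (- g)) else 0)"
      by (intro suminf_cong) (simp only: integral_mult_right_zero integral_cos_phase_cis[OF m], simp)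
    also have "\<dots> = of_real (\<mu> m) * (pi * cis (- g))"
      using sums_If_finite_set[of "{m}" "\<lambda>_. of_real (\<mu> m) * (pi * cis (- g))"] by (simp add: sums_iff)
    finally show ?thesis by simp
  qed
  then show ?thesis using op by (intro exI[of _ K]) auto
qed

end

text \<open>Only the symbol beyond 1 matters, because lower frequencies go into the approximating polynomial.
  Below 1 it is replaced by a linear function, whose second differences vanish.\<close>

definition ext1 :: "(real \<Rightarrow> real) \<Rightarrow> real \<Rightarrow> real" where
  "ext1 r x = (if x \<le> 1 then x * r 1 else r x)"

text \<open>Mean values of r' on two adjacent intervals, then of r'' between the two intermediate
  points, which are less than 2 d apart.\<close>

lemma second_difference_bound:
  fixes r r' r'' :: "real \<Rightarrow> real"
  assumes d: "0 < d" and der: "\<And>y. x \<le> y \<Longrightarrow> (r has_real_derivative r' y) (at y)" "\<And>y. x \<le> y \<Longrightarrow> (r' has_real_derivative r'' y) (at y)"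
    and b: "\<And>y. x \<le> y \<Longrightarrow> \<bar>r'' y\<bar> \<le> M"
  shows "\<bar>r (x + 2 * d) - 2 * r (x + d) + r x\<bar> \<le> 2 * d\<^sup>2 * M"
proof -
  obtain z1 where z1: "x < z1" "z1 < x + d" "r (x + d) - r x = (x + d - x) * r' z1"
    using MVT2[of x "x + d" r r'] d der(1) by auto
  obtain z2 where z2: "x + d < z2" "z2 < x + 2 * d" "r (x + 2 * d) - r (x + d) = (x + 2 * d - (x + d)) * r' z2"
    using MVT2[of "x + d" "x + 2 * d" r r'] d der(1) by auto
  obtain z3 where z3: "z1 < z3" "z3 < z2" "r' z2 - r' z1 = (z2 - z1) * r'' z3"
    using MVT2[of z1 z2 r' r''] z1 z2 der(2) by auto
  have "r (x + 2 * d) - 2 * r (x + d) + r x = d * (r' z2 - r' z1)"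
    using z1(3) z2(3) by (simp add: algebra_simps)
  then have "r (x + 2 * d) - 2 * r (x + d) + r x = d * ((z2 - z1) * r'' z3)" by (simp only: z3(3))
  then have "\<bar>r (x + 2 * d) - 2 * r (x + d) + r x\<bar> = d * ((z2 - z1) * \<bar>r'' z3\<bar>)"
    using d z1 z2 by (simp add: abs_mult)
  also have "\<dots> \<le> d * ((2 * d) * M)"
    using d z1 z2 z3 b[of z3] by (intro mult_left_mono mult_mono) auto
  finally show ?thesis by (simp add: power2_eq_square mult_ac)
qed

text \<open>Summed from N on, it bounds the tail of the series of inverse squares by 2 / N, with
  explicit partial sums suited to induction.\<close>

lemma inverse_square_telescope:
  fixes J :: nat assumes "1 \<le> J"
  shows "1 / (real J)\<^sup>2 \<le> 2 * (1 / real J - 1 / real (Suc J))"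
proof -
  have J: "1 \<le> real J" using assms by simp
  have "1 / real J - 1 / real (Suc J) = 1 / (real J * (real J + 1))" using J by (simp add: field_simps)
  moreover have "real J * (real J + 1) \<le> real J * (2 * real J)" using J by (intro mult_left_mono) auto
  then have "1 / (real J * (2 * real J)) \<le> 1 / (real J * (real J + 1))" using J by (intro divide_left_mono) auto
  ultimately show ?thesis by (simp add: power2_eq_square)
qed

text \<open>Second differences vanish on the linear part, are at most (|r(1)| + D) / N across the
  kink, and are at most 2 D / J^2 beyond it, since the step 1 / N at the point J / N gives 2 N^(-2)
  D / (J / N)^2. The last bounds sum to at most 4 D / N, and |\<mu>(1)| adds |r(1)| / N.\<close>

lemma ext1_second_differences:
  fixes r r' r'' :: "real \<Rightarrow> real" and N :: nat
  assumes N: "1 \<le> N" and D: "0 \<le> D" and der: "\<And>y. 1 \<le> y \<Longrightarrow> (r has_real_derivative r' y) (at y)" "\<And>y. 1 \<le> y \<Longrightarrow> (r' has_real_derivative r'' y) (at y)"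
    and b: "\<And>y. 1 \<le> y \<Longrightarrow> \<bar>r' y\<bar> \<le> D" "\<And>y. 1 \<le> y \<Longrightarrow> \<bar>r'' y\<bar> \<le> D / y\<^sup>2"
  defines "\<mu> \<equiv> \<lambda>j::nat. ext1 r (real j / real N)"
  shows "\<bar>\<mu> 1\<bar> + (\<Sum>j<J. \<bar>\<mu> (j + 2) - 2 * \<mu> (j + 1) + \<mu> j\<bar>) \<le> (2 * \<bar>r 1\<bar> + 5 * D) / real N"
proof -
  define E where "E = \<bar>r 1\<bar> + D"
  \<comment> \<open>A closed-form majorant of the partial sums, so that induction replaces infinite
    series. It jumps at J = N because the second difference that meets the kink is the one of index
    N - 1.\<close>
  define P where "P = (\<lambda>J. if N \<le> J then E / N + 4 * D * (1 / N - 1 / real J) else 0)"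
  have N0: "0 < real N" using N by simp
  have lo: "\<mu> j = real j / N * r 1" if "j \<le> N" for j using that N0 by (simp add: \<mu>_def ext1_def)
  have hi: "\<mu> j = r (real j / N)" if "N \<le> j" for j using that N0 by (cases "j = N") (auto simp: \<mu>_def ext1_def)
  have step: "P J + \<bar>\<mu> (J + 2) - 2 * \<mu> (J + 1) + \<mu> J\<bar> \<le> P (Suc J)" for J
  proof -
    consider "J + 2 \<le> N" | "J + 1 = N" | "N \<le> J" by linarith
    then show ?thesis
    proof cases
      case 1
      then show ?thesis by (simp add: lo P_def) (simp add: field_simps)
    next
      case 2
      have e: "real (J + 2) / N = 1 + 1 / N" "real J / N = 1 - 1 / N" "real (J + 1) / N = 1" using 2 N0 by (auto simp: field_simps)
      have "\<mu> (J + 2) - 2 * \<mu> (J + 1) + \<mu> J = (r (1 + 1 / N) - r 1) - r 1 / N"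
        using 2 hi[of "J + 2"] hi[of "J + 1"] lo[of J] unfolding e by (simp add: algebra_simps)
      moreover obtain z where z: "1 < z" "z < 1 + 1 / N" "r (1 + 1 / N) - r 1 = (1 + 1 / N - 1) * r' z"
        using MVT2[of 1 "1 + 1 / N" r r'] N0 der(1) by auto
      moreover have "\<bar>(1 + 1 / N - 1) * r' z\<bar> \<le> (1 / N) * D" using b(1)[of z] z N0 by (simp add: abs_mult divide_right_mono)
      ultimately have "\<bar>\<mu> (J + 2) - 2 * \<mu> (J + 1) + \<mu> J\<bar> \<le> (1 / N) * D + \<bar>r 1 / N\<bar>" by linarith
      also have "\<dots> = E / N" by (simp add: E_def add_divide_distrib)
      finally show ?thesis using 2 by (simp add: P_def)
    next
      case 3
      define x where "x = real J / N"
      have x: "1 \<le> x" using 3 N0 by (simp add: x_def)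
      have e: "real (J + 2) / N = x + 2 * (1 / N)" "real (J + 1) / N = x + 1 / N" by (auto simp: x_def add_divide_distrib)
      have bb: "\<bar>r'' y\<bar> \<le> D / x\<^sup>2" if "x \<le> y" for y
      proof -
        have "x\<^sup>2 \<le> y\<^sup>2" using x that by (intro power_mono) auto
        then have "D / y\<^sup>2 \<le> D / x\<^sup>2" using x D that by (intro divide_left_mono mult_pos_pos) auto
        then show ?thesis using b(2)[of y] x that by simp
      qed
      have "\<bar>r (x + 2 * (1 / N)) - 2 * r (x + 1 / N) + r x\<bar> \<le> 2 * (1 / N)\<^sup>2 * (D / x\<^sup>2)"
        using x by (intro second_difference_bound[where r' = r' and r'' = r''] der bb) (use N0 in auto)
      also have "\<dots> = 2 * D / (real J)\<^sup>2" using N0 3 by (simp add: x_def power_divide field_simps)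
      also have "\<dots> \<le> 4 * D * (1 / real J - 1 / real (Suc J))"
      proof -
        have J: "0 < real J" using 3 N by simp
        have sq: "1 / (real J)\<^sup>2 \<le> 2 * (1 / real J - 1 / real (Suc J))"
          by (rule inverse_square_telescope) (use 3 N in auto)
        have g: "2 * D * (2 * A) = 4 * D * A" for A by simp
        have "2 * D * (1 / (real J)\<^sup>2) \<le> 2 * D * (2 * (1 / real J - 1 / real (Suc J)))" using D by (intro mult_left_mono sq) auto
        then show ?thesis unfolding g by (simp only: times_divide_eq_right mult_1_right)
      qed
      finally have "\<bar>\<mu> (J + 2) - 2 * \<mu> (J + 1) + \<mu> J\<bar> \<le> 4 * D * (1 / real J - 1 / real (Suc J))"
        using 3 hi[of "J + 2"] hi[of "J + 1"] hi[of J] unfolding e by (simp add: x_def)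
      then show ?thesis using 3 by (simp add: P_def algebra_simps)
    qed
  qed
  have "(\<Sum>j<J. \<bar>\<mu> (j + 2) - 2 * \<mu> (j + 1) + \<mu> j\<bar>) \<le> P J"
  proof (induction J)
    case 0 then show ?case using N by (simp add: P_def)
  next
    case (Suc J) then show ?case using step[of J] by simp
  qed
  also have "P J \<le> (E + 4 * D) / N" 
  proof -
    have "4 * D * (1 / N - 1 / real J) \<le> 4 * D * (1 / N)" using D by (intro mult_left_mono) auto
    moreover have "0 \<le> E" "0 \<le> (E + 4 * D) / N" using D by (auto simp: E_def)
    ultimately show ?thesis by (auto simp: P_def add_divide_distrib)
  qed
  finally have "(\<Sum>j<J. \<bar>\<mu> (j + 2) - 2 * \<mu> (j + 1) + \<mu> j\<bar>) \<le> (E + 4 * D) / N" .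
  moreover have "\<bar>\<mu> 1\<bar> = \<bar>r 1\<bar> / N" using lo[of 1] N by (simp add: abs_mult)
  ultimately show ?thesis by (simp add: E_def add_divide_distrib)
qed

text \<open>The linear part contributes at most N terms of size D, and the tail terms D N^2 / j^2
  sum to at most 2 D N.\<close>

lemma ext1_sum:
  fixes r :: "real \<Rightarrow> real" and N :: nat
  assumes N: "1 \<le> N" and D: "0 \<le> D" and b: "\<And>y. 1 \<le> y \<Longrightarrow> \<bar>r y\<bar> \<le> D / y\<^sup>2"
  defines "\<mu> \<equiv> \<lambda>j::nat. ext1 r (real j / real N)"
  shows "(\<Sum>j<J. \<bar>\<mu> j\<bar>) \<le> 4 * D * real N"
proof -
  have N0: "0 < real N" using N by simp
  define P where "P = (\<lambda>J. if J \<le> N then real J * D else real N * D + 2 * D * (real N)\<^sup>2 * (1 / N - 1 / real J))"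
  have r1: "\<bar>r 1\<bar> \<le> D" using b[of 1] by simp
  have step: "P J + \<bar>\<mu> J\<bar> \<le> P (Suc J)" for J
  proof (cases "J < N")
    case True
    have "\<bar>\<mu> J\<bar> = real J / N * \<bar>r 1\<bar>" using True N0 by (simp add: \<mu>_def ext1_def abs_mult)
    also have "\<dots> \<le> 1 * D" using True N0 r1 by (intro mult_mono) auto
    finally show ?thesis using True by (simp add: P_def algebra_simps)
  next
    case False
    then have J: "N \<le> J" "0 < real J" using N by auto
    have "\<mu> J = r (real J / N)" using J N0 by (cases "J = N") (auto simp: \<mu>_def ext1_def)
    then have "\<bar>\<mu> J\<bar> \<le> D / (real J / N)\<^sup>2" using b[of "real J / N"] J N0 by simp
    also have "\<dots> = D * (real N)\<^sup>2 * (1 / (real J)\<^sup>2)" using J N0 by (simp add: power_divide field_simps)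
    also have "\<dots> \<le> D * (real N)\<^sup>2 * (2 * (1 / real J - 1 / real (Suc J)))"
    proof (intro mult_left_mono)
      show "1 / (real J)\<^sup>2 \<le> 2 * (1 / real J - 1 / real (Suc J))"
        by (rule inverse_square_telescope) (use J N in auto)
    qed (use D in auto)
    finally have "\<bar>\<mu> J\<bar> \<le> 2 * D * (real N)\<^sup>2 * (1 / real J - 1 / real (Suc J))" by (simp only: mult_ac)
    moreover have "P J = real N * D + 2 * D * (real N)\<^sup>2 * (1 / N - 1 / real J)" using J by (auto simp: P_def)
    moreover have "P (Suc J) = real N * D + 2 * D * (real N)\<^sup>2 * (1 / N - 1 / real (Suc J))" using J by (simp add: P_def)
    ultimately show ?thesis by (simp add: right_diff_distrib)
  qed
  have "(\<Sum>j<J. \<bar>\<mu> j\<bar>) \<le> P J"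
  proof (induction J)
    case 0 then show ?case by (simp add: P_def)
  next
    case (Suc J) then show ?case using step[of J] by simp
  qed
  also have "P J \<le> 4 * D * N"
  proof (cases "J \<le> N")
    case True
    then have "real J * D \<le> real N * D" using D by (intro mult_right_mono) auto
    also have "\<dots> \<le> 4 * D * N" using D N0 by simp
    finally show ?thesis using True by (simp add: P_def)
  next
    case False
    have "2 * D * (real N)\<^sup>2 * (1 / N - 1 / real J) \<le> 2 * D * (real N)\<^sup>2 * (1 / N)" using D by (intro mult_left_mono) auto
    also have "\<dots> = 2 * D * N" using N0 by (simp add: power2_eq_square)
    finally have "P J \<le> real N * D + 2 * D * N" using False by (simp add: P_def)
    moreover have "0 \<le> D * real N" using D by simp
    moreover have "real N * D = D * real N" "2 * D * N = 2 * (D * real N)" "4 * D * N = 4 * (D * real N)" by simp_all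
    ultimately show ?thesis by linarith
  qed
  finally show ?thesis .
qed

subsection \<open>Fractional differences\<close>

text \<open>For j \<ge> k the absolute value c(j) of the coefficient satisfies k c(j) = j c(j) - (j
  + 1) c(j + 1), so the sums telescope and are bounded by a single term.\<close>

lemma summable_abs_gbinomial:
  fixes k :: real assumes k: "0 < k"
  shows "summable (\<lambda>j. \<bar>k gchoose j\<bar>)"
proof -
  define m where "m = nat \<lceil>k\<rceil>"
  have m: "k \<le> real m" by (simp add: m_def real_nat_ceiling_ge)
  define c where "c = (\<lambda>j. \<bar>k gchoose j\<bar>)"
  have rec: "k * c j = real j * c j - real (Suc j) * c (Suc j)" if "m \<le> j" for j
  proof -
    have kj: "k \<le> real j" using m that by linarith
    have "real (Suc j) * (k gchoose Suc j) = (k - real j) * (k gchoose j)"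
      using gbinomial_mult_1[of k j] by (simp add: algebra_simps)
    then have "\<bar>real (Suc j) * (k gchoose Suc j)\<bar> = \<bar>(k - real j) * (k gchoose j)\<bar>" by simp
    then have "real (Suc j) * c (Suc j) = (real j - k) * c j"
      unfolding c_def abs_mult using kj by simp
    then show ?thesis by (simp add: algebra_simps)
  qed
  have part: "k * (\<Sum>j<J. c (j + m)) = real m * c m - real (J + m) * c (J + m)" for J
  proof (induction J)
    case (Suc J)
    then show ?case using rec[of "J + m"] by (simp add: distrib_left)
  qed simp
  have "summable (\<lambda>j. c (j + m))"
  proof (rule summableI_nonneg_bounded)
    show "(\<Sum>j<J. c (j + m)) \<le> real m * c m / k" for J
    proof -
      have "0 \<le> real (J + m) * c (J + m)" by (simp add: c_def)
      then have "k * (\<Sum>j<J. c (j + m)) \<le> real m * c m" using part[of J] by linarith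
      then show ?thesis using k by (simp add: field_simps)
    qed
  qed (simp add: c_def)
  then have "summable c" by (subst (asm) summable_iff_shift)
  then show ?thesis by (simp add: c_def)
qed

text \<open>Strictness is what matters: it makes the binomial series converge at every frequency m
  \<ge> 1 and keeps 1 - s positive. For y \<le> 1 it comes from the half-angle formula, where cos (y
  / 2) < 1.\<close>

lemma abs_sinc_less_1:
  fixes y :: real assumes "0 < y" shows "\<bar>sin y / y\<bar> < 1"
proof -
  have "\<bar>sin y\<bar> < y"
  proof (cases "y \<le> 1")
    case True
    then have "0 \<le> sin y" using assms pi_gt3 by (intro sin_ge_zero) auto
    moreover have "0 < sin (y / 2)" using True assms pi_gt3 by (intro sin_gt_zero) auto
    moreover have "cos (y / 2) < 1" using cos_monotone_0_pi[of 0 "y / 2"] True assms pi_gt3 by simp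
    ultimately have "sin (y / 2) * cos (y / 2) < sin (y / 2) * 1" by (intro mult_strict_left_mono)
    then have "sin y < 2 * sin (y / 2)" using sin_double[of "y / 2"] by simp
    also have "\<dots> \<le> 2 * (y / 2)" using sin_x_le_x[of "y / 2"] assms by simp
    finally show ?thesis using \<open>0 \<le> sin y\<close> by simp
  next
    case False
    then show ?thesis using abs_sin_le_one[of y] by linarith
  qed
  then show ?thesis using assms by simp
qed

lemma rconv_rbox_bound:
  assumes h: "0 < h" and [measurable]: "u \<in> borel_measurable borel" and b: "\<And>x. \<bar>u x\<bar> \<le> M"
  shows "\<bar>rconv (rbox h) u x\<bar> \<le> M"
proof -
  have M: "0 \<le> M" using b[of 0] by linarith
  have "ennreal \<bar>rconv (rbox h) u x\<bar> \<le> nconv (\<lambda>t. ennreal \<bar>rbox h t\<bar>) (\<lambda>x. ennreal \<bar>u x\<bar>) x"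
    by (rule rconv_le_nconv)
  also have "\<dots> \<le> (\<integral>\<^sup>+t. boxk h t * ennreal M \<partial>lborel)"
    unfolding nconv_def abs_rbox[OF h] by (intro nn_integral_mono mult_left_mono ennreal_leI b) auto
  also have "\<dots> = ennreal M" using h by (simp add: nn_integral_multc nn_integral_box)
  finally show ?thesis using M by simp
qed

text \<open>One average turns an integrable function into a bounded one. The cost 1 / h affects only
  the convergence of the binomial series and no constant of the final estimate.\<close>

lemma rconv_rbox_L1_bound:
  assumes h: "0 < h" "h \<le> 1" and f: "L1 f"
  shows "\<bar>rconv (rbox h) f x\<bar> \<le> enn2real (ennreal (1 / h) * tint (\<lambda>x. ennreal \<bar>f x\<bar>))"
proof -
  have [measurable]: "f \<in> borel_measurable borel" and fp: "periodic2pi f" using f by (auto simp: L1_def)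
  have per: "periodic2pi (\<lambda>x. ennreal \<bar>f x\<bar>)" using fp by (simp add: periodic2pi_def)
  have fin: "tint (\<lambda>x. ennreal \<bar>f x\<bar>) < \<infinity>" using f fp by (simp add: L1_iff_tint)
  have "ennreal \<bar>rconv (rbox h) f x\<bar> \<le> nconv (\<lambda>t. ennreal \<bar>rbox h t\<bar>) (\<lambda>x. ennreal \<bar>f x\<bar>) x"
    by (rule rconv_le_nconv)
  also have "\<dots> = ennreal (1 / h) * (\<integral>\<^sup>+y. ennreal \<bar>f y\<bar> * indicator {x - h / 2..x + h / 2} y \<partial>lborel)"
    unfolding abs_rbox[OF h(1)] by (rule nconv_box_eq) measurable
  \<comment> \<open>The window has length h \<le> 1 < 2 pi and fits into one period.\<close>
  also have "\<dots> \<le> ennreal (1 / h) * (\<integral>\<^sup>+y. ennreal \<bar>f y\<bar> * indicator {x - h / 2..<x - h / 2 + 2 * pi} y \<partial>lborel)"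
    using h pi_gt3 by (intro mult_left_mono nn_integral_mono) (auto split: split_indicator)
  also have "\<dots> = ennreal (1 / h) * tint (\<lambda>x. ennreal \<bar>f x\<bar>)" by (simp add: tint_any_period per)
  finally have "ennreal \<bar>rconv (rbox h) f x\<bar> \<le> ennreal (1 / h) * tint (\<lambda>x. ennreal \<bar>f x\<bar>)" .
  moreover have "ennreal (1 / h) * tint (\<lambda>x. ennreal \<bar>f x\<bar>) < \<infinity>" using fin by (simp add: ennreal_mult_less_top)
  ultimately show ?thesis by (metis abs_ge_zero enn2real_ennreal enn2real_mono infinity_ennreal_def)
qed

text \<open>Uniform summability justifies integrating term by term over the period, which has finite
  measure.\<close>

lemma fc_bounded_series:
  fixes u :: "nat \<Rightarrow> real \<Rightarrow> real"
  assumes [measurable]: "\<And>j. u j \<in> borel_measurable borel" and per: "\<And>j. periodic2pi (u j)" 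
    and b: "\<And>j x. \<bar>u j x\<bar> \<le> d j" and d: "summable d"
  shows "L1 (\<lambda>x. \<Sum>j. u j x)" "(\<lambda>j. fc (u j) m) sums fc (\<lambda>x. \<Sum>j. u j x) m"
proof -
  have su: "summable (\<lambda>j. \<bar>u j x\<bar>)" for x by (rule summable_comparison_test'[OF d, of 0]) (use b in auto)
  have bb: "\<bar>\<Sum>j. u j x\<bar> \<le> (\<Sum>j. d j)" for x
    using summable_rabs[OF su[of x]] suminf_le[OF b su d] by (rule order_trans)
  show "L1 (\<lambda>x. \<Sum>j. u j x)"
    by (rule L1_bounded[OF _ _ bb]) (use per in \<open>auto simp: periodic2pi_def\<close>)
  have ui: "integrable torusM (\<lambda>x. complex_of_real (u j x) * cis (- (real m * x)))" for j
    by (rule integrable_fc) (use L1_bounded[OF _ per b] in \<open>auto simp: L1_def\<close>)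
  have nb: "norm (complex_of_real (u j x) * cis (- (real m * x))) \<le> d j" for j x using b by (simp add: norm_mult)
  have eq: "fc (\<lambda>x. \<Sum>j. u j x) m = (\<integral>x. (\<Sum>j. complex_of_real (u j x) * cis (- (real m * x))) \<partial>torusM)"
    unfolding fc_def
  proof (rule Bochner_Integration.integral_cong[OF refl])
    fix x
    have "(\<lambda>j. complex_of_real (u j x)) sums of_real (\<Sum>j. u j x)"
      by (rule sums_of_real[OF summable_sums[OF summable_rabs_cancel[OF su]]])
    then have "(\<lambda>j. complex_of_real (u j x) * cis (- (real m * x))) sums (of_real (\<Sum>j. u j x) * cis (- (real m * x)))"
      by (rule sums_mult2)
    then show "of_real (\<Sum>j. u j x) * cis (- (real m * x)) = (\<Sum>j. complex_of_real (u j x) * cis (- (real m * x)))"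
      by (simp add: sums_iff)
  qed
  show "(\<lambda>j. fc (u j) m) sums fc (\<lambda>x. \<Sum>j. u j x) m"
    unfolding eq unfolding fc_def
  proof (rule sums_integral)
    show "AE x in torusM. summable (\<lambda>j. norm (complex_of_real (u j x) * cis (- (real m * x))))"
      by (intro AE_I2 summable_comparison_test'[OF d, of 0]) (use nb in auto)
    show "summable (\<lambda>j. \<integral>x. norm (complex_of_real (u j x) * cis (- (real m * x))) \<partial>torusM)"
    proof (rule summable_comparison_test'[of "\<lambda>j. 2 * pi * d j" 0])
      show "summable (\<lambda>j. 2 * pi * d j)" by (intro summable_mult d)
      fix j
      have "(\<integral>x. norm (complex_of_real (u j x) * cis (- (real m * x))) \<partial>torusM) \<le> (\<integral>t. d j \<partial>torusM)"
        by (intro integral_mono integrable_norm ui finite_measure.integrable_const[OF finite_measure_torusM] nb)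
      also have "\<dots> = 2 * pi * d j" by (simp add: measure_def emeasure_torusM)
      finally show "norm (\<integral>x. norm (complex_of_real (u j x) * cis (- (real m * x))) \<partial>torusM) \<le> 2 * pi * d j"
        by simp
    qed
  qed (rule ui)
qed

context orlicz_weight
begin

text \<open>Integrability of the version is the embedding into L^1 and gives its Fourier
  coefficients their meaning. The dilation c with finite modular is returned as well, for the
  perturbation argument below.\<close>

lemma orlicz_space_version:
  assumes w: "AE x in lborel. w x = W x" and f: "f \<in> orlicz_space \<phi> w"
  obtains f0 c where "L1 f0" "AE x in lborel. f x = f0 x" "0 < c" "tint (\<lambda>x. ennreal (\<phi> (c * \<bar>f0 x\<bar>) * W x)) < \<infinity>"
proof -
  have fm: "f \<in> borel_measurable lebesgue" "periodic2pi f" using f by (auto simp: orlicz_space_def periodic_iff_periodic2pi)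
  obtain c where c: "0 < c" "tint (\<lambda>x. ennreal (\<phi> (c * \<bar>f x\<bar>) * w x)) < \<infinity>"
    using f by (auto simp: orlicz_space_def nn_integral_lebesgue_on_torus)
  obtain f0 where f0 [measurable]: "f0 \<in> borel_measurable borel" "periodic2pi f0" and ae: "AE x in lborel. f x = f0 x"
    using periodic_borel_version[OF fm] by blast
  have "tint (\<lambda>x. ennreal (\<phi> (c * \<bar>f x\<bar>) * w x)) = tint (\<lambda>x. ennreal (\<phi> (c * \<bar>f0 x\<bar>) * W x))"
    by (rule tint_cong_AE) (use ae w in eventually_elim, simp)
  with c have fin: "tint (\<lambda>x. ennreal (\<phi> (c * \<bar>f0 x\<bar>) * W x)) < \<infinity>" by simp
  obtain b where b: "b > 0" "\<And>F. F \<in> borel_measurable borel \<Longrightarrow> ennreal b * tint F \<le> Nn F" using embedding_L1 by blast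
  have "ennreal b * tint (\<lambda>x. ennreal \<bar>f0 x\<bar>) < \<infinity>"
    using b(2)[of "\<lambda>x. ennreal \<bar>f0 x\<bar>"] Nn_finite[OF f0(1) c(1) fin] by (auto intro: le_less_trans)
  then have "tint (\<lambda>x. ennreal \<bar>f0 x\<bar>) < \<infinity>" using b(1) by (auto simp: ennreal_mult_less_top)
  then have "L1 f0" using f0 by (simp add: L1_iff_tint)
  then show ?thesis using that ae c(1) fin by blast
qed

text \<open>|G| \<le> 2 max(|f0|, M), and halving the dilation c removes the factor 2; monotonicity
  of \<phi> does the rest. It puts the explicit sum of the binomial series into the space.\<close>

lemma orlicz_space_bounded_perturbation:
  assumes w: "AE x in lborel. w x = W x" and G [measurable]: "G \<in> borel_measurable borel" and Gp: "periodic2pi G"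
    and f [measurable]: "f0 \<in> borel_measurable borel" and c: "0 < c" and fin: "tint (\<lambda>x. ennreal (\<phi> (c * \<bar>f0 x\<bar>) * W x)) < \<infinity>"
    and b: "\<And>x. \<bar>G x - f0 x\<bar> \<le> M"
  shows "G \<in> orlicz_space \<phi> w"
proof -
  have M: "0 \<le> M" using b[of 0] by linarith
  have "tint (\<lambda>x. ennreal (\<phi> (c / 2 * \<bar>G x\<bar>) * w x)) = tint (\<lambda>x. ennreal (\<phi> (c / 2 * \<bar>G x\<bar>) * W x))"
    by (rule tint_cong_AE) (use w in eventually_elim, simp)
  also have "\<dots> \<le> tint (\<lambda>x. ennreal (\<phi> (c * \<bar>f0 x\<bar>) * W x) + ennreal (\<phi> (c * M)) * ennreal (W x))"
  proof (rule tint_mono)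
    fix x
    have "\<bar>G x\<bar> \<le> 2 * max \<bar>f0 x\<bar> M" using b[of x] by linarith
    then have "c / 2 * \<bar>G x\<bar> \<le> c / 2 * (2 * max \<bar>f0 x\<bar> M)" using c by (intro mult_left_mono) auto
    then have "c / 2 * \<bar>G x\<bar> \<le> c * max \<bar>f0 x\<bar> M" by simp
    then have "\<phi> (c / 2 * \<bar>G x\<bar>) \<le> \<phi> (c * max \<bar>f0 x\<bar> M)" using c by (intro phi_mono) auto
    also have "\<dots> \<le> \<phi> (c * \<bar>f0 x\<bar>) + \<phi> (c * M)" using phi_nonneg by (auto simp: max_def)
    finally have "\<phi> (c / 2 * \<bar>G x\<bar>) * W x \<le> \<phi> (c * \<bar>f0 x\<bar>) * W x + \<phi> (c * M) * W x"
      using W_pos[of x] by (simp add: distrib_right[symmetric])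
    then have "ennreal (\<phi> (c / 2 * \<bar>G x\<bar>) * W x) \<le> ennreal (\<phi> (c * \<bar>f0 x\<bar>) * W x + \<phi> (c * M) * W x)" by (rule ennreal_leI)
    also have "\<dots> = ennreal (\<phi> (c * \<bar>f0 x\<bar>) * W x) + ennreal (\<phi> (c * M)) * ennreal (W x)"
      using W_pos[of x] phi_nonneg by (simp add: ennreal_mult' less_imp_le)
    finally show "ennreal (\<phi> (c / 2 * \<bar>G x\<bar>) * W x) \<le> ennreal (\<phi> (c * \<bar>f0 x\<bar>) * W x) + ennreal (\<phi> (c * M)) * ennreal (W x)" .
  qed
  also have "\<dots> = tint (\<lambda>x. ennreal (\<phi> (c * \<bar>f0 x\<bar>) * W x)) + ennreal (\<phi> (c * M)) * tint (\<lambda>x. ennreal (W x))"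
    by (simp add: tint_add tint_cmult)
  also have "\<dots> < \<infinity>" using fin tint_W_finite by (simp add: ennreal_mult_less_top)
  finally show ?thesis
    using c Gp borel_imp_lebesgue[OF G]
    by (auto simp: orlicz_space_def periodic_iff_periodic2pi nn_integral_lebesgue_on_torus intro!: exI[of _ "c / 2"])
qed

text \<open>Averaging maps integrable functions to bounded ones, so all terms of the binomial series but the
  first are dominated by a multiple of the coefficients.\<close>

lemma frac_difference_lower:
  assumes w: "AE x in lborel. w x = W x" and f: "f \<in> orlicz_space \<phi> w" 
    and f0: "L1 f0" "AE x in lborel. f x = f0 x" and k: "0 < k" and h: "0 < h" "h \<le> 1"
  shows "\<exists>G. L1 G \<and> (\<forall>m\<ge>1. fc G m = of_real ((1 - sin (real m * h / 2) / (real m * h / 2)) powr k) * fc f0 m) \<and>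
     Nn (\<lambda>x. ennreal \<bar>G x\<bar>) \<le> orlicz_norm \<phi> w (frac_difference \<phi> w k h f)"
proof -
  have f0m [measurable]: "f0 \<in> borel_measurable borel" and f0p: "periodic2pi f0" using f0 by (auto simp: L1_def)
  obtain f1 c0 where f1: "L1 f1" "AE x in lborel. f x = f1 x" and c0: "0 < c0" and fin1: "tint (\<lambda>x. ennreal (\<phi> (c0 * \<bar>f1 x\<bar>) * W x)) < \<infinity>"
    using orlicz_space_version[OF w f] by blast
  have "AE x in lborel. f1 x = f0 x" using f1(2) f0(2) by eventually_elim simp
  then have "tint (\<lambda>x. ennreal (\<phi> (c0 * \<bar>f1 x\<bar>) * W x)) = tint (\<lambda>x. ennreal (\<phi> (c0 * \<bar>f0 x\<bar>) * W x))"
    by (intro tint_cong_AE) (auto elim: eventually_mono)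
  with fin1 have fin: "tint (\<lambda>x. ennreal (\<phi> (c0 * \<bar>f0 x\<bar>) * W x)) < \<infinity>" by simp
  define S where "S = rconv (rbox h)"
  define c where "c = (\<lambda>j. (- 1) ^ j * (k gchoose j))"
  have csum: "summable (\<lambda>j. \<bar>c j\<bar>)" using summable_abs_gbinomial[OF k] by (simp add: c_def abs_mult power_abs)
  define M where "M = enn2real (ennreal (1 / h) * tint (\<lambda>x. ennreal \<bar>f0 x\<bar>))"
  have M0: "0 \<le> M" by (simp add: M_def)
  have SL: "L1 ((S ^^ j) f0)" for j
    by (induction j) (auto simp: f0 S_def intro!: rconv_L1(1) rbox_integrable)
  have SLm [measurable]: "(S ^^ j) f0 \<in> borel_measurable borel" for j by (rule L1_borel[OF SL])
  have Sb: "\<bar>(S ^^ Suc j) f0 x\<bar> \<le> M" for j x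
  proof (induction j arbitrary: x)
    case 0
    then show ?case using rconv_rbox_L1_bound[OF h f0(1)] by (simp add: S_def M_def)
  next
    case (Suc j)
    have "(S ^^ Suc (Suc j)) f0 = rconv (rbox h) ((S ^^ Suc j) f0)" by (simp add: S_def)
    then show ?case using rconv_rbox_bound[OF h(1) SLm Suc] by simp
  qed
  define u where "u = (\<lambda>j x. c (Suc j) * (S ^^ Suc j) f0 x)"
  define d where "d = (\<lambda>j. \<bar>c (Suc j)\<bar> * M)"
  have dsum: "summable d" unfolding d_def using csum by (intro summable_mult2) (subst summable_Suc_iff)
  have um [measurable]: "u j \<in> borel_measurable borel" for j
    using borel_measurable_times[OF borel_measurable_const SLm[of "Suc j"], of "c (Suc j)"] by (simp add: u_def)
  have up: "periodic2pi (u j)" for j using SL[of "Suc j"] by (auto simp: u_def L1_def periodic2pi_def)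
  have ub: "\<bar>u j x\<bar> \<le> d j" for j x unfolding u_def d_def abs_mult by (intro mult_left_mono Sb) auto
  note ser = fc_bounded_series[OF um up ub dsum]
  have usum: "summable (\<lambda>j. \<bar>u j x\<bar>)" for x by (rule summable_comparison_test'[OF dsum, of 0]) (use ub in auto)
  \<comment> \<open>The candidate limit: f0 plus a uniformly convergent series of bounded
    functions.\<close>
  define G where "G = (\<lambda>x. f0 x + (\<Sum>j. u j x))"
  have GL: "L1 G" unfolding G_def by (rule L1_add[OF f0(1) ser(1)])
  have Gm [measurable]: "G \<in> borel_measurable borel" by (rule L1_borel[OF GL])
  have Gf: "\<bar>G x - f0 x\<bar> \<le> (\<Sum>j. d j)" for x
    using summable_rabs[OF usum[of x]] suminf_le[OF ub usum dsum] unfolding G_def by (simp add: order_trans)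
  have G_orl: "G \<in> orlicz_space \<phi> w"
    by (rule orlicz_space_bounded_perturbation[OF w Gm _ f0m c0 fin Gf]) (use GL in \<open>simp add: L1_def\<close>)
  have fcS: "fc ((S ^^ j) f0) m = of_real ((sin (real m * h / 2) / (real m * h / 2)) ^ j) * fc f0 m" if "1 \<le> m" for j m
  proof (induction j)
    case (Suc j)
    have "fc ((S ^^ Suc j) f0) m = kc (rbox h) m * fc ((S ^^ j) f0) m"
      using rconv_L1(2)[OF rbox_integrable SL[of j]] by (simp add: S_def)
    then show ?case using Suc kc_rbox[OF h(1) that] by (simp add: mult.assoc)
  qed simp
  have fcG: "fc G m = of_real ((1 - sin (real m * h / 2) / (real m * h / 2)) powr k) * fc f0 m" if m: "1 \<le> m" for m
  proof -
    define s where "s = sin (real m * h / 2) / (real m * h / 2)"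
    have s: "\<bar>s\<bar> < 1" unfolding s_def using m h by (intro abs_sinc_less_1) simp
    have "fc (u j) m = of_real (c (Suc j) * s ^ Suc j) * fc f0 m" for j
      unfolding u_def fc_cmult fcS[OF m] s_def by simp
    then have "(\<lambda>j. complex_of_real (c (Suc j) * s ^ Suc j) * fc f0 m) sums fc (\<lambda>x. \<Sum>j. u j x) m"
      using ser(2)[of m] by simp
    moreover have "(\<lambda>j. complex_of_real (c (Suc j) * s ^ Suc j) * fc f0 m) sums (of_real ((1 - s) powr k - 1) * fc f0 m)"
    proof (intro sums_mult2 sums_of_real)
      have "(\<lambda>j. (k gchoose j) * (- s) ^ j) sums (1 + - s) powr k" using s by (intro gen_binomial_real) simp
      then have "(\<lambda>j. (k gchoose (Suc j)) * (- s) ^ (Suc j)) sums ((1 + - s) powr k - (k gchoose 0) * (- s) ^ 0)"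
        by (subst sums_Suc_iff) simp
      moreover have "(k gchoose (Suc j)) * (- s) ^ (Suc j) = c (Suc j) * s ^ Suc j" for j
        unfolding c_def power_minus[of s] by (simp only: mult_ac)
      ultimately show "(\<lambda>j. c (Suc j) * s ^ Suc j) sums ((1 - s) powr k - 1)" by simp
    qed
    ultimately have "fc (\<lambda>x. \<Sum>j. u j x) m = of_real ((1 - s) powr k - 1) * fc f0 m" by (rule sums_unique2)
    then show ?thesis
      unfolding G_def fc_add[OF f0(1) ser(1)] s_def[symmetric] by (simp add: left_diff_distrib)
  qed
  define P where "P = (\<lambda>N x. \<Sum>j<N. (- 1) ^ j * (k gchoose j) * (steklov h ^^ j) f x)"
  define P0 where "P0 = (\<lambda>N x. \<Sum>j<N. c j * (S ^^ j) f0 x)"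
  have P0m [measurable]: "P0 N \<in> borel_measurable borel" for N unfolding P0_def by measurable
  \<comment> \<open>From the first average on the iterates of both versions agree at every point;
    only the term of index 0 sees the exceptional null set.\<close>
  have st: "(steklov h ^^ Suc j) f = (S ^^ Suc j) f0" for j
  proof (induction j)
    case 0
    then show ?case using steklov_eq_rconv[OF f0(2) f0m] by (auto simp: S_def)
  next
    case (Suc j)
    have "(steklov h ^^ Suc (Suc j)) f = steklov h ((S ^^ Suc j) f0)" using Suc by simp
    also have "\<dots> = rconv (rbox h) ((S ^^ Suc j) f0)"
      by (rule ext, rule steklov_eq_rconv[OF _ SLm]) simp
    finally show ?case by (simp add: S_def)
  qed
  have PP0: "AE x in lborel. P N x = P0 N x" for N
    using f0(2)
  proof eventually_elim
    case (elim x)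
    have "(steklov h ^^ j) f x = (S ^^ j) f0 x" for j using elim st by (cases j) (simp, simp only:)
    then show ?case by (simp add: P_def P0_def c_def)
  qed
  \<comment> \<open>\<open>P0 (Suc N)\<close> consists of f0 and the first N terms of the series,
    hence the shift in the index.\<close>
  have tail: "\<bar>P0 (Suc N) x - G x\<bar> \<le> (\<Sum>j. d (j + N))" for N x
  proof -
    have "P0 (Suc N) x = f0 x + (\<Sum>j<N. u j x)"
      unfolding P0_def by (subst sum.lessThan_Suc_shift) (simp add: c_def u_def)
    moreover have "(\<Sum>j. u j x) = (\<Sum>j. u (j + N) x) + (\<Sum>j<N. u j x)"
      by (rule suminf_split_initial_segment[OF summable_rabs_cancel[OF usum]])
    ultimately have "P0 (Suc N) x - G x = - (\<Sum>j. u (j + N) x)" by (simp add: G_def)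
    moreover have s1: "summable (\<lambda>j. \<bar>u (j + N) x\<bar>)" using usum by (subst summable_iff_shift)
    have "summable (\<lambda>j. d (j + N))" using dsum by (subst summable_iff_shift)
    then have "(\<Sum>j. \<bar>u (j + N) x\<bar>) \<le> (\<Sum>j. d (j + N))" by (intro suminf_le ub s1)
    with summable_rabs[OF s1] have "\<bar>\<Sum>j. u (j + N) x\<bar> \<le> (\<Sum>j. d (j + N))" by simp
    ultimately show ?thesis by simp
  qed
  define e where "e = (\<lambda>N. \<Sum>j. d (j + N))"
  have e0: "e \<longlonglongrightarrow> 0" unfolding e_def by (rule suminf_exist_split2[OF dsum])
  have epos: "0 \<le> e N" for N using tail[of N 0] unfolding e_def by linarith
  have NnPG: "Nn (\<lambda>x. ennreal \<bar>P0 (Suc N) x - G x\<bar>) \<le> ennreal (e N) * Nn (\<lambda>x. ennreal 1)" for N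
  proof -
    have "Nn (\<lambda>x. ennreal \<bar>P0 (Suc N) x - G x\<bar>) \<le> Nn (\<lambda>x. ennreal (e N) * ennreal 1)"
      using tail unfolding e_def by (intro Nn_mono) (simp add: ennreal_leI)
    also have "\<dots> \<le> ennreal (e N) * Nn (\<lambda>x. ennreal 1)" by (rule Nn_cmult) simp
    finally show ?thesis .
  qed
  have conv0: "(\<lambda>N. ennreal (e N) * Nn (\<lambda>x. ennreal 1)) \<longlonglongrightarrow> 0"
  proof -
    obtain r where r: "Nn (\<lambda>x. ennreal 1) = ennreal r" "0 \<le> r"
      using Nn_const_finite[of 1] by (cases "Nn (\<lambda>x. ennreal 1)") auto
    have "(\<lambda>N. ennreal (e N * r)) \<longlonglongrightarrow> ennreal (0 * r)" by (intro tendsto_ennrealI tendsto_mult_right e0)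
    then show ?thesis using r epos by (simp add: ennreal_mult)
  qed
  have PG: "orlicz_norm \<phi> w (\<lambda>x. P N x - G x) = Nn (\<lambda>x. ennreal \<bar>P0 N x - G x\<bar>)" for N
    by (rule orlicz_norm_eq_Nn[OF w]) (use PP0[of N] in eventually_elim, simp)
  have convG: "(\<lambda>N. Nn (\<lambda>x. ennreal \<bar>P0 N x - G x\<bar>)) \<longlonglongrightarrow> 0"
  proof (rule LIMSEQ_imp_Suc, rule tendsto_sandwich[OF _ _ tendsto_const conv0])
    show "\<forall>\<^sub>F N in sequentially. Nn (\<lambda>x. ennreal \<bar>P0 (Suc N) x - G x\<bar>) \<le> ennreal (e N) * Nn (\<lambda>x. ennreal 1)"
      using NnPG by simp
  qed simp
  define g where "g = frac_difference \<phi> w k h f"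
  define Q where "Q = (\<lambda>g. g \<in> orlicz_space \<phi> w \<and> (\<lambda>N. orlicz_norm \<phi> w (\<lambda>x. P N x - g x)) \<longlonglongrightarrow> 0)"
  have "Q G" unfolding Q_def using G_orl convG by (simp add: PG)
  moreover have "g = (SOME g. Q g)" unfolding g_def frac_difference_def Q_def P_def ..
  \<comment> \<open>\<open>frac_difference\<close> selects some limit by choice; the existence of G
    guarantees that the selected g is a limit as well.\<close>
  ultimately have "Q g" by (simp add: someI)
  then have g: "g \<in> orlicz_space \<phi> w \<and> (\<lambda>N. orlicz_norm \<phi> w (\<lambda>x. P N x - g x)) \<longlonglongrightarrow> 0"
    unfolding Q_def .
  obtain g0 where g0: "L1 g0" "AE x in lborel. g x = g0 x"
    using orlicz_space_version[OF w conjunct1[OF g]] by blast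
  have g0m [measurable]: "g0 \<in> borel_measurable borel" by (rule L1_borel[OF g0(1)])
  have Pg: "orlicz_norm \<phi> w (\<lambda>x. P N x - g x) = Nn (\<lambda>x. ennreal \<bar>P0 N x - g0 x\<bar>)" for N
    by (rule orlicz_norm_eq_Nn[OF w]) (use PP0[of N] g0(2) in eventually_elim, simp)
  have convg: "(\<lambda>N. Nn (\<lambda>x. ennreal \<bar>P0 N x - g0 x\<bar>)) \<longlonglongrightarrow> 0" using conjunct2[OF g] by (simp add: Pg)
  \<comment> \<open>G and the selected limit are compared through the partial sums; the last two
    terms vanish as N grows.\<close>
  have tri: "Nn (\<lambda>x. ennreal \<bar>G x\<bar>) \<le> Nn (\<lambda>x. ennreal \<bar>g0 x\<bar>) + (Nn (\<lambda>x. ennreal \<bar>P0 N x - G x\<bar>) + Nn (\<lambda>x. ennreal \<bar>P0 N x - g0 x\<bar>))" for N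
  proof -
    have "Nn (\<lambda>x. ennreal \<bar>G x\<bar>) \<le> Nn (\<lambda>x. ennreal \<bar>g0 x\<bar> + (ennreal \<bar>P0 N x - G x\<bar> + ennreal \<bar>P0 N x - g0 x\<bar>))"
    proof (rule Nn_mono)
      fix x
      have "\<bar>G x\<bar> \<le> \<bar>g0 x\<bar> + (\<bar>P0 N x - G x\<bar> + \<bar>P0 N x - g0 x\<bar>)" by linarith
      then have "ennreal \<bar>G x\<bar> \<le> ennreal (\<bar>g0 x\<bar> + (\<bar>P0 N x - G x\<bar> + \<bar>P0 N x - g0 x\<bar>))" by (rule ennreal_leI)
      then show "ennreal \<bar>G x\<bar> \<le> ennreal \<bar>g0 x\<bar> + (ennreal \<bar>P0 N x - G x\<bar> + ennreal \<bar>P0 N x - g0 x\<bar>)" by simp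
    qed
    also have "\<dots> \<le> Nn (\<lambda>x. ennreal \<bar>g0 x\<bar>) + Nn (\<lambda>x. ennreal \<bar>P0 N x - G x\<bar> + ennreal \<bar>P0 N x - g0 x\<bar>)"
      by (rule Nn_add) measurable
    also have "\<dots> \<le> Nn (\<lambda>x. ennreal \<bar>g0 x\<bar>) + (Nn (\<lambda>x. ennreal \<bar>P0 N x - G x\<bar>) + Nn (\<lambda>x. ennreal \<bar>P0 N x - g0 x\<bar>))"
      by (intro add_left_mono Nn_add) measurable
    finally show ?thesis .
  qed
  have "(\<lambda>N. Nn (\<lambda>x. ennreal \<bar>g0 x\<bar>) + (Nn (\<lambda>x. ennreal \<bar>P0 N x - G x\<bar>) + Nn (\<lambda>x. ennreal \<bar>P0 N x - g0 x\<bar>))) \<longlonglongrightarrow> Nn (\<lambda>x. ennreal \<bar>g0 x\<bar>) + (0 + 0)"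
    by (intro tendsto_add tendsto_const convG convg)
  then have "Nn (\<lambda>x. ennreal \<bar>G x\<bar>) \<le> Nn (\<lambda>x. ennreal \<bar>g0 x\<bar>) + (0 + 0)"
    by (rule LIMSEQ_le_const) (use tri in auto)
  also have "\<dots> = orlicz_norm \<phi> w g" using orlicz_norm_eq_Nn[OF w g0(2)] by simp
  finally show ?thesis using GL fcG unfolding g_def by blast
qed

end

subsection \<open>Inversion of the fractional difference\<close>

text \<open>Compactness on [1, 4], and the trivial bound 2 / x \<le> 1 / 2 beyond 4. A bound uniform
  in x keeps 1 - s away from 0.\<close>

lemma sinc_bound_ge_1: "\<exists>s0. 0 < s0 \<and> s0 < 1 \<and> (\<forall>x\<ge>1::real. \<bar>2 * sin (x / 2) / x\<bar> \<le> s0)"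
proof -
  have ne: "{1..4::real} \<noteq> {}" by simp
  have c: "continuous_on {1..4} (\<lambda>x::real. \<bar>2 * sin (x / 2) / x\<bar>)" by (intro continuous_intros) auto
  obtain y :: real where y: "y \<in> {1..4}" "\<forall>x\<in>{1..4}. \<bar>2 * sin (x / 2) / x\<bar> \<le> \<bar>2 * sin (y / 2) / y\<bar>"
    using continuous_attains_sup[OF compact_Icc ne c] by blast
  have "\<bar>sin (y / 2) / (y / 2)\<bar> < 1" using y by (intro abs_sinc_less_1) auto
  then have y1: "\<bar>2 * sin (y / 2) / y\<bar> < 1" by (simp add: mult.commute)
  define s0 where "s0 = max (1 / 2) \<bar>2 * sin (y / 2) / y\<bar>"
  have "\<bar>2 * sin (x / 2) / x\<bar> \<le> s0" if "1 \<le> x" for x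
  proof (cases "x \<le> 4")
    case True
    then show ?thesis using bspec[OF y(2), of x] that by (simp add: s0_def)
  next
    case False
    have "\<bar>2 * sin (x / 2) / x\<bar> = 2 * \<bar>sin (x / 2)\<bar> / x" using that by (simp add: abs_mult)
    also have "\<dots> \<le> 2 * 1 / 4" using False by (intro frac_le mult_left_mono) auto
    finally show ?thesis by (simp add: s0_def)
  qed
  then show ?thesis using y1 by (intro exI[of _ s0]) (auto simp: s0_def)
qed

text \<open>R(z) = (1 - z)^(-k) - 1 - k z vanishes to second order at 0, so R, R' and R'' are of
  order z^2, z and 1 on |z| \<le> s0, while s and its first two derivatives are of order 1 / x.
  Hence r and r'' = R''(s) s'^2 + R'(s) s'' are both of order 1 / x^2.\<close>

lemma inverse_power_symbol:
  fixes k :: real assumes k: "0 < k"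
  defines "s \<equiv> \<lambda>x::real. 2 * sin (x / 2) / x"
  defines "r \<equiv> \<lambda>x. (1 - s x) powr (- k) - 1 - k * s x"
  shows "\<exists>D r' r''. 0 \<le> D \<and> (\<forall>y\<ge>1. (r has_real_derivative r' y) (at y)) \<and> (\<forall>y\<ge>1. (r' has_real_derivative r'' y) (at y)) \<and>
     (\<forall>y\<ge>1. \<bar>r y\<bar> \<le> D / y\<^sup>2 \<and> \<bar>r' y\<bar> \<le> D \<and> \<bar>r'' y\<bar> \<le> D / y\<^sup>2)"
proof -
  obtain s0 where s0: "0 < s0" "s0 < 1" "\<And>x. 1 \<le> x \<Longrightarrow> \<bar>s x\<bar> \<le> s0"
    using sinc_bound_ge_1 unfolding s_def by blast
  define R where "R = (\<lambda>s::real. (1 - s) powr (- k) - 1 - k * s)"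
  define R1 where "R1 = (\<lambda>s::real. k * (1 - s) powr (- k - 1) - k)"
  define R2 where "R2 = (\<lambda>s::real. k * (k + 1) * (1 - s) powr (- k - 2))"
  have dR: "(R has_real_derivative R1 z) (at z)" if "z < 1" for z
    unfolding R_def R1_def using that by (auto intro!: derivative_eq_intros DERIV_fun_powr)
  have dR1: "(R1 has_real_derivative R2 z) (at z)" if "z < 1" for z
    unfolding R1_def R2_def using that by (auto intro!: derivative_eq_intros DERIV_fun_powr simp: algebra_simps)
  define M where "M = k * (k + 1) * (1 - s0) powr (- k - 2)"
  have M: "0 \<le> M" using k by (simp add: M_def)
  have bR2: "\<bar>R2 z\<bar> \<le> M" if "\<bar>z\<bar> \<le> s0" for z
  proof -
    have "(1 - z) powr (- k - 2) \<le> (1 - s0) powr (- k - 2)" using that s0(1,2) k by (intro powr_mono2') auto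
    then show ?thesis using k by (simp add: R2_def M_def abs_mult mult_left_mono)
  qed
  have bR1: "\<bar>R1 z\<bar> \<le> M * \<bar>z\<bar>" if z: "\<bar>z\<bar> \<le> s0" for z
  proof -
    have "norm (R1 z - R1 0) \<le> M * norm (z - 0)"
    proof (rule field_differentiable_bound[of "{-s0..s0}"])
      show "(R1 has_field_derivative R2 x) (at x within {-s0..s0})" if "x \<in> {-s0..s0}" for x
        by (rule has_field_derivative_at_within[OF dR1]) (use that s0(1,2) in auto)
      show "norm (R2 x) \<le> M" if "x \<in> {-s0..s0}" for x using bR2[of x] that by auto
    qed (use z s0(1,2) in auto)
    then show ?thesis by (simp add: R1_def)
  qed
  have bR: "\<bar>R z\<bar> \<le> M * \<bar>z\<bar> * \<bar>z\<bar>" if z: "\<bar>z\<bar> \<le> s0" for z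
  proof -
    have "norm (R z - R 0) \<le> M * \<bar>z\<bar> * norm (z - 0)"
    proof (rule field_differentiable_bound[of "{-\<bar>z\<bar>..\<bar>z\<bar>}"])
      show "(R has_field_derivative R1 x) (at x within {-\<bar>z\<bar>..\<bar>z\<bar>})" if "x \<in> {-\<bar>z\<bar>..\<bar>z\<bar>}" for x
        by (rule has_field_derivative_at_within[OF dR]) (use that s0(1,2) z in auto)
      show "norm (R1 x) \<le> M * \<bar>z\<bar>" if "x \<in> {-\<bar>z\<bar>..\<bar>z\<bar>}" for x
      proof -
        have x: "\<bar>x\<bar> \<le> \<bar>z\<bar>" using that by auto
        then have "\<bar>R1 x\<bar> \<le> M * \<bar>x\<bar>" using bR1[of x] z by auto
        also have "\<dots> \<le> M * \<bar>z\<bar>" using x M by (intro mult_left_mono)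
        finally show ?thesis by simp
      qed
    qed auto
    then show ?thesis by (simp add: R_def)
  qed
  define s1 where "s1 = (\<lambda>x::real. cos (x / 2) / x - 2 * sin (x / 2) / x\<^sup>2)"
  define s2 where "s2 = (\<lambda>x::real. - sin (x / 2) / (2 * x) - 2 * cos (x / 2) / x\<^sup>2 + 4 * sin (x / 2) / x ^ 3)"
  have ds: "(s has_real_derivative s1 x) (at x)" if "1 \<le> x" for x
    unfolding s_def s1_def using that by (auto intro!: derivative_eq_intros simp: field_simps power2_eq_square)
  have ds1: "(s1 has_real_derivative s2 x) (at x)" if "1 \<le> x" for x
    unfolding s1_def s2_def using that by (auto intro!: derivative_eq_intros simp: field_simps power2_eq_square power3_eq_cube)
  have inv: "1 / x\<^sup>2 \<le> 1 / x" "1 / x ^ 3 \<le> 1 / x" "1 / x \<le> 1" if "1 \<le> x" for x :: real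
  proof -
    have "x ^ 1 \<le> x ^ 2" "x ^ 1 \<le> x ^ 3" using that by (intro power_increasing; simp)+
    then show "1 / x\<^sup>2 \<le> 1 / x" "1 / x ^ 3 \<le> 1 / x" "1 / x \<le> 1" using that by (auto simp: frac_le)
  qed
  have bs: "\<bar>s x\<bar> \<le> 2 / x" "\<bar>s1 x\<bar> \<le> 3 / x" "\<bar>s2 x\<bar> \<le> 7 / x" if x: "1 \<le> x" for x
  proof -
    have sc: "\<bar>sin (x / 2)\<bar> \<le> 1" "\<bar>cos (x / 2)\<bar> \<le> 1" by auto
    have x0: "0 < x" using x by simp
    show "\<bar>s x\<bar> \<le> 2 / x" using x0 sc by (simp add: s_def abs_mult divide_right_mono)
    have a1: "\<bar>cos (x / 2) / x\<bar> \<le> 1 / x" using x0 sc by (simp add: divide_right_mono)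
    have a2: "\<bar>2 * sin (x / 2) / x\<^sup>2\<bar> \<le> 2 * (1 / x)"
    proof -
      have "\<bar>2 * sin (x / 2) / x\<^sup>2\<bar> \<le> 2 * (1 / x\<^sup>2)" using x0 sc by (simp add: abs_mult divide_right_mono)
      then show ?thesis using inv(1)[OF x] by linarith
    qed
    show "\<bar>s1 x\<bar> \<le> 3 / x" using a1 a2 unfolding s1_def by linarith
    have "\<bar>sin (x / 2)\<bar> \<le> 2" using sc(1) by linarith
    then have a3: "\<bar>- sin (x / 2) / (2 * x)\<bar> \<le> 1 / x" using x0 by (simp add: divide_simps)
    have a4: "\<bar>2 * cos (x / 2) / x\<^sup>2\<bar> \<le> 2 * (1 / x)"
    proof -
      have "\<bar>2 * cos (x / 2) / x\<^sup>2\<bar> \<le> 2 * (1 / x\<^sup>2)" using x0 sc by (simp add: abs_mult divide_right_mono)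
      then show ?thesis using inv(1)[OF x] by linarith
    qed
    have a5: "\<bar>4 * sin (x / 2) / x ^ 3\<bar> \<le> 4 * (1 / x)"
    proof -
      have "\<bar>4 * sin (x / 2) / x ^ 3\<bar> \<le> 4 * (1 / x ^ 3)" using x0 sc by (simp add: abs_mult divide_right_mono)
      then show ?thesis using inv(2)[OF x] by linarith
    qed
    show "\<bar>s2 x\<bar> \<le> 7 / x" using a3 a4 a5 unfolding s2_def by linarith
  qed
  define r' where "r' = (\<lambda>x. R1 (s x) * s1 x)"
  define r'' where "r'' = (\<lambda>x. R2 (s x) * s1 x * s1 x + R1 (s x) * s2 x)"
  have rR: "r = (\<lambda>x. R (s x))" by (simp add: r_def R_def)
  have sl: "s x < 1" if "1 \<le> x" for x using s0(2) s0(3)[OF that] by linarith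
  have "(r has_real_derivative r' y) (at y)" if "1 \<le> y" for y
    unfolding rR r'_def by (rule DERIV_chain2[OF dR[OF sl[OF that]] ds[OF that]])
  moreover have "(r' has_real_derivative r'' y) (at y)" if "1 \<le> y" for y
    unfolding r'_def r''_def
    using DERIV_mult[OF DERIV_chain2[OF dR1[OF sl[OF that]] ds[OF that]] ds1[OF that]] by (simp add: mult_ac add.commute)
  \<comment> \<open>23 = 3 * 3 + 2 * 7, from the bounds 2 / y, 3 / y and 7 / y for s and its first
    two derivatives in the formula for r''.\<close>
  moreover have "\<bar>r y\<bar> \<le> 23 * M / y\<^sup>2 \<and> \<bar>r' y\<bar> \<le> 23 * M \<and> \<bar>r'' y\<bar> \<le> 23 * M / y\<^sup>2" if y: "1 \<le> y" for y
  proof -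
    have y0: "0 < y" using y by simp
    note b = bs[OF y] s0(3)[OF y]
    have r1: "\<bar>R1 (s y)\<bar> \<le> M * (2 / y)" using bR1[OF b(4)] mult_left_mono[OF b(1) M] by linarith
    have "\<bar>r y\<bar> \<le> M * \<bar>s y\<bar> * \<bar>s y\<bar>" unfolding rR by (rule bR[OF b(4)])
    also have "\<dots> \<le> M * (2 / y) * (2 / y)" using M b(1) y0 by (intro mult_mono) auto
    also have "\<dots> = 4 * M / y\<^sup>2" by (simp add: power2_eq_square)
    also have "\<dots> \<le> 23 * M / y\<^sup>2" using M by (intro divide_right_mono) auto
    finally have 1: "\<bar>r y\<bar> \<le> 23 * M / y\<^sup>2" .
    have "\<bar>r' y\<bar> \<le> M * (2 / y) * (3 / y)" unfolding r'_def abs_mult using r1 b(2) M y0 by (intro mult_mono) auto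
    also have "\<dots> = 6 * M * (1 / y) * (1 / y)" by simp
    also have "\<dots> \<le> 6 * M * 1 * 1" using inv(3)[OF y] M y0 by (intro mult_mono) auto
    finally have 2: "\<bar>r' y\<bar> \<le> 23 * M" using M by linarith
    have "\<bar>R2 (s y) * s1 y * s1 y\<bar> \<le> M * (3 / y) * (3 / y)" unfolding abs_mult using bR2[OF b(4)] b(2) M y0 by (intro mult_mono) auto
    moreover have "\<bar>R1 (s y) * s2 y\<bar> \<le> M * (2 / y) * (7 / y)" unfolding abs_mult using r1 b(3) M y0 by (intro mult_mono) auto
    ultimately have "\<bar>r'' y\<bar> \<le> M * (3 / y) * (3 / y) + M * (2 / y) * (7 / y)"
      unfolding r''_def by (rule order_trans[OF abs_triangle_ineq add_mono])
    also have "\<dots> = 23 * M / y\<^sup>2" using y0 by (simp add: power2_eq_square field_simps)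
    finally have 3: "\<bar>r'' y\<bar> \<le> 23 * M / y\<^sup>2" .
    show ?thesis using 1 2 3 by simp
  qed
  ultimately show ?thesis using M by (intro exI[of _ "23 * M"] exI[of _ r'] exI[of _ r'']) auto
qed

text \<open>For small a the power itself does not decay quadratically; it is therefore used only in
  differences of two scales, see \<open>fractional_integral_block\<close>.\<close>

lemma powr_symbol:
  fixes a :: real assumes a: "0 < a"
  shows "\<exists>D r' r''. 0 \<le> D \<and> (\<forall>y\<ge>1. ((\<lambda>x. x powr (- a)) has_real_derivative r' y) (at y)) \<and> (\<forall>y\<ge>1. (r' has_real_derivative r'' y) (at y)) \<and>
     (\<forall>y\<ge>1. \<bar>r' y\<bar> \<le> D \<and> \<bar>r'' y\<bar> \<le> D / y\<^sup>2)"
proof -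
  define r' where "r' = (\<lambda>x::real. - a * x powr (- a - 1))"
  define r'' where "r'' = (\<lambda>x::real. a * (a + 1) * x powr (- a - 2))"
  have "((\<lambda>x. x powr (- a)) has_real_derivative r' y) (at y)" if "1 \<le> y" for y
    unfolding r'_def using that by (auto intro!: derivative_eq_intros)
  moreover have "(r' has_real_derivative r'' y) (at y)" if "1 \<le> y" for y
    unfolding r'_def r''_def using that by (auto intro!: derivative_eq_intros simp: algebra_simps)
  moreover have "\<bar>r' y\<bar> \<le> a * (a + 2) \<and> \<bar>r'' y\<bar> \<le> a * (a + 2) / y\<^sup>2" if y: "1 \<le> y" for y
  proof
    have "y powr (- a - 1) \<le> y powr 0" using y a by (intro powr_mono) auto
    then have "a * y powr (- a - 1) \<le> a * 1" using y a by (intro mult_left_mono) auto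
    also have "\<dots> \<le> a * (a + 2)" using a by (intro mult_left_mono) auto
    finally show "\<bar>r' y\<bar> \<le> a * (a + 2)" using a by (simp add: r'_def abs_mult)
    have "y powr (- a - 2) \<le> y powr (- 2)" using y a by (intro powr_mono) auto
    also have "\<dots> = 1 / y\<^sup>2" using y by (simp add: powr_minus divide_inverse)
    finally have "a * (a + 1) * y powr (- a - 2) \<le> a * (a + 2) * (1 / y\<^sup>2)" using a by (intro mult_mono) auto
    then show "\<bar>r'' y\<bar> \<le> a * (a + 2) / y\<^sup>2" using a by (simp add: r''_def abs_mult)
  qed
  ultimately show ?thesis using a by (intro exI[of _ "a * (a + 2)"] exI[of _ r'] exI[of _ r'']) auto
qed

context orlicz_weight
begin

lemma opbd_integrable:
  assumes [measurable]: "K \<in> borel_measurable borel" and "opbd (\<lambda>t. ennreal \<bar>K t\<bar>) (ennreal A)"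
  shows "integrable lborel K"
  using assms(2) unfolding opbd_def by (intro integrableI_bounded) (auto intro: le_less_trans)

lemma Nn_rconv:
  assumes "opbd (\<lambda>t. ennreal \<bar>K t\<bar>) A" and f: "L1 f"
  shows "Nn (\<lambda>x. ennreal \<bar>rconv K f x\<bar>) \<le> A * Nn (\<lambda>x. ennreal \<bar>f x\<bar>)"
proof -
  have [measurable]: "f \<in> borel_measurable borel" and "periodic2pi f" using f by (auto simp: L1_def)
  then have "(\<lambda>x. ennreal \<bar>f x\<bar>) \<in> borel_measurable borel" "periodic2pi (\<lambda>x. ennreal \<bar>f x\<bar>)"
    by (auto simp: periodic2pi_def)
  then have "Nn (nconv (\<lambda>t. ennreal \<bar>K t\<bar>) (\<lambda>x. ennreal \<bar>f x\<bar>)) \<le> A * Nn (\<lambda>x. ennreal \<bar>f x\<bar>)"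
    using assms(1) unfolding opbd_def by blast
  then show ?thesis using Nn_mono[OF rconv_le_nconv] by (rule order_trans[rotated])
qed

text \<open>P is the sum of G, k A_h G and the convolution of G with K, where h = 1 / n and K has
  the symbol r of \<open>inverse_power_symbol\<close> at m / n. For m > n the three symbols add up
  to (1 - s)^(-k), which undoes the factor in the hypothesis; the lower coefficients of P are left
  arbitrary. The constant is independent of n because the bounds on \<open>ext1\<close> scale as
  \<open>multiplier_kernel\<close> demands.\<close>

lemma difference_inversion:
  assumes k: "0 < k"
  shows "\<exists>C>0. \<forall>n\<ge>1. \<forall>G g0. L1 G \<longrightarrow> L1 g0 \<longrightarrow> 
     (\<forall>m\<ge>1. fc G m = of_real ((1 - sin (real m * (1 / real n) / 2) / (real m * (1 / real n) / 2)) powr k) * fc g0 m) \<longrightarrow>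
     (\<exists>P. L1 P \<and> Nn (\<lambda>x. ennreal \<bar>P x\<bar>) \<le> ennreal C * Nn (\<lambda>x. ennreal \<bar>G x\<bar>) \<and> (\<forall>m>n. fc P m = fc g0 m))"
proof -
  define s where "s = (\<lambda>x::real. 2 * sin (x / 2) / x)"
  define r where "r = (\<lambda>x. (1 - s x) powr (- k) - 1 - k * s x)"
  obtain D r' r'' where D: "0 \<le> D" and der: "\<And>y. 1 \<le> y \<Longrightarrow> (r has_real_derivative r' y) (at y)" "\<And>y. 1 \<le> y \<Longrightarrow> (r' has_real_derivative r'' y) (at y)"
    and b: "\<And>y. 1 \<le> y \<Longrightarrow> \<bar>r y\<bar> \<le> D / y\<^sup>2" "\<And>y. 1 \<le> y \<Longrightarrow> \<bar>r' y\<bar> \<le> D" "\<And>y. 1 \<le> y \<Longrightarrow> \<bar>r'' y\<bar> \<le> D / y\<^sup>2"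
    using inverse_power_symbol[OF k] unfolding r_def s_def by blast
  \<comment> \<open>At least 2 |r(1)| + 5 D, as |r(1)| \<le> D, for the second differences, and at
    least 4 D for the sum.\<close>
  define A where "A = 7 * D"
  define C where "C = 1 + (k * (1 + Kbox) + 9 * A * Kdec)"
  have C0: "0 \<le> k * (1 + Kbox)" "0 \<le> 9 * A * Kdec" using k Kbox_pos Kdec_pos D by (auto simp: A_def)
  show ?thesis
  proof (rule exI[of _ C], intro conjI allI impI)
    show "0 < C" using C0 by (simp add: C_def)
    fix n :: nat and G g0
    assume n: "1 \<le> n" and G: "L1 G" and g0: "L1 g0"
      and fcG: "\<forall>m\<ge>1. fc G m = of_real ((1 - sin (real m * (1 / real n) / 2) / (real m * (1 / real n) / 2)) powr k) * fc g0 m"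
    define \<mu> where "\<mu> = (\<lambda>j::nat. ext1 r (real j / real n))"
    have n0: "0 < real n" using n by simp
    have r1: "\<bar>r 1\<bar> \<le> D" using b(1)[of 1] by simp
    have "\<exists>K. K \<in> borel_measurable borel \<and> opbd (\<lambda>t. ennreal \<bar>K t\<bar>) (ennreal (9 * A * Kdec)) \<and>
      (\<forall>m\<ge>1. kc K m = of_real (\<mu> m) * cis (- 0))"
    proof (rule multiplier_kernel[OF n0])
      show "0 \<le> A" using D by (simp add: A_def)
      show "\<mu> 0 = 0" by (simp add: \<mu>_def ext1_def)
      show "(\<Sum>j<J. \<bar>\<mu> j\<bar>) \<le> A * real n" for J
      proof -
        have "(\<Sum>j<J. \<bar>\<mu> j\<bar>) \<le> 4 * D * real n" unfolding \<mu>_def by (rule ext1_sum[OF n D b(1)])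
        also have "\<dots> \<le> A * real n" using D by (simp add: A_def mult_right_mono)
        finally show ?thesis .
      qed
      show "\<bar>\<mu> 1\<bar> + (\<Sum>j<J. \<bar>\<mu> (j + 2) - 2 * \<mu> (j + 1) + \<mu> j\<bar>) \<le> A / real n" for J
      proof -
        have "\<bar>\<mu> 1\<bar> + (\<Sum>j<J. \<bar>\<mu> (j + 2) - 2 * \<mu> (j + 1) + \<mu> j\<bar>) \<le> (2 * \<bar>r 1\<bar> + 5 * D) / real n"
          unfolding \<mu>_def by (rule ext1_second_differences[OF n D der b(2,3)])
        also have "\<dots> \<le> A / real n" using r1 n0 by (intro divide_right_mono) (auto simp: A_def)
        finally show ?thesis .
      qed
    qed
    then obtain K where K: "K \<in> borel_measurable borel" "opbd (\<lambda>t. ennreal \<bar>K t\<bar>) (ennreal (9 * A * Kdec))" "\<And>m. 1 \<le> m \<Longrightarrow> kc K m = of_real (\<mu> m)"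
      by auto
    have Ki: "integrable lborel K" by (rule opbd_integrable[OF K(1,2)])
    define h where "h = 1 / real n"
    have h: "0 < h" using n0 by (simp add: h_def)
    have ob: "opbd (\<lambda>t. ennreal \<bar>rbox h t\<bar>) (ennreal (1 + Kbox))" using opbd_box[OF h] abs_rbox[OF h] by simp
    define X where "X = rconv (rbox h) G"
    define Y where "Y = rconv K G"
    have XL: "L1 X" unfolding X_def by (rule rconv_L1(1)[OF rbox_integrable G])
    have YL: "L1 Y" unfolding Y_def by (rule rconv_L1(1)[OF Ki G])
    note [measurable] = L1_borel[OF G] L1_borel[OF XL] L1_borel[OF YL]
    define P where "P = (\<lambda>x. G x + (k * X x + Y x))"
    have PL: "L1 P" unfolding P_def by (intro L1_add L1_cmult G XL YL)
    have "Nn (\<lambda>x. ennreal \<bar>P x\<bar>) \<le> ennreal C * Nn (\<lambda>x. ennreal \<bar>G x\<bar>)"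
    proof -
      have "Nn (\<lambda>x. ennreal \<bar>P x\<bar>) \<le> Nn (\<lambda>x. ennreal \<bar>G x\<bar> + (ennreal k * ennreal \<bar>X x\<bar> + ennreal \<bar>Y x\<bar>))"
      proof (rule Nn_mono)
        fix x
        have "\<bar>P x\<bar> \<le> \<bar>G x\<bar> + (k * \<bar>X x\<bar> + \<bar>Y x\<bar>)" using k abs_mult[of k "X x"] unfolding P_def by linarith
        then have "ennreal \<bar>P x\<bar> \<le> ennreal (\<bar>G x\<bar> + (k * \<bar>X x\<bar> + \<bar>Y x\<bar>))" by (rule ennreal_leI)
        then show "ennreal \<bar>P x\<bar> \<le> ennreal \<bar>G x\<bar> + (ennreal k * ennreal \<bar>X x\<bar> + ennreal \<bar>Y x\<bar>)" using k by (simp add: ennreal_mult')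
      qed
      also have "\<dots> \<le> Nn (\<lambda>x. ennreal \<bar>G x\<bar>) + Nn (\<lambda>x. ennreal k * ennreal \<bar>X x\<bar> + ennreal \<bar>Y x\<bar>)"
        by (rule Nn_add) measurable
      also have "\<dots> \<le> Nn (\<lambda>x. ennreal \<bar>G x\<bar>) + (Nn (\<lambda>x. ennreal k * ennreal \<bar>X x\<bar>) + Nn (\<lambda>x. ennreal \<bar>Y x\<bar>))"
        by (intro add_left_mono Nn_add) measurable
      also have "\<dots> \<le> Nn (\<lambda>x. ennreal \<bar>G x\<bar>) + (ennreal k * (ennreal (1 + Kbox) * Nn (\<lambda>x. ennreal \<bar>G x\<bar>)) + ennreal (9 * A * Kdec) * Nn (\<lambda>x. ennreal \<bar>G x\<bar>))"
      proof (intro add_left_mono add_mono)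
        have "Nn (\<lambda>x. ennreal k * ennreal \<bar>X x\<bar>) \<le> ennreal k * Nn (\<lambda>x. ennreal \<bar>X x\<bar>)" by (rule Nn_cmult) measurable
        also have "\<dots> \<le> ennreal k * (ennreal (1 + Kbox) * Nn (\<lambda>x. ennreal \<bar>G x\<bar>))"
          unfolding X_def by (intro mult_left_mono Nn_rconv[OF ob G]) auto
        finally show "Nn (\<lambda>x. ennreal k * ennreal \<bar>X x\<bar>) \<le> ennreal k * (ennreal (1 + Kbox) * Nn (\<lambda>x. ennreal \<bar>G x\<bar>))" .
        show "Nn (\<lambda>x. ennreal \<bar>Y x\<bar>) \<le> ennreal (9 * A * Kdec) * Nn (\<lambda>x. ennreal \<bar>G x\<bar>)"
          unfolding Y_def by (rule Nn_rconv[OF K(2) G])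
      qed
      also have "\<dots> = (1 + (ennreal k * ennreal (1 + Kbox) + ennreal (9 * A * Kdec))) * Nn (\<lambda>x. ennreal \<bar>G x\<bar>)"
        by (simp only: distrib_right mult.assoc mult_1_left)
      also have "1 + (ennreal k * ennreal (1 + Kbox) + ennreal (9 * A * Kdec)) = ennreal C"
      proof -
        have "ennreal k * ennreal (1 + Kbox) = ennreal (k * (1 + Kbox))" using k Kbox_pos by (intro ennreal_mult[symmetric]) auto
        then show ?thesis unfolding C_def using C0 by (simp only: ennreal_plus add_nonneg_nonneg zero_le_one ennreal_1)
      qed
      finally show ?thesis .
    qed
    moreover have "fc P m = fc g0 m" if m: "n < m" for m
    proof -
      have m1: "1 \<le> m" using m by simp
      define x where "x = real m / real n"
      have x: "1 < x" using m n0 by (simp add: x_def)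
      have sx: "sin (real m * h / 2) / (real m * h / 2) = s x" by (simp add: s_def x_def h_def mult.commute)
      have "\<bar>s x\<bar> < 1" unfolding sx[symmetric] using m1 h by (intro abs_sinc_less_1) simp
      then have s1: "0 < 1 - s x" by simp
      have mu: "\<mu> m = r x" using x by (simp add: \<mu>_def ext1_def x_def)
      have "fc P m = fc G m + (of_real k * fc X m + fc Y m)"
        unfolding P_def by (simp add: fc_add fc_cmult L1_add L1_cmult G XL YL)
      also have "fc X m = of_real (s x) * fc G m"
        unfolding X_def rconv_L1(2)[OF rbox_integrable G] kc_rbox[OF h m1] sx ..
      also have "fc Y m = of_real (r x) * fc G m"
        unfolding Y_def rconv_L1(2)[OF Ki G] K(3)[OF m1] mu ..
      also have "fc G m + (of_real k * (of_real (s x) * fc G m) + of_real (r x) * fc G m) = of_real (1 + k * s x + r x) * fc G m"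
        by (simp add: algebra_simps)
      also have "1 + k * s x + r x = (1 - s x) powr (- k)" by (simp add: r_def)
      also have "fc G m = of_real ((1 - s x) powr k) * fc g0 m" using fcG m1 sx unfolding h_def by simp
      also have "of_real ((1 - s x) powr (- k)) * (of_real ((1 - s x) powr k) * fc g0 m) = of_real ((1 - s x) powr (- k) * (1 - s x) powr k) * fc g0 m"
        by (simp add: mult.assoc)
      also have "(1 - s x) powr (- k) * (1 - s x) powr k = 1" using s1 by (simp flip: powr_add)
      finally show ?thesis by simp
    qed
    ultimately show "\<exists>P. L1 P \<and> Nn (\<lambda>x. ennreal \<bar>P x\<bar>) \<le> ennreal C * Nn (\<lambda>x. ennreal \<bar>G x\<bar>) \<and> (\<forall>m>n. fc P m = fc g0 m)"
      using PL by blast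
  qed
qed

end

subsection \<open>The direct theorem\<close>

context orlicz_weight
begin

text \<open>Subtracting 2^(-a) times the symbol at scale 2 N cancels the pure power exactly for m
  \<ge> 2 N. So only frequencies below 2 N remain, with coefficients bounded by 1, and their sum is
  of order N however slowly the power decays. The constant does not depend on N.\<close>

lemma fractional_integral_block:
  assumes a: "0 < a"
  shows "\<exists>A>0. \<forall>N::nat\<ge>1. \<exists>K. K \<in> borel_measurable borel \<and> opbd (\<lambda>t. ennreal \<bar>K t\<bar>) (ennreal A) \<and>
    (\<forall>m\<ge>1. kc K m = of_real (ext1 (\<lambda>x. x powr (- a)) (real m / real N) - 2 powr (- a) * ext1 (\<lambda>x. x powr (- a)) (real m / real (2 * N))) * cis (- g))"
proof -
  define r where "r = (\<lambda>x::real. x powr (- a))"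
  obtain D r' r'' where D: "0 \<le> D" and der: "\<And>y. 1 \<le> y \<Longrightarrow> (r has_real_derivative r' y) (at y)" "\<And>y. 1 \<le> y \<Longrightarrow> (r' has_real_derivative r'' y) (at y)"
    and b: "\<And>y. 1 \<le> y \<Longrightarrow> \<bar>r' y\<bar> \<le> D" "\<And>y. 1 \<le> y \<Longrightarrow> \<bar>r'' y\<bar> \<le> D / y\<^sup>2"
    using powr_symbol[OF a] unfolding r_def by blast
  define p where "p = 2 powr (- a)"
  have p: "0 < p" "p < 1" using a powr_less_mono[of "- a" 0 2] by (auto simp: p_def)
  have e01: "0 \<le> ext1 r x \<and> ext1 r x \<le> 1" if x: "0 \<le> x" for x
  proof (cases "x \<le> 1")
    case True
    then show ?thesis using x by (simp add: ext1_def r_def)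
  next
    case False
    then have "x powr (- a) \<le> x powr 0" using a by (intro powr_mono) auto
    then show ?thesis using False by (simp add: ext1_def r_def)
  qed
  define A where "A = 4 + 10 * D"
  have A: "4 \<le> A" using D by (simp add: A_def)
  show ?thesis
  proof (rule exI[of _ "9 * A * Kdec"], intro conjI allI impI)
    show "0 < 9 * A * Kdec" using A Kdec_pos by simp
    fix N :: nat assume N: "1 \<le> N"
    have N0: "0 < real N" using N by simp
    define m1 where "m1 = (\<lambda>j::nat. ext1 r (real j / real N))"
    define m2 where "m2 = (\<lambda>j::nat. ext1 r (real j / real (2 * N)))"
    define \<mu> where "\<mu> = (\<lambda>j. m1 j - p * m2 j)"
    have "\<exists>K. K \<in> borel_measurable borel \<and> opbd (\<lambda>t. ennreal \<bar>K t\<bar>) (ennreal (9 * A * Kdec)) \<and>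
      (\<forall>m\<ge>1. kc K m = of_real (\<mu> m) * cis (- g))"
    proof (rule multiplier_kernel[OF N0])
      show "0 \<le> A" using A by simp
      show "\<mu> 0 = 0" by (simp add: \<mu>_def m1_def m2_def ext1_def)
      have mb: "\<bar>\<mu> j\<bar> \<le> 1" for j
      proof -
        have "0 \<le> m1 j" "m1 j \<le> 1" "0 \<le> m2 j" "m2 j \<le> 1" using e01 by (auto simp: m1_def m2_def)
        moreover from this have "0 \<le> p * m2 j" "p * m2 j \<le> 1" using p by (auto intro: mult_le_one)
        ultimately show ?thesis unfolding \<mu>_def by linarith
      qed
      have mz: "\<mu> j = 0" if j: "2 * N \<le> j" for j
      proof -
        have "1 < real j / real N" "1 \<le> real j / real (2 * N)" using j N0 by (auto simp: field_simps)
        then have "m1 j = r (real j / real N)" "m2 j = r (real j / real (2 * N))"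
          by (auto simp: m1_def m2_def ext1_def r_def)
        moreover have "p * r (real j / real (2 * N)) = r (2 * (real j / real (2 * N)))"
          unfolding p_def r_def by (subst powr_mult) auto
        moreover have "2 * (real j / real (2 * N)) = real j / real N" by simp
        ultimately show ?thesis by (simp add: \<mu>_def)
      qed
      show "(\<Sum>j<J. \<bar>\<mu> j\<bar>) \<le> A * real N" for J
      proof -
        have "(\<Sum>j<J. \<bar>\<mu> j\<bar>) = (\<Sum>j\<in>{..<J} \<inter> {..<2 * N}. \<bar>\<mu> j\<bar>)"
          by (intro sum.mono_neutral_right) (auto, metis mz not_le_imp_less)
        also have "\<dots> \<le> (\<Sum>j\<in>{..<J} \<inter> {..<2 * N}. 1)" by (intro sum_mono mb)
        also have "\<dots> \<le> (\<Sum>j\<in>{..<2 * N}. 1)" by (intro sum_mono2) auto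
        also have "\<dots> \<le> A * real N" using A N0 by (simp add: mult_right_mono)
        finally show ?thesis .
      qed
      show "\<bar>\<mu> 1\<bar> + (\<Sum>j<J. \<bar>\<mu> (j + 2) - 2 * \<mu> (j + 1) + \<mu> j\<bar>) \<le> A / real N" for J
      proof -
        have r1: "\<bar>r 1\<bar> = 1" by (simp add: r_def)
        have h1: "\<bar>m1 1\<bar> + (\<Sum>j<J. \<bar>m1 (j + 2) - 2 * m1 (j + 1) + m1 j\<bar>) \<le> (2 + 5 * D) / real N"
          using ext1_second_differences[OF N D der b, of J] by (simp add: m1_def r1)
        have N2: "1 \<le> 2 * N" using N by simp
        have h2: "\<bar>m2 1\<bar> + (\<Sum>j<J. \<bar>m2 (j + 2) - 2 * m2 (j + 1) + m2 j\<bar>) \<le> (2 + 5 * D) / real (2 * N)"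
          using ext1_second_differences[OF N2 D der b, of J] by (simp add: m2_def r1)
        have tri: "\<bar>x - p * y\<bar> \<le> \<bar>x\<bar> + \<bar>y\<bar>" for x y
        proof -
          have "\<bar>p * y\<bar> \<le> 1 * \<bar>y\<bar>" unfolding abs_mult using p by (intro mult_right_mono) auto
          then show ?thesis by linarith
        qed
        have "\<bar>\<mu> 1\<bar> \<le> \<bar>m1 1\<bar> + \<bar>m2 1\<bar>" unfolding \<mu>_def by (rule tri)
        moreover have "(\<Sum>j<J. \<bar>\<mu> (j + 2) - 2 * \<mu> (j + 1) + \<mu> j\<bar>)
          \<le> (\<Sum>j<J. \<bar>m1 (j + 2) - 2 * m1 (j + 1) + m1 j\<bar> + \<bar>m2 (j + 2) - 2 * m2 (j + 1) + m2 j\<bar>)"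
        proof (rule sum_mono)
          fix j
          have "\<mu> (j + 2) - 2 * \<mu> (j + 1) + \<mu> j = (m1 (j + 2) - 2 * m1 (j + 1) + m1 j) - p * (m2 (j + 2) - 2 * m2 (j + 1) + m2 j)"
            by (simp add: \<mu>_def algebra_simps)
          then show "\<bar>\<mu> (j + 2) - 2 * \<mu> (j + 1) + \<mu> j\<bar> \<le> \<bar>m1 (j + 2) - 2 * m1 (j + 1) + m1 j\<bar> + \<bar>m2 (j + 2) - 2 * m2 (j + 1) + m2 j\<bar>"
            using tri by simp
        qed
        ultimately have "\<bar>\<mu> 1\<bar> + (\<Sum>j<J. \<bar>\<mu> (j + 2) - 2 * \<mu> (j + 1) + \<mu> j\<bar>) \<le> (2 + 5 * D) / real N + (2 + 5 * D) / real (2 * N)"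
          using h1 h2 by (simp only: sum.distrib)
        also have "\<dots> \<le> (2 + 5 * D) / real N + (2 + 5 * D) / real N"
          using N0 D by (intro add_left_mono divide_left_mono) auto
        also have "\<dots> = A / real N" by (simp add: A_def add_divide_distrib[symmetric])
        finally show ?thesis .
      qed
    qed
    then show "\<exists>K. K \<in> borel_measurable borel \<and> opbd (\<lambda>t. ennreal \<bar>K t\<bar>) (ennreal (9 * A * Kdec)) \<and>
      (\<forall>m\<ge>1. kc K m = of_real (ext1 (\<lambda>x. x powr (- a)) (real m / real N) - 2 powr (- a) * ext1 (\<lambda>x. x powr (- a)) (real m / real (2 * N))) * cis (- g))"
      unfolding \<mu>_def m1_def m2_def r_def p_def .
  qed
qed

text \<open>The symbol of frequency \<open>m\<close> telescopes in \<open>i\<close> to its value for \<open>N = n\<close>.\<close>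

lemma fractional_integral:
  assumes a: "0 < a"
  shows "\<exists>C>0. \<forall>n::nat\<ge>1. \<exists>K. K \<in> borel_measurable borel \<and> opbd (\<lambda>t. ennreal \<bar>K t\<bar>) (ennreal (C / real n powr a)) \<and>
    (\<forall>m\<ge>n. kc K m = of_real (real m powr (- a)) * cis (- g))"
proof -
  define l where "l = ext1 (\<lambda>x::real. x powr (- a))"
  obtain A where A: "0 < A" and blk: "\<And>N::nat. 1 \<le> N \<Longrightarrow> \<exists>K. K \<in> borel_measurable borel \<and> opbd (\<lambda>t. ennreal \<bar>K t\<bar>) (ennreal A) \<and>
    (\<forall>m\<ge>1. kc K m = of_real (l (real m / real N) - 2 powr (- a) * l (real m / real (2 * N))) * cis (- g))"
    using fractional_integral_block[OF a, of g] unfolding l_def by blast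
  define p where "p = 2 powr (- a)"
  have p: "0 < p" "p < 1" using a powr_less_mono[of "- a" 0 2] by (auto simp: p_def)
  have l01: "\<bar>l x\<bar> \<le> 1" if "0 \<le> x" for x
  proof (cases "x \<le> 1")
    case False
    then have "x powr (- a) \<le> x powr 0" using a by (intro powr_mono) auto
    then show ?thesis using False by (simp add: l_def ext1_def)
  qed (use that in \<open>simp add: l_def ext1_def\<close>)
  show ?thesis
  proof (rule exI[of _ "A / (1 - p)"], intro conjI allI impI)
    show "0 < A / (1 - p)" using A p by simp
    fix n :: nat assume n: "1 \<le> n"
    have n0: "0 < real n" using n by simp
    have "\<forall>i. \<exists>K. K \<in> borel_measurable borel \<and> opbd (\<lambda>t. ennreal \<bar>K t\<bar>) (ennreal A) \<and>
       (\<forall>m\<ge>1. kc K m = of_real (l (real m / real (2 ^ i * n)) - 2 powr (- a) * l (real m / real (2 * (2 ^ i * n)))) * cis (- g))"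
      using n by (intro allI blk) simp
    then obtain K where Kb: "\<And>i. K i \<in> borel_measurable borel" and Ko: "\<And>i. opbd (\<lambda>t. ennreal \<bar>K i t\<bar>) (ennreal A)"
      and Kc: "\<And>i m. 1 \<le> m \<Longrightarrow> kc (K i) m = of_real (l (real m / real (2 ^ i * n)) - p * l (real m / real (2 * (2 ^ i * n)))) * cis (- g)"
      unfolding p_def by metis
    note [measurable] = Kb
    \<comment> \<open>The (-a)-th power of the scale 2^i n, which is the size of the i-th
      block.\<close>
    define q where "q = (\<lambda>i. real n powr (- a) * p ^ i)"
    have q0: "0 \<le> q i" for i using p by (simp add: q_def)
    have qs: "q sums (real n powr (- a) * (1 / (1 - p)))" unfolding q_def using p by (intro sums_mult geometric_sums) simp
    define Kinf where "Kinf = (\<lambda>t. \<Sum>i. q i * K i t)"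
    have Km [measurable]: "Kinf \<in> borel_measurable borel" unfolding Kinf_def by measurable
    have os: "opbd (\<lambda>t. \<Sum>i. ennreal (q i) * ennreal \<bar>K i t\<bar>) (\<Sum>i. ennreal (q i) * ennreal A)"
      by (intro opbd_suminf opbd_cmult Ko)
    have qA: "(\<Sum>i. ennreal (q i) * ennreal A) = ennreal (A / (1 - p) / real n powr a)"
    proof -
      have "(\<Sum>i. ennreal (q i)) = ennreal (real n powr (- a) * (1 / (1 - p)))"
        using qs q0 by (subst suminf_ennreal2) (auto simp: sums_iff)
      then have "(\<Sum>i. ennreal (q i) * ennreal A) = ennreal (real n powr (- a) * (1 / (1 - p))) * ennreal A" by simp
      also have "\<dots> = ennreal (real n powr (- a) * (1 / (1 - p)) * A)" using A by (intro ennreal_mult''[symmetric]) simp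
      also have "real n powr (- a) * (1 / (1 - p)) * A = A / (1 - p) / real n powr a" by (simp add: powr_minus divide_inverse)
      finally show ?thesis .
    qed
    \<comment> \<open>Where the series does not converge absolutely, nothing is known about
      \<open>Kinf\<close>, but the majorant is infinite there.\<close>
    have dom: "ennreal \<bar>Kinf t\<bar> \<le> (\<Sum>i. ennreal (q i) * ennreal \<bar>K i t\<bar>)" for t
    proof (cases "summable (\<lambda>i. \<bar>q i * K i t\<bar>)")
      case True
      have "ennreal \<bar>Kinf t\<bar> \<le> ennreal (\<Sum>i. \<bar>q i * K i t\<bar>)" unfolding Kinf_def by (intro ennreal_leI summable_rabs True)
      also have "\<dots> = (\<Sum>i. ennreal \<bar>q i * K i t\<bar>)" using True by (intro suminf_ennreal2[symmetric]) auto
      also have "\<dots> = (\<Sum>i. ennreal (q i) * ennreal \<bar>K i t\<bar>)" using q0 by (simp add: abs_mult ennreal_mult')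
      finally show ?thesis .
    next
      case False
      have "(\<Sum>i. ennreal \<bar>q i * K i t\<bar>) = top"
      proof (rule ccontr)
        assume "(\<Sum>i. ennreal \<bar>q i * K i t\<bar>) \<noteq> top"
        then have "summable (\<lambda>i. \<bar>q i * K i t\<bar>)" by (rule summable_suminf_not_top[rotated]) simp
        with False show False ..
      qed
      moreover have "ennreal \<bar>q i * K i t\<bar> = ennreal (q i) * ennreal \<bar>K i t\<bar>" for i using q0[of i] by (simp add: abs_mult ennreal_mult')
      ultimately show ?thesis by simp
    qed
    have op: "opbd (\<lambda>t. ennreal \<bar>Kinf t\<bar>) (ennreal (A / (1 - p) / real n powr a))"
      by (rule opbd_mono[OF os]) (use dom qA in auto)
    have Ki: "integrable lborel (K i)" for i by (rule opbd_integrable[OF Kb Ko])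
    have kcinf: "kc Kinf m = of_real (real m powr (- a)) * cis (- g)" if m: "n \<le> m" for m
    proof -
      have m1: "1 \<le> m" using m n by simp
      have aes: "AE t in lborel. summable (\<lambda>i. \<bar>q i * K i t\<bar>)"
      proof -
        have "(\<integral>\<^sup>+t. (\<Sum>i. ennreal (q i) * ennreal \<bar>K i t\<bar>) \<partial>lborel) \<noteq> \<infinity>"
          using os unfolding opbd_def qA by (auto simp: top_unique)
        then have "AE t in lborel. (\<Sum>i. ennreal (q i) * ennreal \<bar>K i t\<bar>) \<noteq> \<infinity>"
          by (intro nn_integral_PInf_AE) auto
        then show ?thesis
        proof eventually_elim
          case (elim t)
          then have "(\<Sum>i. ennreal \<bar>q i * K i t\<bar>) \<noteq> top" using q0 by (simp add: abs_mult ennreal_mult')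
          then show ?case by (intro summable_suminf_not_top) auto
        qed
      qed
      have ti: "integrable lborel (\<lambda>t. of_real (q i * K i t) * cis (real m * t))" for i
      proof (rule Bochner_Integration.integrable_bound[of _ "\<lambda>t. q i * K i t"])
        show "integrable lborel (\<lambda>t. q i * K i t)" by (intro integrable_mult_right Ki)
        show "(\<lambda>t. complex_of_real (q i * K i t) * cis (real m * t)) \<in> borel_measurable lborel" by measurable
      qed (simp add: norm_mult)
      have "(\<lambda>i. \<integral>t. of_real (q i * K i t) * cis (real m * t) \<partial>lborel) sums (\<integral>t. (\<Sum>i. of_real (q i * K i t) * cis (real m * t)) \<partial>lborel)"
      proof (rule sums_integral[OF ti])
        show "AE t in lborel. summable (\<lambda>i. norm (complex_of_real (q i * K i t) * cis (real m * t)))"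
          using aes by (simp add: norm_mult abs_mult)
        show "summable (\<lambda>i. \<integral>t. norm (complex_of_real (q i * K i t) * cis (real m * t)) \<partial>lborel)"
        proof (rule summable_comparison_test'[of "\<lambda>i. q i * A" 0])
          show "summable (\<lambda>i. q i * A)" using qs by (intro summable_mult2) (auto simp: sums_iff)
          fix i
          have "ennreal (\<integral>t. \<bar>K i t\<bar> \<partial>lborel) = (\<integral>\<^sup>+t. ennreal \<bar>K i t\<bar> \<partial>lborel)"
            using Ki[of i] by (intro nn_integral_eq_integral[symmetric]) auto
          also have "\<dots> \<le> ennreal A" using Ko[of i] by (simp add: opbd_def)
          finally have "(\<integral>t. \<bar>K i t\<bar> \<partial>lborel) \<le> A" using A by simp
          then have "q i * (\<integral>t. \<bar>K i t\<bar> \<partial>lborel) \<le> q i * A" by (intro mult_left_mono q0)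
          then show "norm (\<integral>t. norm (complex_of_real (q i * K i t) * cis (real m * t)) \<partial>lborel) \<le> q i * A"
            using q0 by (simp add: norm_mult abs_mult)
        qed
      qed
      moreover have "(\<integral>t. (\<Sum>i. of_real (q i * K i t) * cis (real m * t)) \<partial>lborel) = kc Kinf m"
        unfolding kc_def
      proof (rule integral_cong_AE)
        show "AE t in lborel. (\<Sum>i. of_real (q i * K i t) * cis (real m * t)) = of_real (Kinf t) * cis (real m * t)"
          using aes
        proof eventually_elim
          case (elim t)
          have "(\<lambda>i. complex_of_real (q i * K i t)) sums of_real (Kinf t)"
            unfolding Kinf_def by (rule sums_of_real[OF summable_sums[OF summable_rabs_cancel[OF elim]]])
          then have "(\<lambda>i. complex_of_real (q i * K i t) * cis (real m * t)) sums (of_real (Kinf t) * cis (real m * t))"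
            by (rule sums_mult2)
          then show ?case by (simp add: sums_iff)
        qed
      qed measurable
      moreover have "(\<integral>t. of_real (q i * K i t) * cis (real m * t) \<partial>lborel) = of_real (q i * l (real m / real (2 ^ i * n)) - q (Suc i) * l (real m / real (2 ^ Suc i * n))) * cis (- g)" for i
      proof -
        have "(\<integral>t. of_real (q i * K i t) * cis (real m * t) \<partial>lborel) = of_real (q i) * kc (K i) m"
          unfolding kc_def of_real_mult mult.assoc by (rule integral_mult_right_zero)
        also have "\<dots> = of_real (q i * (l (real m / real (2 ^ i * n)) - p * l (real m / real (2 * (2 ^ i * n))))) * cis (- g)"
          unfolding Kc[OF m1] by simp
        also have "q i * (l (real m / real (2 ^ i * n)) - p * l (real m / real (2 * (2 ^ i * n)))) = q i * l (real m / real (2 ^ i * n)) - q (Suc i) * l (real m / real (2 ^ Suc i * n))"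
          by (simp add: q_def right_diff_distrib mult_ac)
        finally show ?thesis .
      qed
      ultimately have s1: "(\<lambda>i. of_real (q i * l (real m / real (2 ^ i * n)) - q (Suc i) * l (real m / real (2 ^ Suc i * n))) * cis (- g)) sums kc Kinf m"
        by simp
      \<comment> \<open>The upper end of the telescoping sum vanishes, because the weights
        \<open>q\<close> tend to 0 and \<open>l\<close> is bounded by 1.\<close>
      have "(\<lambda>i. q i * l (real m / real (2 ^ i * n))) \<longlonglongrightarrow> 0"
      proof (rule Lim_null_comparison[where g = q])
        show "\<forall>\<^sub>F i in sequentially. norm (q i * l (real m / real (2 ^ i * n))) \<le> q i"
          using q0 l01 by (intro always_eventually allI) (simp add: abs_mult mult_left_le)
        show "q \<longlonglongrightarrow> 0" using qs by (intro summable_LIMSEQ_zero) (auto simp: sums_iff)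
      qed
      from telescope_sums'[OF this]
      have "(\<lambda>i. q i * l (real m / real (2 ^ i * n)) - q (Suc i) * l (real m / real (2 ^ Suc i * n))) sums (q 0 * l (real m / real n))"
        by simp
      moreover have "q 0 * l (real m / real n) = real m powr (- a)"
      proof -
        have x: "1 \<le> real m / real n" using m n0 by simp
        have "l (real m / real n) = (real m / real n) powr (- a)"
          using x by (cases "real m / real n = 1") (auto simp: l_def ext1_def)
        then show ?thesis using n0 m1 by (simp add: q_def powr_divide)
      qed
      ultimately have "(\<lambda>i. of_real (q i * l (real m / real (2 ^ i * n)) - q (Suc i) * l (real m / real (2 ^ Suc i * n))) * cis (- g)) sums (of_real (real m powr (- a)) * cis (- g))"
        by (intro sums_mult2 sums_of_real) simp
      then show ?thesis using s1 sums_unique2 by blast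
    qed
    show "\<exists>K. K \<in> borel_measurable borel \<and> opbd (\<lambda>t. ennreal \<bar>K t\<bar>) (ennreal (A / (1 - p) / real n powr a)) \<and>
      (\<forall>m\<ge>n. kc K m = of_real (real m powr (- a)) * cis (- g))"
      using Km op kcinf by blast
  qed
qed

end

text \<open>The identity holds for all x, so evaluation at x = 0 and at x = pi / (2 j) isolates the
  two coefficients; together they say that differentiation multiplies coefficient j by the principal
  value of (i j)^\<alpha>.\<close>

lemma fc_weyl_derivative:
  assumes d: "has_weyl_derivative f \<alpha> g" and a: "0 < \<alpha>"
    and f: "f \<in> borel_measurable lebesgue" "L1 f0" "AE x in lborel. f x = f0 x"
    and g0: "L1 g0" "AE x in lborel. g x = g0 x"
  shows "fc g0 0 = 0" and "1 \<le> j \<Longrightarrow> fc g0 j = of_real (real j powr \<alpha>) * cis (\<alpha> * pi / 2) * fc f0 j"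
proof -
  have gm: "g \<in> borel_measurable lebesgue" using d a by (simp add: has_weyl_derivative_def)
  note fe = fourier_cos_eq[OF f] and ge = fourier_cos_eq[OF gm g0]
  have "fourier_cos g 0 = 0" using d a by (simp add: has_weyl_derivative_def)
  then show "fc g0 0 = 0" unfolding ge by (simp add: complex_eq_iff fc_def)
  assume j: "1 \<le> j"
  have j0: "0 < real j" using j by simp
  have *: "fourier_cos g j * cos (real j * x) + fourier_sin g j * sin (real j * x) =
     real j powr \<alpha> * (fourier_cos f j * cos (real j * x + \<alpha> * pi / 2) + fourier_sin f j * sin (real j * x + \<alpha> * pi / 2))" for x
  proof -
    have "real j * (x + \<alpha> * pi / (2 * real j)) = real j * x + \<alpha> * pi / 2" using j0 by (simp add: field_simps)
    then show ?thesis using d a j by (simp add: has_weyl_derivative_def)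
  qed
  define c s where "c = cos (\<alpha> * pi / 2)" and "s = sin (\<alpha> * pi / 2)"
  have c: "fourier_cos g j = real j powr \<alpha> * (fourier_cos f j * c + fourier_sin f j * s)"
    using *[of 0] by (simp add: c_def s_def)
  have e: "real j * (pi / (2 * real j)) = pi / 2" using j0 by simp
  have s: "fourier_sin g j = real j powr \<alpha> * (- fourier_cos f j * s + fourier_sin f j * c)"
    using *[of "pi / (2 * real j)", unfolded e] by (simp add: c_def s_def cos_add sin_add)
  show "fc g0 j = of_real (real j powr \<alpha>) * cis (\<alpha> * pi / 2) * fc f0 j"
  proof -
    have "Re (fc g0 j) = real j powr \<alpha> * (Re (fc f0 j) * c - Im (fc f0 j) * s)"
      using c unfolding fe ge by (simp add: field_simps)
    moreover have "Im (fc g0 j) = real j powr \<alpha> * (Re (fc f0 j) * s + Im (fc f0 j) * c)"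
      using s unfolding fe ge by (simp add: field_simps)
    ultimately show ?thesis by (simp add: complex_eq_iff c_def s_def algebra_simps)
  qed
qed

context orlicz_weight
begin

text \<open>For \<alpha> > 0 the given g is by definition merely integrable. It has the same
  coefficients, including the vanishing one at frequency 0, as the derivative that
  \<open>weyl_class\<close> provides in the space, and uniqueness makes the two equal almost
  everywhere.\<close>

lemma weyl_derivative_in_orlicz_space:
  assumes w: "AE x in lborel. w x = W x" and f: "f \<in> weyl_class \<phi> w \<alpha>" and d: "has_weyl_derivative f \<alpha> g" and a: "0 \<le> \<alpha>"
  shows "g \<in> orlicz_space \<phi> w"
proof (cases "\<alpha> = 0")
  case True
  then show ?thesis using f d by (simp add: weyl_class_def has_weyl_derivative_def)
next
  case False
  then have a0: "0 < \<alpha>" using a by simp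
  have fo: "f \<in> orlicz_space \<phi> w" using f by (simp add: weyl_class_def)
  then have fm: "f \<in> borel_measurable lebesgue" by (simp add: orlicz_space_def)
  obtain f0 where f0: "L1 f0" "AE x in lborel. f x = f0 x" using orlicz_space_version[OF w fo] by blast
  obtain h where h: "h \<in> orlicz_space \<phi> w" "has_weyl_derivative f \<alpha> h" using f by (auto simp: weyl_class_def)
  obtain h0 c where h0: "L1 h0" "AE x in lborel. h x = h0 x" and c: "0 < c" "tint (\<lambda>x. ennreal (\<phi> (c * \<bar>h0 x\<bar>) * W x)) < \<infinity>"
    using orlicz_space_version[OF w h(1)] by blast
  have g: "g \<in> borel_measurable lebesgue" "periodic2pi g" "set_integrable lebesgue torus g"
    using d False by (auto simp: has_weyl_derivative_def periodic_iff_periodic2pi)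
  obtain g0 where g0m: "g0 \<in> borel_measurable borel" and g0p: "periodic2pi g0" and g0a: "AE x in lborel. g x = g0 x"
    using periodic_borel_version[OF g(1,2)] by blast
  have g0: "L1 g0" using g(3) set_integral_lebesgue_torus(2)[OF g(1) g0m g0a, of "\<lambda>_. 0"] g0m g0p by (simp add: L1_def)
  have "fc g0 j = fc h0 j" for j
    using fc_weyl_derivative(1)[OF d a0 fm f0 g0 g0a] fc_weyl_derivative(1)[OF h(2) a0 fm f0 h0]
      fc_weyl_derivative(2)[OF d a0 fm f0 g0 g0a, of j] fc_weyl_derivative(2)[OF h(2) a0 fm f0 h0, of j]
    by (cases "j = 0") auto
  then have "AE x in lborel. g0 x - h0 x = 0" by (intro fc_eq_0_imp L1_diff g0 h0(1)) (simp add: fc_diff g0 h0(1))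
  then have gh: "AE x in lborel. g0 x = h0 x" by simp
  have "tint (\<lambda>x. ennreal (\<phi> (c * \<bar>g x\<bar>) * w x)) = tint (\<lambda>x. ennreal (\<phi> (c * \<bar>h0 x\<bar>) * W x))"
    by (rule tint_cong_AE) (use gh g0a w in eventually_elim, simp)
  then show ?thesis using g c by (auto simp: orlicz_space_def periodic_iff_periodic2pi nn_integral_lebesgue_on_torus)
qed

text \<open>Each of the two inversions is needed only above frequency n and may be taken as the
  identity when its parameter is 0, so that k = 0 and \<alpha> = 0 fit the same scheme.\<close>

lemma jackson_estimate:
  assumes w: "AE x in lborel. w x = W x" and a: "0 \<le> \<alpha>" and k: "0 \<le> k"
  shows "\<exists>C::real. 0 < C \<and>
    (\<forall>f \<in> weyl_class \<phi> w \<alpha>. \<forall>f\<alpha>. has_weyl_derivative f \<alpha> f\<alpha> \<longrightarrow>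
      (\<forall>n::nat. 1 \<le> n \<longrightarrow>
        best_approx \<phi> w n f \<le> ennreal (C / real n powr \<alpha>) * smoothness_modulus \<phi> w k f\<alpha> (1 / real n)))"
proof -
  have "\<exists>C>0. \<forall>n::nat\<ge>1. \<forall>g g0. g \<in> orlicz_space \<phi> w \<longrightarrow> L1 g0 \<longrightarrow> (AE x in lborel. g x = g0 x) \<longrightarrow>
     (\<exists>P. L1 P \<and> Nn (\<lambda>x. ennreal \<bar>P x\<bar>) \<le> ennreal C * smoothness_modulus \<phi> w k g (1 / real n) \<and> (\<forall>m>n. fc P m = fc g0 m))"
  proof (cases "k = 0")
    case True
    then show ?thesis
      by (intro exI[of _ 1]) (auto simp: smoothness_modulus_def orlicz_norm_eq_Nn[OF w])
  next
    case False
    then have k0: "0 < k" using k by simp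
    obtain C where C: "0 < C" and inv: "\<forall>n\<ge>1. \<forall>G g0. L1 G \<longrightarrow> L1 g0 \<longrightarrow> 
     (\<forall>m\<ge>1. fc G m = of_real ((1 - sin (real m * (1 / real n) / 2) / (real m * (1 / real n) / 2)) powr k) * fc g0 m) \<longrightarrow>
     (\<exists>P. L1 P \<and> Nn (\<lambda>x. ennreal \<bar>P x\<bar>) \<le> ennreal C * Nn (\<lambda>x. ennreal \<bar>G x\<bar>) \<and> (\<forall>m>n. fc P m = fc g0 m))"
      using difference_inversion[OF k0] by (elim exE conjE)
    show ?thesis
    proof (rule exI[of _ C], intro conjI allI impI C)
      fix n :: nat and g g0
      assume n: "1 \<le> n" and g: "g \<in> orlicz_space \<phi> w" "L1 g0" "AE x in lborel. g x = g0 x"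
      have h: "0 < 1 / real n" "1 / real n \<le> 1" using n by auto
      obtain G where G: "L1 G" "\<forall>m\<ge>1. fc G m = of_real ((1 - sin (real m * (1 / real n) / 2) / (real m * (1 / real n) / 2)) powr k) * fc g0 m"
        "Nn (\<lambda>x. ennreal \<bar>G x\<bar>) \<le> orlicz_norm \<phi> w (frac_difference \<phi> w k (1 / real n) g)"
        using frac_difference_lower[OF w g k0 h] by blast
      have "orlicz_norm \<phi> w (frac_difference \<phi> w k (1 / real n) g) \<le> smoothness_modulus \<phi> w k g (1 / real n)"
        using False h unfolding smoothness_modulus_def by (auto intro: SUP_upper)
      with G(3) have le: "Nn (\<lambda>x. ennreal \<bar>G x\<bar>) \<le> smoothness_modulus \<phi> w k g (1 / real n)" by (rule order_trans)
      obtain P where P: "L1 P" "Nn (\<lambda>x. ennreal \<bar>P x\<bar>) \<le> ennreal C * Nn (\<lambda>x. ennreal \<bar>G x\<bar>)" "\<forall>m>n. fc P m = fc g0 m"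
        using inv[THEN spec, THEN mp, OF n, THEN spec, THEN spec, THEN mp, OF G(1), THEN mp, OF g(2), THEN mp, OF G(2)] by blast
      have "Nn (\<lambda>x. ennreal \<bar>P x\<bar>) \<le> ennreal C * smoothness_modulus \<phi> w k g (1 / real n)"
        by (rule order_trans[OF P(2) mult_left_mono[OF le]]) simp
      then show "\<exists>P. L1 P \<and> Nn (\<lambda>x. ennreal \<bar>P x\<bar>) \<le> ennreal C * smoothness_modulus \<phi> w k g (1 / real n) \<and> (\<forall>m>n. fc P m = fc g0 m)"
        using P by blast
    qed
  qed
  then obtain C1 where C1: "0 < C1" and step1: "\<forall>n::nat\<ge>1. \<forall>g g0. g \<in> orlicz_space \<phi> w \<longrightarrow> L1 g0 \<longrightarrow> (AE x in lborel. g x = g0 x) \<longrightarrow>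
     (\<exists>P. L1 P \<and> Nn (\<lambda>x. ennreal \<bar>P x\<bar>) \<le> ennreal C1 * smoothness_modulus \<phi> w k g (1 / real n) \<and> (\<forall>m>n. fc P m = fc g0 m))"
    by (elim exE conjE)
  have "\<exists>C>0. \<forall>n::nat\<ge>1. \<forall>P. L1 P \<longrightarrow> (\<exists>J. L1 J \<and> Nn (\<lambda>x. ennreal \<bar>J x\<bar>) \<le> ennreal (C / real n powr \<alpha>) * Nn (\<lambda>x. ennreal \<bar>P x\<bar>) \<and>
      (\<forall>m>n. of_real (real m powr \<alpha>) * cis (\<alpha> * pi / 2) * fc J m = fc P m))"
  proof (cases "\<alpha> = 0")
    case True
    then show ?thesis by (intro exI[of _ 1]) auto
  next
    case False
    then have a0: "0 < \<alpha>" using a by simp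
    obtain C where C: "0 < C" and fi: "\<And>n::nat. 1 \<le> n \<Longrightarrow> \<exists>K. K \<in> borel_measurable borel \<and> opbd (\<lambda>t. ennreal \<bar>K t\<bar>) (ennreal (C / real n powr \<alpha>)) \<and>
      (\<forall>m\<ge>n. kc K m = of_real (real m powr (- \<alpha>)) * cis (- (\<alpha> * pi / 2)))"
      using fractional_integral[OF a0, of "\<alpha> * pi / 2"] by blast
    show ?thesis
    proof (rule exI[of _ C], intro conjI allI impI C)
      fix n :: nat and P assume n: "1 \<le> n" and P: "L1 P"
      obtain K where K: "K \<in> borel_measurable borel" "opbd (\<lambda>t. ennreal \<bar>K t\<bar>) (ennreal (C / real n powr \<alpha>))"
        "\<forall>m\<ge>n. kc K m = of_real (real m powr (- \<alpha>)) * cis (- (\<alpha> * pi / 2))" using fi[OF n] by blast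
      have Ki: "integrable lborel K" by (rule opbd_integrable[OF K(1,2)])
      have "of_real (real m powr \<alpha>) * cis (\<alpha> * pi / 2) * fc (rconv K P) m = fc P m" if m: "n < m" for m
      proof -
        have "of_real (real m powr \<alpha>) * cis (\<alpha> * pi / 2) * fc (rconv K P) m
          = of_real (real m powr \<alpha> * real m powr (- \<alpha>)) * (cis (\<alpha> * pi / 2) * cis (- (\<alpha> * pi / 2))) * fc P m"
          using K(3) m unfolding rconv_L1(2)[OF Ki P] by (simp add: mult_ac)
        also have "real m powr \<alpha> * real m powr (- \<alpha>) = 1" using m by (simp flip: powr_add)
        also have "cis (\<alpha> * pi / 2) * cis (- (\<alpha> * pi / 2)) = 1" by (simp add: cis_mult)
        finally show ?thesis by simp
      qed
      then show "\<exists>J. L1 J \<and> Nn (\<lambda>x. ennreal \<bar>J x\<bar>) \<le> ennreal (C / real n powr \<alpha>) * Nn (\<lambda>x. ennreal \<bar>P x\<bar>) \<and>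
        (\<forall>m>n. of_real (real m powr \<alpha>) * cis (\<alpha> * pi / 2) * fc J m = fc P m)"
        using rconv_L1(1)[OF Ki P] Nn_rconv[OF K(2) P] by blast
    qed
  qed
  then obtain C2 where C2: "0 < C2" and step2: "\<forall>n::nat\<ge>1. \<forall>P. L1 P \<longrightarrow> (\<exists>J. L1 J \<and> Nn (\<lambda>x. ennreal \<bar>J x\<bar>) \<le> ennreal (C2 / real n powr \<alpha>) * Nn (\<lambda>x. ennreal \<bar>P x\<bar>) \<and>
      (\<forall>m>n. of_real (real m powr \<alpha>) * cis (\<alpha> * pi / 2) * fc J m = fc P m))"
    by (elim exE conjE)
  show ?thesis
  proof (rule exI[of _ "C2 * C1"], intro conjI ballI allI impI)
    show "0 < C2 * C1" using C1 C2 by simp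
    fix f g and n :: nat
    assume f: "f \<in> weyl_class \<phi> w \<alpha>" and d: "has_weyl_derivative f \<alpha> g" and n: "1 \<le> n"
    have fo: "f \<in> orlicz_space \<phi> w" using f by (simp add: weyl_class_def)
    then have fm: "f \<in> borel_measurable lebesgue" by (simp add: orlicz_space_def)
    obtain f0 where f0: "L1 f0" "AE x in lborel. f x = f0 x" using orlicz_space_version[OF w fo] by blast
    have g: "g \<in> orlicz_space \<phi> w" by (rule weyl_derivative_in_orlicz_space[OF w f d a])
    obtain g0 where g0: "L1 g0" "AE x in lborel. g x = g0 x" using orlicz_space_version[OF w g] by blast
    have fg: "fc g0 m = of_real (real m powr \<alpha>) * cis (\<alpha> * pi / 2) * fc f0 m" if m: "1 \<le> m" for m
    proof (cases "\<alpha> = 0")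
      case True
      then have "g = f" using d by (simp add: has_weyl_derivative_def)
      then have "AE x in lborel. g0 x = f0 x" using f0(2) g0(2) by (auto elim: eventually_elim2)
      then have "AE x in torusM. g0 x = f0 x" by (rule AE_torusM)
      then have "fc g0 m = fc f0 m"
        unfolding fc_def using L1_borel[OF f0(1)] L1_borel[OF g0(1)] by (intro integral_cong_AE) (auto elim: eventually_mono)
      then show ?thesis using True m by simp
    next
      case False
      then show ?thesis using fc_weyl_derivative(2)[OF d _ fm f0 g0 m] a by simp
    qed
    obtain P where P: "L1 P" "Nn (\<lambda>x. ennreal \<bar>P x\<bar>) \<le> ennreal C1 * smoothness_modulus \<phi> w k g (1 / real n)" "\<forall>m>n. fc P m = fc g0 m"
      using step1[THEN spec, THEN mp, OF n, THEN spec, THEN spec, THEN mp, OF g, THEN mp, OF g0(1), THEN mp, OF g0(2)] by blast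
    obtain J where J: "L1 J" "Nn (\<lambda>x. ennreal \<bar>J x\<bar>) \<le> ennreal (C2 / real n powr \<alpha>) * Nn (\<lambda>x. ennreal \<bar>P x\<bar>)"
      "\<forall>m>n. of_real (real m powr \<alpha>) * cis (\<alpha> * pi / 2) * fc J m = fc P m" using step2[THEN spec, THEN mp, OF n, THEN spec, THEN mp, OF P(1)] by blast
    have "fc (\<lambda>x. f0 x - J x) m = 0" if m: "n < m" for m
    proof -
      have m1: "1 \<le> m" using m by simp
      \<comment> \<open>The multiplier of the derivative does not vanish for m \<ge> 1 and can be
        cancelled, so J and f0 share all coefficients above n.\<close>
      have "of_real (real m powr \<alpha>) * cis (\<alpha> * pi / 2) * fc J m = of_real (real m powr \<alpha>) * cis (\<alpha> * pi / 2) * fc f0 m"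
        using J(3) P(3) fg[OF m1] m by simp
      then have "fc J m = fc f0 m" using m by simp
      then show ?thesis by (simp add: fc_diff f0(1) J(1))
    qed
    then obtain T where T: "T \<in> trig_polys n" "AE x in lborel. f0 x - J x = T x"
      using finite_spectrum_trig_poly[OF L1_diff[OF f0(1) J(1)]] by blast
    have ae: "AE x in lborel. f x - T x = J x" using T(2) f0(2) by eventually_elim simp
    have "best_approx \<phi> w n f \<le> orlicz_norm \<phi> w (\<lambda>x. f x - T x)"
      unfolding best_approx_def by (rule INF_lower[OF T(1)])
    also have "\<dots> = Nn (\<lambda>x. ennreal \<bar>J x\<bar>)" by (rule orlicz_norm_eq_Nn[OF w ae])
    also have "\<dots> \<le> ennreal (C2 / real n powr \<alpha>) * Nn (\<lambda>x. ennreal \<bar>P x\<bar>)" by (rule J(2))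
    also have "\<dots> \<le> ennreal (C2 / real n powr \<alpha>) * (ennreal C1 * smoothness_modulus \<phi> w k g (1 / real n))"
      by (intro mult_left_mono P(2)) simp
    also have "\<dots> = ennreal (C2 * C1 / real n powr \<alpha>) * smoothness_modulus \<phi> w k g (1 / real n)"
      using C1 by (simp add: mult.assoc[symmetric] ennreal_mult''[symmetric])
    finally show "best_approx \<phi> w n f \<le> ennreal (C2 * C1 / real n powr \<alpha>) * smoothness_modulus \<phi> w k g (1 / real n)" .
  qed
qed

end

theorem theorem5p3:
  fixes \<alpha> k :: real and \<phi> W :: "real \<Rightarrow> real"
  assumes "0 \<le> \<alpha>" and "0 \<le> k"
    and "\<phi> \<in> class_Q"
    and "W \<in> muckenhoupt (young_index \<phi>)"
  shows "\<exists>C::real. 0 < C \<and>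
    (\<forall>f \<in> weyl_class \<phi> W \<alpha>. \<forall>f\<alpha>. has_weyl_derivative f \<alpha> f\<alpha> \<longrightarrow>
      (\<forall>n::nat. 1 \<le> n \<longrightarrow>
        best_approx \<phi> W n f
          \<le> ennreal (C / real n powr \<alpha>) * smoothness_modulus \<phi> W k f\<alpha> (1 / real n)))"
proof -
  have "weight W" using assms(4) by (simp add: muckenhoupt_def)
  then obtain W0 where W0: "W0 \<in> borel_measurable borel" "periodic2pi W0" "\<And>x. 0 < W0 x" "AE x in lborel. W x = W0 x"
    using weight_borel_version by blast
  obtain B0 where B0: "ap_bound W0 (young_index \<phi>) B0" using muckenhoupt_ap_bound[OF assms(4) W0(1,4)] by blast
  obtain q B C0 where q: "1 < q" "ap_bound W0 q B" "1 \<le> C0"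
    and gr: "\<And>s x. 1 \<le> s \<Longrightarrow> 0 \<le> x \<Longrightarrow> s powr q * \<phi> (x / C0) \<le> \<phi> (s * x)"
    using class_Q_growth_exponent[OF assms(3) W0(1,3) B0] by blast
  have y: "young \<phi>" using assms(3) by (simp add: class_Q_def)
  have nn: "0 \<le> \<phi> x" for x using y by (simp add: young_def)
  have z: "\<phi> 0 = 0" using y by (simp add: young_def)
  interpret orlicz_weight \<phi> W0 q B C0
  proof
    show "\<phi> \<in> borel_measurable borel" using y by (auto simp: young_def intro: borel_measurable_continuous_onI)
    \<comment> \<open>Monotonicity is given on the open half-line; at x = 0 it follows from the
      value 0 and nonnegativity.\<close>
    show "\<phi> x \<le> \<phi> y'" if "0 \<le> x" "x \<le> y'" for x y'
      using y that nn z by (cases "x = 0") (auto simp: young_def mono_on_def)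
    have "filterlim \<phi> at_top at_top" using y by (simp add: young_def)
    then have "eventually (\<lambda>x. 0 < \<phi> x \<and> 0 < x) at_top"
      by (intro eventually_conj eventually_gt_at_top) (auto simp: filterlim_at_top_dense)
    then show "\<exists>x>0. 0 < \<phi> x" using eventually_happens'[OF trivial_limit_at_top_linorder] by blast
  qed (use W0 q gr nn z in \<open>auto simp: periodic2pi_def\<close>)
  show ?thesis by (rule jackson_estimate[OF W0(4) assms(1,2)])
qed

end
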